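(* Let $M$ be a supermanifold and let $H\in C^{\infty}(T^*M)$ be an odd function satisfying $(H,H)=0$ for the canonical Poisson bracket $(\cdot,\cdot)$ on $T^*M$. Let $r\in C^{\infty}(M)$ be an arbitrary even function, and define an odd function $H'\in C^{\infty}(T^*M)$ by $$H'(x,p):=H\Bigl(x,\,p+\frac{\partial r}{\partial x}\Bigr),$$ i.e. by substituting $p_a+\partial r/\partial x^a$ for $p_a$ in $H$. Then the following holds. \begin{enumerate} \item $(H',H')=0$. \item If $r$ satisfies the equation $$H\Bigl(x,\frac{\partial r}{\partial x}\Bigr)=0, \qquad ( * )$$ then $H'$ vanishes on the zero section $M\subset T^*M$. \item If $H$ is fiberwise quadratic, then equation $( * )$ takes the form $\{r,r\}_H=0$, where $\{\cdot,\cdot\}_H$ is the Schouten bracket on $C^{\infty}(M)$ defined by $H$; and if $r$ satisfies this equation, then $$H'=H+(H,r).$$ \end{enumerate}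
   Context: Everything is $\mathbb{Z}_2$-graded; the parity of an object is denoted by a tilde, and $\tilde a$ denotes the parity of the local coordinate $x^a$ on $M$. On $T^*M$ one uses coordinates $x^a,p_a$, where $p_a$ are the momenta conjugate to $x^a$ (of the same parity as $x^a$). Functions on $M$ are regarded as functions on $T^*M$ by pullback, and $M\subset T^*M$ is the zero section $p_a=0$. The canonical even Poisson bracket on $C^\infty(T^*M)$ is (left derivatives) $$(F,G)=(-1)^{\tilde F\tilde a}\left((-1)^{\tilde a}\frac{\partial F}{\partial p_a}\frac{\partial G}{\partial x^a}-\frac{\partial F}{\partial x^a}\frac{\partial G}{\partial p_a}\right).$$ $H$ is fiberwise quadratic if locally $H=\frac12 H^{ab}(x)p_bp_a$. The Schouten (odd Poisson) bracket on $C^\infty(M)$ defined by such an odd $H$ with $(H,H)=0$ is $\{f,g\}_H=((H,f),g)$. *)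

theory Defs
  imports "HOL-Analysis.Analysis"
begin

section \<open>Superfunctions on superdomains\<close>

text \<open>
  Coordinates are labelled by elements of a finite linearly ordered type; \<open>ev D\<close> and \<open>od D\<close> are
  the labels of the even and of the odd coordinates. Labels in neither set are unused, so every
  dimension \<open>n|m\<close> (including \<open>n = 0\<close> or \<open>m = 0\<close>) occurs for a suitable label type.
  Points of the body are vectors supported in \<open>ev D\<close>.
\<close>

record 'i sdim =
  ev :: "'i set"
  od :: "'i set"

definition coords :: "'i sdim \<Rightarrow> 'i set" where
  "coords D = ev D \<union> od D"

definition body_space :: "'i::finite sdim \<Rightarrow> (real ^ 'i) set" where
  "body_space D = {x. \<forall>i. i \<notin> ev D \<longrightarrow> x $ i = 0}"

text \<open>
  \<open>F S x\<close> is the coefficient at the body point \<open>x\<close> of the monomial \<open>\<xi>\<^sub>S\<close>, the product of the odd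
  coordinates with labels in \<open>S\<close> in increasing order. Only the values on a given domain matter.
\<close>

type_synonym 'i sfun = "'i set \<Rightarrow> real ^ 'i \<Rightarrow> real"

definition partial :: "'i::finite \<Rightarrow> (real ^ 'i \<Rightarrow> real) \<Rightarrow> real ^ 'i \<Rightarrow> real" where
  "partial i f x = deriv (\<lambda>t. f (x + t *\<^sub>R axis i 1)) 0"

definition partials :: "'i::finite list \<Rightarrow> (real ^ 'i \<Rightarrow> real) \<Rightarrow> real ^ 'i \<Rightarrow> real" where
  "partials is f = foldr partial is f"

text \<open>
  Smoothness on \<open>U\<close>, to be used for relatively open subsets \<open>U\<close> of the body space: the iterated
  partial derivatives of all orders are (Frechet) differentiable.
\<close>

definition smooth_fun_on :: "'i::finite sdim \<Rightarrow> (real ^ 'i) set \<Rightarrow> (real ^ 'i \<Rightarrow> real) \<Rightarrow> bool" where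
  "smooth_fun_on D U f \<longleftrightarrow> (\<forall>is. set is \<subseteq> ev D \<longrightarrow> partials is f differentiable_on U)"

definition superfun_on :: "'i::finite sdim \<Rightarrow> (real ^ 'i) set \<Rightarrow> 'i sfun \<Rightarrow> bool" where
  "superfun_on D U F \<longleftrightarrow>
     (\<forall>S. smooth_fun_on D U (F S)) \<and>
     (\<forall>S. \<not> S \<subseteq> od D \<longrightarrow> (\<forall>x\<in>U. F S x = 0))"

definition sfun_eq_on :: "(real ^ 'i::finite) set \<Rightarrow> 'i sfun \<Rightarrow> 'i sfun \<Rightarrow> bool" where
  "sfun_eq_on U F G \<longleftrightarrow> (\<forall>x\<in>U. \<forall>S. F S x = G S x)"

definition even_on :: "(real ^ 'i::finite) set \<Rightarrow> 'i sfun \<Rightarrow> bool" where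
  "even_on U F \<longleftrightarrow> (\<forall>x\<in>U. \<forall>S. odd (card S) \<longrightarrow> F S x = 0)"

definition odd_on :: "(real ^ 'i::finite) set \<Rightarrow> 'i sfun \<Rightarrow> bool" where
  "odd_on U F \<longleftrightarrow> (\<forall>x\<in>U. \<forall>S. even (card S) \<longrightarrow> F S x = 0)"

definition szero :: "'i::finite sfun" where
  "szero = (\<lambda>S x. 0)"

definition sone :: "'i::finite sfun" where
  "sone = (\<lambda>S x. if S = {} then 1 else 0)"

definition sadd :: "'i::finite sfun \<Rightarrow> 'i sfun \<Rightarrow> 'i sfun" where
  "sadd F G = (\<lambda>S x. F S x + G S x)"

definition sscale :: "real \<Rightarrow> 'i::finite sfun \<Rightarrow> 'i sfun" where
  "sscale c F = (\<lambda>S x. c * F S x)"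

definition ssum :: "('k \<Rightarrow> 'i::finite sfun) \<Rightarrow> 'k set \<Rightarrow> 'i sfun" where
  "ssum F A = (\<lambda>S x. \<Sum>k\<in>A. F k S x)"

text \<open>For disjoint \<open>S\<close> and \<open>T\<close>: \<open>\<xi>\<^sub>S \<xi>\<^sub>T = gsign S T \<xi>\<^sub>S\<^sub>\<union>\<^sub>T\<close>.\<close>

definition gsign :: "'i::linorder set \<Rightarrow> 'i set \<Rightarrow> real" where
  "gsign S T = (- 1) ^ card {(s, t). s \<in> S \<and> t \<in> T \<and> t < s}"

definition smul :: "'i::{finite,linorder} sfun \<Rightarrow> 'i sfun \<Rightarrow> 'i sfun" where
  "smul F G = (\<lambda>S x. \<Sum>R\<in>Pow S. gsign R (S - R) * F R x * G (S - R) x)"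

definition sprod :: "'i::{finite,linorder} sfun list \<Rightarrow> 'i sfun" where
  "sprod Fs = foldr smul Fs sone"

definition scoord :: "'i::finite sdim \<Rightarrow> 'i \<Rightarrow> 'i sfun" where
  "scoord D i = (\<lambda>S x. if i \<in> od D then (if S = {i} then 1 else 0)
                       else (if S = {} then x $ i else 0))"

definition sderiv :: "'i::{finite,linorder} sdim \<Rightarrow> 'i \<Rightarrow> 'i sfun \<Rightarrow> 'i sfun" where
  "sderiv D i F = (\<lambda>S x.
     if i \<in> od D then (if i \<in> S then 0 else gsign {i} S * F (insert i S) x)
     else partial i (F S) x)"


subsection \<open>Substitution of superfunctions for the coordinates\<close>

definition soul :: "'i::finite sfun \<Rightarrow> 'i sfun" where
  "soul F = (\<lambda>S x. if S = {} then 0 else F S x)"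

definition body_map :: "'i::finite sdim \<Rightarrow> ('i \<Rightarrow> 'j::finite sfun) \<Rightarrow> real ^ 'j \<Rightarrow> real ^ 'i" where
  "body_map D \<Phi> x = (\<chi> i. if i \<in> ev D then \<Phi> i {} x else 0)"

text \<open>
  An ordinary function of the even coordinates, evaluated at even superfunctions, is given by its
  Taylor expansion at the body. A product of more than \<open>CARD('j)\<close> souls vanishes, so that the
  finite sum is the whole expansion. Summing over lists with the factor \<open>1/l!\<close> amounts to summing
  over multi-indices \<open>k\<close> with the factor \<open>1/k!\<close>.
\<close>

definition taylor ::
  "'i::finite sdim \<Rightarrow> (real ^ 'i \<Rightarrow> real) \<Rightarrow> ('i \<Rightarrow> 'j::{finite,linorder} sfun) \<Rightarrow> 'j sfun" where
  "taylor D f \<Phi> = (\<lambda>R x. \<Sum>l\<le>CARD('j). \<Sum>is | set is \<subseteq> ev D \<and> length is = l.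
      1 / fact l * partials is f (body_map D \<Phi> x) * sprod (map (\<lambda>i. soul (\<Phi> i)) is) R x)"

text \<open>
  \<open>spull D F \<Phi>\<close> is \<open>F\<close> with \<open>\<Phi> i\<close> (of the parity of \<open>i\<close>) substituted for the \<open>i\<close>-th coordinate,
  i.e. the pullback of \<open>F\<close> along the morphism of superdomains with components \<open>\<Phi> i\<close>;
  \<open>D\<close> describes the target of that morphism, on which \<open>F\<close> lives.
\<close>

definition spull ::
  "'i::{finite,linorder} sdim \<Rightarrow> 'i sfun \<Rightarrow> ('i \<Rightarrow> 'j::{finite,linorder} sfun) \<Rightarrow> 'j sfun" where
  "spull D F \<Phi> = ssum (\<lambda>S. smul (taylor D (F S) \<Phi>) (sprod (map \<Phi> (sorted_list_of_set S)))) (Pow (od D))"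


section \<open>Supermanifolds\<close>

text \<open>
  A supermanifold is given by an atlas: a Hausdorff second countable space with charts onto
  open subsets of the body space, and coordinate changes that are morphisms of superdomains lifting
  the coordinate changes of the underlying manifold and satisfying the cocycle condition.
  \<open>trans M c d i\<close> is the \<open>i\<close>-th coordinate of the chart \<open>d\<close> as a superfunction of the coordinates
  of the chart \<open>c\<close>.
\<close>

record ('m, 'a, 'c) smfd =
  sdim :: "'a sdim"
  carrier_top :: "'m topology"
  charts :: "'c set"
  chart_dom :: "'c \<Rightarrow> 'm set"
  chart :: "'c \<Rightarrow> 'm \<Rightarrow> real ^ 'a"
  trans :: "'c \<Rightarrow> 'c \<Rightarrow> 'a \<Rightarrow> 'a sfun"

definition img :: "('m, 'a::finite, 'c) smfd \<Rightarrow> 'c \<Rightarrow> (real ^ 'a) set" where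
  "img M c = chart M c ` chart_dom M c"

definition overlap :: "('m, 'a::finite, 'c) smfd \<Rightarrow> 'c \<Rightarrow> 'c \<Rightarrow> (real ^ 'a) set" where
  "overlap M c d = chart M c ` (chart_dom M c \<inter> chart_dom M d)"

definition supermanifold :: "('m, 'a::{finite,linorder}, 'c) smfd \<Rightarrow> bool" where
  "supermanifold M \<longleftrightarrow>
     ev (sdim M) \<inter> od (sdim M) = {} \<and>
     Hausdorff_space (carrier_top M) \<and> second_countable (carrier_top M) \<and>
     (\<Union>c\<in>charts M. chart_dom M c) = topspace (carrier_top M) \<and>
     (\<forall>c\<in>charts M.
        openin (carrier_top M) (chart_dom M c) \<and>
        openin (top_of_set (body_space (sdim M))) (img M c) \<and>
        homeomorphic_map (subtopology (carrier_top M) (chart_dom M c)) (top_of_set (img M c)) (chart M c)) \<and>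
     (\<forall>c\<in>charts M. \<forall>d\<in>charts M.
        (\<forall>i\<in>ev (sdim M).
           superfun_on (sdim M) (overlap M c d) (trans M c d i) \<and>
           even_on (overlap M c d) (trans M c d i) \<and>
           (\<forall>q\<in>chart_dom M c \<inter> chart_dom M d. trans M c d i {} (chart M c q) = chart M d q $ i)) \<and>
        (\<forall>i\<in>od (sdim M).
           superfun_on (sdim M) (overlap M c d) (trans M c d i) \<and>
           odd_on (overlap M c d) (trans M c d i))) \<and>
     (\<forall>c\<in>charts M. \<forall>i\<in>coords (sdim M).
        sfun_eq_on (img M c) (trans M c c i) (scoord (sdim M) i)) \<and>
     (\<forall>c\<in>charts M. \<forall>d\<in>charts M. \<forall>e\<in>charts M. \<forall>i\<in>coords (sdim M).
        sfun_eq_on (chart M c ` (chart_dom M c \<inter> chart_dom M d \<inter> chart_dom M e))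
          (trans M c e i) (spull (sdim M) (trans M d e i) (trans M c d)))"

definition smooth_functions :: "('m, 'a::{finite,linorder}, 'c) smfd \<Rightarrow> ('c \<Rightarrow> 'a sfun) set" where
  "smooth_functions M = {f.
     (\<forall>c\<in>charts M. superfun_on (sdim M) (img M c) (f c)) \<and>
     (\<forall>c\<in>charts M. \<forall>d\<in>charts M.
        sfun_eq_on (overlap M c d) (f c) (spull (sdim M) (f d) (trans M c d)))}"

definition fun_even :: "('m, 'a::finite, 'c) smfd \<Rightarrow> ('c \<Rightarrow> 'a sfun) \<Rightarrow> bool" where
  "fun_even M f \<longleftrightarrow> (\<forall>c\<in>charts M. even_on (img M c) (f c))"

definition fun_eq :: "('m, 'a::finite, 'c) smfd \<Rightarrow> ('c \<Rightarrow> 'a sfun) \<Rightarrow> ('c \<Rightarrow> 'a sfun) \<Rightarrow> bool" where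
  "fun_eq M f g \<longleftrightarrow> (\<forall>c\<in>charts M. sfun_eq_on (img M c) (f c) (g c))"


section \<open>The cotangent bundle\<close>

text \<open>\<open>Pos a\<close> labels the coordinate \<open>x\<^sup>a\<close>, and \<open>Mom a\<close> the conjugate momentum \<open>p\<^sub>a\<close>.\<close>

datatype 'a cot = Pos 'a | Mom 'a

instance cot :: (finite) finite
proof
  have "(UNIV :: 'a cot set) = range Pos \<union> range Mom"
    by (metis UNIV_eq_I UnCI cot.exhaust rangeI)
  then show "finite (UNIV :: 'a cot set)"
    by (metis finite_UnI finite_imageI finite)
qed

instantiation cot :: (linorder) linorder
begin

definition less_eq_cot :: "'a cot \<Rightarrow> 'a cot \<Rightarrow> bool" where
  "less_eq_cot u v = (case u of
      Pos a \<Rightarrow> (case v of Pos b \<Rightarrow> a \<le> b | Mom b \<Rightarrow> True)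
    | Mom a \<Rightarrow> (case v of Pos b \<Rightarrow> False | Mom b \<Rightarrow> a \<le> b))"

definition less_cot :: "'a cot \<Rightarrow> 'a cot \<Rightarrow> bool" where
  "less_cot u v \<longleftrightarrow> u \<le> v \<and> \<not> v \<le> u"

instance
  by standard (auto simp: less_eq_cot_def less_cot_def split: cot.splits)

end

definition cot_dim :: "'a sdim \<Rightarrow> 'a cot sdim" where
  "cot_dim D = \<lparr>ev = Pos ` ev D \<union> Mom ` ev D, od = Pos ` od D \<union> Mom ` od D\<rparr>"

definition cot_dom :: "'a::finite sdim \<Rightarrow> (real ^ 'a) set \<Rightarrow> (real ^ 'a cot) set" where
  "cot_dom D U = {z \<in> body_space (cot_dim D). (\<chi> i. z $ Pos i) \<in> U}"

text \<open>Pullback along the bundle projection.\<close>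

definition cot_pull :: "'a::{finite,linorder} sdim \<Rightarrow> 'a sfun \<Rightarrow> 'a cot sfun" where
  "cot_pull D f = spull D f (\<lambda>i. scoord (cot_dim D) (Pos i))"

text \<open>
  Momenta transform as the partial derivatives: if the charts \<open>c\<close> and \<open>d\<close> have coordinates \<open>x\<close>
  and \<open>x'\<close>, then \<open>p'\<^sub>b\<close> is the sum over \<open>a\<close> of \<open>(\<partial>x\<^sup>a/\<partial>x'\<^sup>b) p\<^sub>a\<close>.
\<close>

definition cot_trans ::
  "('m, 'a::{finite,linorder}, 'c) smfd \<Rightarrow> 'c \<Rightarrow> 'c \<Rightarrow> 'a cot \<Rightarrow> 'a cot sfun" where
  "cot_trans M c d u = (case u of
      Pos i \<Rightarrow> cot_pull (sdim M) (trans M c d i)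
    | Mom b \<Rightarrow> ssum (\<lambda>a.
        smul (cot_pull (sdim M) (spull (sdim M) (sderiv (sdim M) b (trans M d c a)) (trans M c d)))
             (scoord (cot_dim (sdim M)) (Mom a))) (coords (sdim M)))"

definition cot_functions :: "('m, 'a::{finite,linorder}, 'c) smfd \<Rightarrow> ('c \<Rightarrow> 'a cot sfun) set" where
  "cot_functions M = {F.
     (\<forall>c\<in>charts M. superfun_on (cot_dim (sdim M)) (cot_dom (sdim M) (img M c)) (F c)) \<and>
     (\<forall>c\<in>charts M. \<forall>d\<in>charts M.
        sfun_eq_on (cot_dom (sdim M) (overlap M c d))
          (F c) (spull (cot_dim (sdim M)) (F d) (cot_trans M c d)))}"

definition cot_odd :: "('m, 'a::{finite,linorder}, 'c) smfd \<Rightarrow> ('c \<Rightarrow> 'a cot sfun) \<Rightarrow> bool" where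
  "cot_odd M F \<longleftrightarrow> (\<forall>c\<in>charts M. odd_on (cot_dom (sdim M) (img M c)) (F c))"

definition cot_eq ::
  "('m, 'a::{finite,linorder}, 'c) smfd \<Rightarrow> ('c \<Rightarrow> 'a cot sfun) \<Rightarrow> ('c \<Rightarrow> 'a cot sfun) \<Rightarrow> bool" where
  "cot_eq M F G \<longleftrightarrow> (\<forall>c\<in>charts M. sfun_eq_on (cot_dom (sdim M) (img M c)) (F c) (G c))"

definition lift :: "('m, 'a::{finite,linorder}, 'c) smfd \<Rightarrow> ('c \<Rightarrow> 'a sfun) \<Rightarrow> 'c \<Rightarrow> 'a cot sfun" where
  "lift M f = (\<lambda>c. cot_pull (sdim M) (f c))"


subsection \<open>The canonical Poisson bracket\<close>

text \<open>
  \<open>twist D a F\<close> is \<open>F\<close> times the sign with exponent (parity of \<open>F\<close>) times (parity of \<open>x\<^sup>a\<close>),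
  for homogeneous \<open>F\<close>, and is extended to all \<open>F\<close> by linearity.
\<close>

definition par_sign :: "'a sdim \<Rightarrow> 'a \<Rightarrow> real" where
  "par_sign D a = (if a \<in> od D then - 1 else 1)"

definition twist :: "'a::finite sdim \<Rightarrow> 'a \<Rightarrow> 'a cot sfun \<Rightarrow> 'a cot sfun" where
  "twist D a F = (\<lambda>S x. (if a \<in> od D \<and> odd (card S) then - 1 else 1) * F S x)"

definition poisson :: "'a::{finite,linorder} sdim \<Rightarrow> 'a cot sfun \<Rightarrow> 'a cot sfun \<Rightarrow> 'a cot sfun" where
  "poisson D F G = ssum (\<lambda>a.
     sadd (sscale (par_sign D a)
            (smul (sderiv (cot_dim D) (Mom a) (twist D a F)) (sderiv (cot_dim D) (Pos a) G)))
          (sscale (- 1)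
            (smul (sderiv (cot_dim D) (Pos a) (twist D a F)) (sderiv (cot_dim D) (Mom a) G))))
     (coords D)"

definition poisson_bracket ::
  "('m, 'a::{finite,linorder}, 'c) smfd \<Rightarrow> ('c \<Rightarrow> 'a cot sfun) \<Rightarrow> ('c \<Rightarrow> 'a cot sfun) \<Rightarrow> 'c \<Rightarrow> 'a cot sfun"
where
  "poisson_bracket M F G = (\<lambda>c. poisson (sdim M) (F c) (G c))"

text \<open>A function on \<open>T\<^sup>*M\<close>; for fiberwise quadratic \<open>H\<close> it is the pullback of one on \<open>M\<close>.\<close>

definition schouten_bracket ::
  "('m, 'a::{finite,linorder}, 'c) smfd \<Rightarrow> ('c \<Rightarrow> 'a cot sfun) \<Rightarrow> ('c \<Rightarrow> 'a sfun) \<Rightarrow> ('c \<Rightarrow> 'a sfun) \<Rightarrow> 'c \<Rightarrow> 'a cot sfun"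
where
  "schouten_bracket M H f g = poisson_bracket M (poisson_bracket M H (lift M f)) (lift M g)"

definition fiberwise_quadratic ::
  "('m, 'a::{finite,linorder}, 'c) smfd \<Rightarrow> ('c \<Rightarrow> 'a cot sfun) \<Rightarrow> bool" where
  "fiberwise_quadratic M H \<longleftrightarrow> (\<forall>c\<in>charts M. \<exists>h :: 'a \<Rightarrow> 'a \<Rightarrow> 'a sfun.
     (\<forall>a\<in>coords (sdim M). \<forall>b\<in>coords (sdim M). superfun_on (sdim M) (img M c) (h a b)) \<and>
     sfun_eq_on (cot_dom (sdim M) (img M c)) (H c)
       (sscale (1 / 2) (ssum (\<lambda>(a, b).
          smul (cot_pull (sdim M) (h a b))
            (smul (scoord (cot_dim (sdim M)) (Mom b)) (scoord (cot_dim (sdim M)) (Mom a))))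
          (coords (sdim M) \<times> coords (sdim M)))))"


subsection \<open>Shifting the momenta by a differential\<close>

text \<open>\<open>H(x, p + \<partial>r/\<partial>x)\<close> as a function on the cotangent bundle.\<close>

definition shift_momenta ::
  "('m, 'a::{finite,linorder}, 'c) smfd \<Rightarrow> ('c \<Rightarrow> 'a cot sfun) \<Rightarrow> ('c \<Rightarrow> 'a sfun) \<Rightarrow> 'c \<Rightarrow> 'a cot sfun"
where
  "shift_momenta M H r = (\<lambda>c. spull (cot_dim (sdim M)) (H c)
     (\<lambda>u. case u of
        Pos a \<Rightarrow> scoord (cot_dim (sdim M)) (Pos a)
      | Mom a \<Rightarrow> sadd (scoord (cot_dim (sdim M)) (Mom a))
                      (cot_pull (sdim M) (sderiv (sdim M) a (r c)))))"

text \<open>\<open>H(x, \<partial>r/\<partial>x)\<close> as a function on \<open>M\<close>.\<close>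

definition at_differential ::
  "('m, 'a::{finite,linorder}, 'c) smfd \<Rightarrow> ('c \<Rightarrow> 'a cot sfun) \<Rightarrow> ('c \<Rightarrow> 'a sfun) \<Rightarrow> 'c \<Rightarrow> 'a sfun"
where
  "at_differential M H r = (\<lambda>c. spull (cot_dim (sdim M)) (H c)
     (\<lambda>u. case u of
        Pos a \<Rightarrow> scoord (sdim M) a
      | Mom a \<Rightarrow> sderiv (sdim M) a (r c)))"

definition zero_section_restrict ::
  "('m, 'a::{finite,linorder}, 'c) smfd \<Rightarrow> ('c \<Rightarrow> 'a cot sfun) \<Rightarrow> 'c \<Rightarrow> 'a sfun"
where
  "zero_section_restrict M F = (\<lambda>c. spull (cot_dim (sdim M)) (F c)
     (\<lambda>u. case u of Pos a \<Rightarrow> scoord (sdim M) a | Mom a \<Rightarrow> szero))"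

end

theory Submission
  imports Defs
begin

text \<open>
  Substitution of superfunctions is controlled by the Euler field, which multiplies each monomial
  \<open>\<xi>\<^sub>S\<close> by its degree: the Euler derivative of \<open>F(\<Phi>)\<close> is \<open>\<Sum>\<^sub>i E(\<Phi>\<^sub>i) (\<partial>\<^sub>iF)(\<Phi>)\<close>, and an element of a
  Grassmann algebra is determined by its Euler derivative and its body. Since \<open>E(\<Phi>\<^sub>i)\<close> is nilpotent,
  induction on the degree turns this rule into multiplicativity of pullbacks, the chain rule and
  functoriality, and these reduce invariance of the shift under coordinate changes to the
  transformation law of \<open>\<partial>r/\<partial>x\<close>.

  In a chart, the shift changes \<open>\<partial>H/\<partial>x\<^sup>a\<close> by the sum of \<open>(\<partial>\<^sub>a\<partial>\<^sub>br) \<partial>H/\<partial>p\<^sub>b\<close>, and graded symmetry of the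
  second derivatives makes the shift preserve the Poisson bracket. Bracketing with \<open>r\<close> is the even
  derivation \<open>\<delta> = \<Sum>\<^sub>a (\<partial>\<^sub>ar) \<partial>/\<partial>p\<^sub>a\<close>; for fiberwise quadratic \<open>H\<close> one has \<open>\<delta>\<delta>H = 2 H(x, \<partial>r/\<partial>x)\<close> and
  \<open>H(x, p + \<partial>r/\<partial>x) = H + \<delta>H + \<delta>\<delta>H/2\<close>.
\<close>

section \<open>Finite-dimensional Grassmann algebras\<close>

text \<open>Taylor sums are awkward to multiply and to compose: expansions have to be re-expanded
  and the signs of odd monomials tracked. The Euler field avoids this because it treats even and odd
  coordinates by one rule, and the Taylor formula is opened only for that rule and for elementary
  facts about body, parity and scaling. Its blind spot is degree zero, since it kills the body; each
  comparison therefore also needs an equation of ordinary functions, and for the chain rule this is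
  the classical chain rule.

  Superfunctions matter only on a domain that is open relative to the body space. Hence identities
  are not equations between functions: they are stated for the values \<open>val F x\<close> with
  \<open>x\<close> in the domain, where the ring laws of \<open>gr\<close> apply, and
  differentiability is meant within the domain. Signs are governed by Boolean parities, through
  \<open>gpar\<close> for moving past an arbitrary element and \<open>kos\<close> for moving past a
  homogeneous one, so that most arguments need no case split into even and odd coordinates.\<close>

lemma gsign_un_left:
  fixes A B C :: "'i::{finite,linorder} set"
  assumes "A \<inter> B = {}" shows "gsign (A \<union> B) C = gsign A C * gsign B C"
proof -
  have "{(s, t). s \<in> A \<union> B \<and> t \<in> C \<and> t < s} =
      {(s, t). s \<in> A \<and> t \<in> C \<and> t < s} \<union> {(s, t). s \<in> B \<and> t \<in> C \<and> t < s}" by auto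
  then have "card {(s, t). s \<in> A \<union> B \<and> t \<in> C \<and> t < s} =
      card {(s, t). s \<in> A \<and> t \<in> C \<and> t < s} + card {(s, t). s \<in> B \<and> t \<in> C \<and> t < s}"
    using assms by (simp, intro card_Un_disjoint) auto
  then show ?thesis by (simp add: gsign_def power_add)
qed

lemma gsign_un_right:
  fixes A B C :: "'i::{finite,linorder} set"
  assumes "B \<inter> C = {}" shows "gsign A (B \<union> C) = gsign A B * gsign A C"
proof -
  have "{(s, t). s \<in> A \<and> t \<in> B \<union> C \<and> t < s} =
      {(s, t). s \<in> A \<and> t \<in> B \<and> t < s} \<union> {(s, t). s \<in> A \<and> t \<in> C \<and> t < s}" by auto
  then have "card {(s, t). s \<in> A \<and> t \<in> B \<union> C \<and> t < s} =
      card {(s, t). s \<in> A \<and> t \<in> B \<and> t < s} + card {(s, t). s \<in> A \<and> t \<in> C \<and> t < s}"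
    using assms by (simp, intro card_Un_disjoint) auto
  then show ?thesis by (simp add: gsign_def power_add)
qed

text \<open>Each pair of \<open>A \<times> B\<close> is an inversion in exactly one of the two
  orders; disjointness rules out ties. So the two inversion counts add up to
  \<open>card A * card B\<close>.\<close>

lemma gsign_swap:
  fixes A B :: "'i::{finite,linorder} set"
  assumes "A \<inter> B = {}" shows "gsign A B * gsign B A = (- 1) ^ (card A * card B)"
proof -
  let ?X = "{(s, t). s \<in> A \<and> t \<in> B \<and> t < s}" and ?Y = "{(s, t). s \<in> B \<and> t \<in> A \<and> t < s}"
  have "card ?Y = card (prod.swap ` ?Y)" by (rule card_image [symmetric]) auto
  moreover have "prod.swap ` ?Y = {(s, t). s \<in> A \<and> t \<in> B \<and> s < t}" by force
  ultimately have "card ?X + card ?Y = card (?X \<union> {(s, t). s \<in> A \<and> t \<in> B \<and> s < t})"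
    by (subst card_Un_disjoint) auto
  also have "?X \<union> {(s, t). s \<in> A \<and> t \<in> B \<and> s < t} = A \<times> B"
    using assms by (auto simp: not_less_iff_gr_or_eq)
  finally show ?thesis by (simp add: gsign_def card_cartesian_product flip: power_add)
qed

lemma gsign_empty [simp]: "gsign {} S = 1" "gsign S {} = 1"
  by (auto simp: gsign_def)

lemma gsign_square [simp]: "gsign A B * gsign A B = 1"
  by (simp add: gsign_def flip: power_add mult_2)

lemma gsign_square_left [simp]: "gsign A B * (gsign A B * c) = c"
  by (simp flip: mult.assoc)

text \<open>
  The values of superfunctions at points of the body are taken in this algebra; \<open>gc a S\<close> is the
  coefficient of the monomial \<open>\<xi>\<^sub>S\<close>.
\<close>

typedef 'i gr = "UNIV :: ('i set \<Rightarrow> real) set" morphisms gc Gr by simp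

lemma gc_Gr [simp]: "gc (Gr f) = f" by (simp add: Gr_inverse)

lemma gr_eqI: "(\<And>S. gc a S = gc b S) \<Longrightarrow> a = b"
  by (simp add: ext gc_inject [symmetric])

instantiation gr :: (type) real_vector
begin
definition "0 = Gr (\<lambda>S. 0)"
definition "a + b = Gr (\<lambda>S. gc a S + gc b S)"
definition "a - b = Gr (\<lambda>S. gc a S - gc b S)"
definition "- a = Gr (\<lambda>S. - gc a S)"
definition "c *\<^sub>R a = Gr (\<lambda>S. c * gc a S)"
instance
  by standard (auto intro!: gr_eqI simp: zero_gr_def plus_gr_def minus_gr_def uminus_gr_def
      scaleR_gr_def algebra_simps)
end

lemma gc_linear [simp]:
  "gc 0 S = 0" "gc (a + b) S = gc a S + gc b S" "gc (a - b) S = gc a S - gc b S"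
  "gc (- a) S = - gc a S" "gc (c *\<^sub>R a) S = c * gc a S"
  by (auto simp: zero_gr_def plus_gr_def minus_gr_def uminus_gr_def scaleR_gr_def)

lemma gc_sum [simp]: "gc (sum f A) S = (\<Sum>k\<in>A. gc (f k) S)"
  by (induction A rule: infinite_finite_induct) auto

instantiation gr :: ("{finite,linorder}") real_algebra_1
begin
definition "1 = Gr (\<lambda>S. if S = {} then 1 else 0)"
definition "a * b = Gr (\<lambda>S. \<Sum>R\<in>Pow S. gsign R (S - R) * gc a R * gc b (S - R))"
instance
proof
  fix a b c :: "'a gr" and r :: real
  show "a * b * c = a * (b * c)"
  proof (rule gr_eqI)
    fix S :: "'a set"
    have "gc (a * b * c) S = (\<Sum>(A, B)\<in>Sigma (Pow S) Pow.
        gsign A (S - A) * (gsign B (A - B) * gc a B * gc b (A - B)) * gc c (S - A))"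
      by (simp add: times_gr_def sum_distrib_left sum_distrib_right sum.Sigma)
    \<comment> \<open>Both sums run over the ordered partitions of \<open>S\<close> into three
      blocks \<open>B\<close>, \<open>A - B\<close>, \<open>S - A\<close>. On either side the total
      sign counts the inversions between different blocks.\<close>
    also have "\<dots> = (\<Sum>(B, C)\<in>Sigma (Pow S) (\<lambda>B. Pow (S - B)).
        gsign B (S - B) * gc a B * (gsign C (S - B - C) * gc b C * gc c (S - B - C)))"
    proof (rule sum.reindex_bij_witness [where i = "\<lambda>(B, C). (B \<union> C, B)" and j = "\<lambda>(A, B). (B, A - B)"],
        goal_cases)
      case (5 p)
      obtain A B where p: "p = (A, B)" by force
      then have AB: "A \<subseteq> S" "B \<subseteq> A" using 5 by auto
      have "gsign A (S - A) = gsign B (S - A) * gsign (A - B) (S - A)"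
        using gsign_un_left [of B "A - B" "S - A"] AB by (simp add: Un_absorb1)
      moreover have "gsign B (S - B) = gsign B (A - B) * gsign B (S - A)"
      proof -
        have "S - B = (A - B) \<union> (S - A)" "(A - B) \<inter> (S - A) = {}" using AB by auto
        then show ?thesis using gsign_un_right by metis
      qed
      moreover have "S - B - (A - B) = S - A" using AB by auto
      ultimately show ?case using p by (simp add: algebra_simps)
    qed auto
    also have "\<dots> = gc (a * (b * c)) S"
      by (simp add: times_gr_def sum_distrib_left sum_distrib_right sum.Sigma)
    finally show "gc (a * b * c) S = gc (a * (b * c)) S" .
  qed
  show "(a + b) * c = a * c + b * c" "a * (b + c) = a * b + a * c"
    by (auto intro!: gr_eqI simp: times_gr_def algebra_simps sum.distrib)
  show "r *\<^sub>R a * b = r *\<^sub>R (a * b)" "a * r *\<^sub>R b = r *\<^sub>R (a * b)"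
    by (auto intro!: gr_eqI simp: times_gr_def algebra_simps sum_distrib_left)
  show "1 * a = a"
  proof (rule gr_eqI)
    fix S :: "'a set"
    have "gc (1 * a) S = (\<Sum>R\<in>Pow S. if R = {} then gc a S else 0)"
      unfolding times_gr_def one_gr_def gc_Gr by (rule sum.cong) auto
    then show "gc (1 * a) S = gc a S" by simp
  qed
  show "a * 1 = a"
  proof (rule gr_eqI)
    fix S :: "'a set"
    have "gc (a * 1) S = (\<Sum>R\<in>Pow S. if R = S then gc a S else 0)"
      unfolding times_gr_def one_gr_def gc_Gr by (rule sum.cong) auto
    then show "gc (a * 1) S = gc a S" by simp
  qed
  have "gc (0 :: 'a gr) {} \<noteq> gc 1 {}" by (simp add: one_gr_def)
  then show "(0 :: 'a gr) \<noteq> 1" by metis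
qed
end

lemma gc_one: "gc 1 S = (if S = {} then 1 else 0)" by (simp add: one_gr_def)

lemma gc_mult: "gc (a * b) S = (\<Sum>R\<in>Pow S. gsign R (S - R) * gc a R * gc b (S - R))"
  by (simp add: times_gr_def)

lemma gc_mult_empty [simp]: "gc (a * b) {} = gc a {} * gc b {}"
  by (simp add: gc_mult)

section \<open>The grading involution, the Euler field and left derivatives\<close>

definition gtau :: "'i::{finite,linorder} gr \<Rightarrow> 'i gr" where
  "gtau a = Gr (\<lambda>S. (- 1) ^ card S * gc a S)"

definition eul :: "'i::{finite,linorder} gr \<Rightarrow> 'i gr" where
  "eul a = Gr (\<lambda>S. card S * gc a S)"

text \<open>The left derivative by the odd coordinate with label \<open>i\<close>: the factor
  \<open>gsign {i} S\<close> is the sign for moving that coordinate to the front of the monomial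
  before deleting it.\<close>

definition gd :: "'i::{finite,linorder} \<Rightarrow> 'i gr \<Rightarrow> 'i gr" where
  "gd i a = Gr (\<lambda>S. if i \<in> S then 0 else gsign {i} S * gc a (insert i S))"

lemma gc_gtau [simp]: "gc (gtau a) S = (- 1) ^ card S * gc a S" by (simp add: gtau_def)
lemma gc_eul [simp]: "gc (eul a) S = card S * gc a S" by (simp add: eul_def)
lemma gc_gd: "gc (gd i a) S = (if i \<in> S then 0 else gsign {i} S * gc a (insert i S))"
  by (simp add: gd_def)

lemma gtau_linear [simp]:
  "gtau 0 = 0" "gtau (a + b) = gtau a + gtau b" "gtau (a - b) = gtau a - gtau b"
  "gtau (- a) = - gtau a" "gtau (c *\<^sub>R a) = c *\<^sub>R gtau a" "gtau 1 = 1"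
  by (auto intro!: gr_eqI simp: algebra_simps gc_one)

lemma gtau_sum: "gtau (sum f A) = (\<Sum>k\<in>A. gtau (f k))"
  by (induction A rule: infinite_finite_induct) auto

lemma gtau_gtau [simp]: "gtau (gtau a) = a"
  by (auto intro!: gr_eqI simp flip: mult.assoc power_add mult_2)

lemma eul_linear [simp]:
  "eul 0 = 0" "eul (a + b) = eul a + eul b" "eul (a - b) = eul a - eul b"
  "eul (- a) = - eul a" "eul (c *\<^sub>R a) = c *\<^sub>R eul a" "eul 1 = 0"
  by (auto intro!: gr_eqI simp: algebra_simps gc_one)

lemma eul_sum: "eul (sum f A) = (\<Sum>k\<in>A. eul (f k))"
  by (induction A rule: infinite_finite_induct) auto

lemma gd_linear [simp]:
  "gd i 0 = 0" "gd i (a + b) = gd i a + gd i b" "gd i (a - b) = gd i a - gd i b"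
  "gd i (- a) = - gd i a" "gd i (c *\<^sub>R a) = c *\<^sub>R gd i a"
  by (auto intro!: gr_eqI simp: algebra_simps gc_gd)

lemma eul_gtau: "eul (gtau a) = gtau (eul a)"
  by (auto intro!: gr_eqI)

lemma gd_gtau: "gd i (gtau a) = - gtau (gd i a)"
  by (auto intro!: gr_eqI simp: gc_gd)

text \<open>A derivative by an odd coordinate lowers the degree by one. This commutator is the
  source of the shift in \<open>deg_eq_eul_shift\<close> and in the chain rule.\<close>

lemma eul_gd: "eul (gd i a) = gd i (eul a) - gd i a"
  by (auto intro!: gr_eqI simp: gc_gd algebra_simps)

lemma card_Diff_Pow: "R \<in> Pow (S :: 'i::finite set) \<Longrightarrow> card S = card R + card (S - R)"
  by (metis PowD card_Un_disjnt disjnt_def Diff_disjoint Un_Diff_cancel finite sup.absorb_iff2)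

lemma gtau_mult: "gtau (a * b) = gtau a * gtau b"
  by (auto intro!: gr_eqI sum.cong simp: gc_mult sum_distrib_left card_Diff_Pow power_add)

lemma eul_mult: "eul (a * b) = eul a * b + a * eul b"
proof (rule gr_eqI)
  fix S :: "'a set"
  show "gc (eul (a * b)) S = gc (eul a * b + a * eul b) S"
    unfolding gc_eul gc_linear gc_mult sum_distrib_left sum.distrib [symmetric]
    by (intro sum.cong refl) (simp add: card_Diff_Pow algebra_simps)
qed

text \<open>Graded Leibniz rule of an odd derivation. For a monomial without \<open>i\<close>, the
  coordinate to be removed comes from the left or from the right factor; in the second case it must
  first cross the left one, and \<open>gtau\<close> records that sign. For a monomial containing
  \<open>i\<close>, the two terms on the right cancel.\<close>

lemma gd_mult: "gd i (a * b) = gd i a * b + gtau a * gd i b"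
proof (rule gr_eqI)
  fix S :: "'a set"
  show "gc (gd i (a * b)) S = gc (gd i a * b + gtau a * gd i b) S"
  proof (cases "i \<in> S")
    case True
    define T where "T = S - {i}"
    then have T: "S = insert i T" "i \<notin> T" using True by auto
    have inj: "inj_on (insert i) (Pow T)" using T by (auto simp: inj_on_def)
    \<comment> \<open>The subsets of \<open>S\<close> are grouped in pairs \<open>R\<close>,
      \<open>insert i R\<close>. Cancellation happens within each pair: in the surviving terms
      \<open>i\<close> belongs to the factor that is not differentiated.\<close>
    have split: "(\<Sum>R\<in>Pow S. f R) = (\<Sum>R\<in>Pow T. f R + f (insert i R))" for f :: "'a set \<Rightarrow> real"
    proof -
      have "(\<Sum>R\<in>Pow S. f R) = sum f (Pow T) + sum f (insert i ` Pow T)"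
        unfolding T(1) Pow_insert using T(2) by (intro sum.union_disjoint) auto
      then show ?thesis by (simp add: sum.reindex [OF inj] sum.distrib)
    qed
    have "gc (gd i a * b + gtau a * gd i b) S = 0"
      unfolding gc_linear gc_mult split sum.distrib [symmetric]
    proof (rule sum.neutral, rule ballI)
      fix R assume R: "R \<in> Pow T"
      then have iR: "i \<notin> R" and eq: "S - R = insert i (T - R)" "S - insert i R = T - R" using T by auto
      have "gsign R (S - R) * gsign {i} R = (gsign R {i} * gsign {i} R) * gsign R (T - R)"
        unfolding eq using gsign_un_right [of "{i}" "T - R" R] T by simp
      also have "gsign R {i} * gsign {i} R = (- 1) ^ card R"
        using gsign_swap [of R "{i}"] iR by auto
      finally have 1: "gsign R (S - R) * gsign {i} R = (- 1) ^ card R * gsign R (T - R)" .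
      have "gsign (insert i R) (S - insert i R) = gsign {i} (T - R) * gsign R (T - R)"
        unfolding eq using gsign_un_left [of "{i}" R "T - R"] iR by simp
      then have 2: "gsign (insert i R) (S - insert i R) * gsign {i} (T - R) = gsign R (T - R)"
        by simp
      have A: "gsign R (S - R) * gc (gd i a) R * gc b (S - R) =
          (gsign R (S - R) * gsign {i} R) * gc a (insert i R) * gc b (insert i (T - R))"
        using iR by (simp add: gc_gd eq)
      have B: "gsign (insert i R) (S - insert i R) * gc (gtau a) (insert i R) * gc (gd i b) (S - insert i R) =
         - ((- 1) ^ card R) * (gsign (insert i R) (S - insert i R) * gsign {i} (T - R)) * gc a (insert i R) * gc b (insert i (T - R))"
        using iR T by (simp add: gc_gd eq)
      have C: "gc (gd i a) (insert i R) = 0" "gc (gd i b) (S - R) = 0"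
        using iR eq by (auto simp: gc_gd)
      show "gsign R (S - R) * gc (gd i a) R * gc b (S - R) +
          gsign (insert i R) (S - insert i R) * gc (gd i a) (insert i R) * gc b (S - insert i R) +
          (gsign R (S - R) * gc (gtau a) R * gc (gd i b) (S - R) +
           gsign (insert i R) (S - insert i R) * gc (gtau a) (insert i R) * gc (gd i b) (S - insert i R)) = 0"
        unfolding A B C 1 2 by simp
    qed
    then show ?thesis using True by (simp add: gc_gd)
  next
    case False
    have 1: "gsign {i} S * gsign (insert i R) (S - R) = gsign {i} R * gsign R (S - R)" if "R \<subseteq> S" for R
    proof -
      have "gsign {i} S = gsign {i} R * gsign {i} (S - R)"
        using gsign_un_right [of R "S - R" "{i}"] that by (simp add: Un_absorb1)
      moreover have "gsign (insert i R) (S - R) = gsign {i} (S - R) * gsign R (S - R)"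
        using gsign_un_left [of "{i}" R "S - R"] that False by auto
      ultimately show ?thesis by (simp add: algebra_simps)
    qed
    \<comment> \<open>Here the removed coordinate sits in the right factor;
      \<open>gsign_swap\<close> gives the sign \<open>(- 1) ^ card R\<close> for carrying it across
      \<open>R\<close>.\<close>
    have 2: "gsign {i} S * gsign R (insert i (S - R)) = (- 1) ^ card R * gsign R (S - R) * gsign {i} (S - R)"
      if "R \<subseteq> S" for R
    proof -
      have "gsign {i} S = gsign {i} R * gsign {i} (S - R)"
        using gsign_un_right [of R "S - R" "{i}"] that by (simp add: Un_absorb1)
      moreover have "gsign R (insert i (S - R)) = gsign R {i} * gsign R (S - R)"
        using gsign_un_right [of "{i}" "S - R" R] that False by auto
      moreover have "gsign R {i} * gsign {i} R = (- 1) ^ card R"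
        using gsign_swap [of R "{i}"] that False by auto
      ultimately show ?thesis by (simp add: algebra_simps)
    qed
    have "gc (gd i (a * b)) S = gsign {i} S * (\<Sum>R\<in>Pow (insert i S). gsign R (insert i S - R) * gc a R * gc b (insert i S - R))"
      using False by (simp add: gc_gd gc_mult)
    also have "Pow (insert i S) = Pow S \<union> insert i ` Pow S" by (rule Pow_insert)
    also have "(\<Sum>R\<in>\<dots>. gsign R (insert i S - R) * gc a R * gc b (insert i S - R)) =
        (\<Sum>R\<in>Pow S. gsign R (insert i S - R) * gc a R * gc b (insert i S - R)) +
        (\<Sum>R\<in>insert i ` Pow S. gsign R (insert i S - R) * gc a R * gc b (insert i S - R))"
      using False by (intro sum.union_disjoint) auto
    also have "(\<Sum>R\<in>insert i ` Pow S. gsign R (insert i S - R) * gc a R * gc b (insert i S - R)) =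
        (\<Sum>R\<in>Pow S. gsign (insert i R) (S - R) * gc a (insert i R) * gc b (S - R))"
    proof -
      have inj: "inj_on (insert i) (Pow S)" using False by (auto simp: inj_on_def)
      have "insert i S - insert i R = S - R" for R using False by auto
      then show ?thesis by (simp add: sum.reindex [OF inj])
    qed
    also have "(\<Sum>R\<in>Pow S. gsign R (insert i S - R) * gc a R * gc b (insert i S - R)) =
       (\<Sum>R\<in>Pow S. gsign R (insert i (S - R)) * gc a R * gc b (insert i (S - R)))"
      using False by (intro sum.cong refl) (metis PowD insert_Diff_if subsetD)
    also have "gsign {i} S * (\<dots> + (\<Sum>R\<in>Pow S. gsign (insert i R) (S - R) * gc a (insert i R) * gc b (S - R))) =
       (\<Sum>R\<in>Pow S. (gsign {i} S * gsign (insert i R) (S - R)) * gc a (insert i R) * gc b (S - R)) +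
       (\<Sum>R\<in>Pow S. (gsign {i} S * gsign R (insert i (S - R))) * gc a R * gc b (insert i (S - R)))"
      by (simp add: algebra_simps sum_distrib_left)
    also have "\<dots> = (\<Sum>R\<in>Pow S. (gsign {i} R * gsign R (S - R)) * gc a (insert i R) * gc b (S - R)) +
       (\<Sum>R\<in>Pow S. ((- 1) ^ card R * gsign R (S - R) * gsign {i} (S - R)) * gc a R * gc b (insert i (S - R)))"
      by (intro arg_cong2 [where f = "(+)"] sum.cong refl) (auto simp: 1 2)
    also have "\<dots> = gc (gd i a * b + gtau a * gd i b) S"
      unfolding gc_linear gc_mult
      using False by (intro arg_cong2 [where f = "(+)"] sum.cong refl) (auto simp: gc_gd)
    finally show ?thesis .
  qed
qed

lemma gd_commute: "gd i (gd j a) = - gd j (gd i a)"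
proof (rule gr_eqI)
  fix S :: "'a set"
  show "gc (gd i (gd j a)) S = gc (- gd j (gd i a)) S"
  proof (cases "i \<in> S \<or> j \<in> S \<or> i = j")
    case True
    then show ?thesis by (auto simp: gc_gd)
  next
    case False
    have "gsign {j} (insert i S) = gsign {j} {i} * gsign {j} S"
      and "gsign {i} (insert j S) = gsign {i} {j} * gsign {i} S"
      using False gsign_un_right [of "{i}" S "{j}"] gsign_un_right [of "{j}" S "{i}"] by auto
    moreover have "gsign {j} {i} = - gsign {i} {j}"
    proof -
      have "gsign {i} {j} * gsign {j} {i} = - 1" using gsign_swap [of "{i}" "{j}"] False by auto
      then have "gsign {i} {j} * (gsign {i} {j} * gsign {j} {i}) = - gsign {i} {j}" by simp
      then show ?thesis by (simp del: mult_minus_right)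
    qed
    ultimately show ?thesis using False by (auto simp: gc_gd insert_commute)
  qed
qed

section \<open>Parity and supercommutativity\<close>

definition gev :: "'i::{finite,linorder} gr \<Rightarrow> bool" where
  "gev a \<longleftrightarrow> gtau a = a"

definition god :: "'i::{finite,linorder} gr \<Rightarrow> bool" where
  "god a \<longleftrightarrow> gtau a = - a"

lemma gev_iff: "gev a \<longleftrightarrow> (\<forall>S. odd (card S) \<longrightarrow> gc a S = 0)"
proof
  assume "gev a"
  then show "\<forall>S. odd (card S) \<longrightarrow> gc a S = 0"
    unfolding gev_def by (metis gc_gtau equal_neg_zero mult_minus1 uminus_power_if power_one)
next
  assume "\<forall>S. odd (card S) \<longrightarrow> gc a S = 0"
  then show "gev a" by (auto intro!: gr_eqI simp: gev_def minus_one_power_iff)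
qed

lemma god_iff: "god a \<longleftrightarrow> (\<forall>S. even (card S) \<longrightarrow> gc a S = 0)"
proof
  assume "god a"
  then show "\<forall>S. even (card S) \<longrightarrow> gc a S = 0"
    unfolding god_def
    by (metis gc_gtau gc_linear(4) equal_neg_zero mult_1 uminus_power_if power_one)
next
  assume "\<forall>S. even (card S) \<longrightarrow> gc a S = 0"
  then show "god a" by (auto intro!: gr_eqI simp: god_def minus_one_power_iff)
qed

lemma gc_mult_flip: "gc (a * b) S = (\<Sum>R\<in>Pow S. gsign (S - R) R * gc a (S - R) * gc b R)"
  unfolding gc_mult
  by (rule sum.reindex_bij_witness [where i = "\<lambda>R. S - R" and j = "\<lambda>R. S - R"]) (auto simp: double_diff)

lemma gev_commute: assumes "gev a" shows "a * b = b * a"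
proof (rule gr_eqI)
  fix S :: "'a set"
  show "gc (a * b) S = gc (b * a) S"
    unfolding gc_mult [of a b] gc_mult_flip [of b a]
  proof (rule sum.cong [OF refl])
    fix R assume "R \<in> Pow S"
    show "gsign R (S - R) * gc a R * gc b (S - R) = gsign (S - R) R * gc b (S - R) * gc a R"
    proof (cases "odd (card R)")
      case True then show ?thesis using assms by (simp add: gev_iff)
    next
      case False
      then have "gsign R (S - R) * gsign (S - R) R = 1" by (subst gsign_swap) auto
      then have "gsign R (S - R) = gsign (S - R) R"
        by (metis gsign_square_left mult.right_neutral)
      then show ?thesis by simp
    qed
  qed
qed

text \<open>The second factor may be inhomogeneous: crossing an odd element multiplies its part of
  degree \<open>k\<close> by \<open>(- 1) ^ k\<close>, which is the effect of
  \<open>gtau\<close>.\<close>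

lemma god_commute: assumes "god a" shows "a * b = gtau b * a"
proof (rule gr_eqI)
  fix S :: "'a set"
  show "gc (a * b) S = gc (gtau b * a) S"
    unfolding gc_mult [of a b] gc_mult_flip [of "gtau b" a]
  proof (rule sum.cong [OF refl])
    fix R assume "R \<in> Pow S"
    show "gsign R (S - R) * gc a R * gc b (S - R) = gsign (S - R) R * gc (gtau b) (S - R) * gc a R"
    proof (cases "even (card R)")
      case True then show ?thesis using assms by (simp add: god_iff)
    next
      case False
      have "gsign R (S - R) * gsign (S - R) R = (- 1) ^ (card R * card (S - R))"
        by (rule gsign_swap) auto
      also have "\<dots> = (- 1) ^ card (S - R)" using False by (auto simp: minus_one_power_iff)
      finally have "gsign R (S - R) = gsign (S - R) R * (- 1) ^ card (S - R)"
        by (metis gsign_square_left mult.commute)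
      then show ?thesis by simp
    qed
  qed
qed

text \<open>Congruence modulo the \<open>n\<close>-th power of the ideal generated by the odd
  generators.\<close>

definition deg_eq :: "nat \<Rightarrow> 'i::{finite,linorder} gr \<Rightarrow> 'i gr \<Rightarrow> bool" where
  "deg_eq n a b \<longleftrightarrow> (\<forall>S. card S < n \<longrightarrow> gc a S = gc b S)"

lemma deg_eq_0 [simp]: "deg_eq 0 a b" by (simp add: deg_eq_def)

lemma deg_eq_imp_eq: "(\<And>n. deg_eq n a b) \<Longrightarrow> a = b"
  unfolding deg_eq_def by (blast intro: gr_eqI)

lemma deg_eq_refl [simp]: "deg_eq n a a" by (simp add: deg_eq_def)

lemma deg_eq_sum: "(\<And>k. k \<in> A \<Longrightarrow> deg_eq n (f k) (g k)) \<Longrightarrow> deg_eq n (sum f A) (sum g A)"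
  by (auto simp: deg_eq_def intro!: sum.cong)

lemma deg_eq_add: "deg_eq n a b \<Longrightarrow> deg_eq n c d \<Longrightarrow> deg_eq n (a + c) (b + d)"
  by (auto simp: deg_eq_def)

lemma deg_eq_scaleR: "deg_eq n a b \<Longrightarrow> deg_eq n (c *\<^sub>R a) (c *\<^sub>R b)"
  by (auto simp: deg_eq_def)

text \<open>All terms of \<open>c\<close> have positive degree, so multiplication by
  \<open>c\<close> gains one order of agreement. This gain drives the inductions on the
  degree.\<close>

lemma deg_eq_mult_nilpotent:
  assumes "gc c {} = 0" "deg_eq n a b" shows "deg_eq (Suc n) (c * a) (c * b)"
  unfolding deg_eq_def gc_mult
proof (intro allI impI sum.cong refl)
  fix S R :: "'a set" assume S: "card S < Suc n" and R: "R \<in> Pow S"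
  show "gsign R (S - R) * gc c R * gc a (S - R) = gsign R (S - R) * gc c R * gc b (S - R)"
  proof (cases "R = {}")
    case False
    then have "card R > 0" by (simp add: card_gt_0_iff)
    then have "card (S - R) < n" using S card_Diff_Pow [OF R] by simp
    then show ?thesis using assms by (simp add: deg_eq_def)
  qed (use assms in simp)
qed

text \<open>Division by the degree recovers every coefficient except the body, which the first
  assumption supplies.\<close>

lemma deg_eq_eul:
  assumes "gc a {} = gc b {}" "deg_eq n (eul a) (eul b)" shows "deg_eq n a b"
  using assms by (auto simp: deg_eq_def)

lemma eul_eq_imp_eq: assumes "gc a {} = gc b {}" "eul a = eul b" shows "a = b"
  by (rule deg_eq_imp_eq, rule deg_eq_eul) (use assms in auto)

lemma prod_list_nilpotent:
  fixes as :: "'i::{finite,linorder} gr list"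
  assumes "\<And>a. a \<in> set as \<Longrightarrow> gc a {} = 0" "card S < length as"
  shows "gc (prod_list as) S = 0"
proof -
  have "deg_eq (length as) (prod_list as) 0" using assms(1)
  proof (induction as)
    case (Cons a as)
    then have "deg_eq (Suc (length as)) (a * prod_list as) (a * 0)"
      by (intro deg_eq_mult_nilpotent) auto
    then show ?case by simp
  qed auto
  then show ?thesis using assms(2) by (simp add: deg_eq_def)
qed

section \<open>Partial derivatives and smooth functions\<close>

abbreviation dom_open :: "'i::finite sdim \<Rightarrow> (real ^ 'i) set \<Rightarrow> bool" where
  "dom_open D U \<equiv> openin (top_of_set (body_space D)) U"

lemma dom_open_subset: "dom_open D U \<Longrightarrow> x \<in> U \<Longrightarrow> x \<in> body_space D"
  using openin_imp_subset by blast

lemma dom_open_ball: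
  assumes "dom_open D U" "x \<in> U"
  obtains e where "e > 0" "\<And>y. y \<in> body_space D \<Longrightarrow> dist y x < e \<Longrightarrow> y \<in> U"
proof -
  obtain e where "e > 0" "\<forall>y\<in>body_space D. dist y x < e \<longrightarrow> y \<in> U"
    using assms unfolding openin_euclidean_subtopology_iff by blast
  then show ?thesis using that by blast
qed

lemma body_space_shift: "x \<in> body_space D \<Longrightarrow> i \<in> ev D \<Longrightarrow> x + t *\<^sub>R axis i 1 \<in> body_space D"
  by (auto simp: body_space_def axis_def)

lemma dom_open_line:
  assumes "dom_open D U" "x \<in> U" "i \<in> ev D"
  obtains e where "e > 0" "\<And>t. \<bar>t\<bar> < e \<Longrightarrow> x + t *\<^sub>R axis i 1 \<in> U"
proof -
  obtain e where e: "e > 0" "\<And>y. y \<in> body_space D \<Longrightarrow> dist y x < e \<Longrightarrow> y \<in> U"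
    using dom_open_ball assms by blast
  have "x + t *\<^sub>R axis i 1 \<in> U" if "\<bar>t\<bar> < e" for t
    using that assms dom_open_subset [OF assms(1,2)]
    by (intro e(2) body_space_shift) (auto simp: dist_norm)
  then show ?thesis using e that by blast
qed

text \<open>The sets \<open>U\<close> of interest are open only inside the body space, so the
  derivative of \<open>f\<close> exists merely within \<open>U\<close>. A curve that stays in
  \<open>U\<close> for a short time turns it into an unrestricted derivative in the parameter,
  because the time interval is open in the reals.\<close>

lemma has_derivative_along_curve:
  assumes f: "(f has_derivative f') (at (g 0) within U)"
    and g: "(g has_vector_derivative v) (at (0 :: real))"
    and e: "e > 0" "\<And>t. \<bar>t\<bar> < e \<Longrightarrow> g t \<in> U"
  shows "((\<lambda>t. f (g t)) has_real_derivative f' v) (at 0)"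
proof -
  have "g ` {-e<..<e} \<subseteq> U" using e by auto
  then have "(f has_derivative f') (at (g 0) within g ` {-e<..<e})"
    using f has_derivative_subset by blast
  moreover have "(g has_derivative (\<lambda>t. t *\<^sub>R v)) (at 0 within {-e<..<e})"
    using g by (simp add: has_vector_derivative_def has_derivative_at_withinI)
  ultimately have "((\<lambda>t. f (g t)) has_derivative (\<lambda>t. f' (t *\<^sub>R v))) (at 0 within {-e<..<e})"
    by (rule has_derivative_in_compose [rotated])
  then have "((\<lambda>t. f (g t)) has_derivative (\<lambda>t. f' (t *\<^sub>R v))) (at 0)"
    using e(1) at_within_open [of 0 "{-e<..<e}"] by auto
  moreover have "f' (t *\<^sub>R v) = f' v * t" for t
    using has_derivative_linear [OF f] by (simp add: linear_scale)
  ultimately show ?thesis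
    by (simp add: has_field_derivative_def)
qed

lemma line_has_vector_derivative:
  "((\<lambda>t. x + t *\<^sub>R v) has_vector_derivative v) (at 0)"
  by (auto intro!: derivative_eq_intros)

lemma has_derivative_partial:
  assumes "(f has_derivative f') (at x within U)" "dom_open D U" "x \<in> U" "i \<in> ev D"
  shows "((\<lambda>t. f (x + t *\<^sub>R axis i 1)) has_real_derivative f' (axis i 1)) (at 0)"
    and "partial i f x = f' (axis i 1)"
proof -
  obtain e where e: "e > 0" "\<And>t. \<bar>t\<bar> < e \<Longrightarrow> x + t *\<^sub>R axis i 1 \<in> U"
    using dom_open_line assms by blast
  show 1: "((\<lambda>t. f (x + t *\<^sub>R axis i 1)) has_real_derivative f' (axis i 1)) (at 0)"
    by (rule has_derivative_along_curve [OF _ line_has_vector_derivative e]) (use assms in auto)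
  then show "partial i f x = f' (axis i 1)"
    by (simp add: partial_def DERIV_imp_deriv)
qed

lemma differentiable_partial:
  assumes "f differentiable_on U" "dom_open D U" "x \<in> U" "i \<in> ev D"
  shows "((\<lambda>t. f (x + t *\<^sub>R axis i 1)) has_real_derivative partial i f x) (at 0)"
  using assms has_derivative_partial unfolding differentiable_on_def differentiable_def by metis

lemma partial_eqI:
  "((\<lambda>t. f (x + t *\<^sub>R axis i 1)) has_real_derivative c) (at 0) \<Longrightarrow> partial i f x = c"
  by (simp add: partial_def DERIV_imp_deriv)

lemma partial_cong:
  assumes "dom_open D U" "x \<in> U" "i \<in> ev D" "\<And>y. y \<in> U \<Longrightarrow> f y = g y"
  shows "partial i f x = partial i g x"
proof -
  obtain e where e: "e > 0" "\<And>t. \<bar>t\<bar> < e \<Longrightarrow> x + t *\<^sub>R axis i 1 \<in> U"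
    using dom_open_line assms by blast
  then have "\<forall>\<^sub>F t in nhds 0. f (x + t *\<^sub>R axis i 1) = g (x + t *\<^sub>R axis i 1)"
    using assms(4) unfolding eventually_nhds_metric by (metis dist_real_def diff_zero)
  then show ?thesis unfolding partial_def by (rule deriv_cong_ev) simp
qed

lemma partials_simps [simp]:
  "partials [] f = f" "partials (i # is) f = partial i (partials is f)"
  by (auto simp: partials_def)

lemma partials_append: "partials (is @ js) f = partials is (partials js f)"
  by (simp add: partials_def)

lemma partials_cong:
  assumes "dom_open D U" "set is \<subseteq> ev D" "\<And>y. y \<in> U \<Longrightarrow> f y = g y" "x \<in> U"
  shows "partials is f x = partials is g x"
  using assms(2,4)
proof (induction "is" arbitrary: x)
  case (Cons i "is")
  then show ?case using assms by (auto intro!: partial_cong [of D U])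
qed (use assms in auto)

lemma smooth_differentiable: "smooth_fun_on D U f \<Longrightarrow> f differentiable_on U"
  unfolding smooth_fun_on_def by (metis empty_subsetI list.set(1) partials_simps(1))

lemma smooth_partial: "smooth_fun_on D U f \<Longrightarrow> i \<in> ev D \<Longrightarrow> smooth_fun_on D U (partial i f)"
proof (unfold smooth_fun_on_def, intro allI impI)
  fix "is" assume 1: "\<forall>is. set is \<subseteq> ev D \<longrightarrow> partials is f differentiable_on U" "i \<in> ev D" "set is \<subseteq> ev D"
  then have "partials (is @ [i]) f differentiable_on U" by (auto simp del: partials_simps)
  then show "partials is (partial i f) differentiable_on U" by (simp add: partials_append)
qed

lemma smooth_partials: "smooth_fun_on D U f \<Longrightarrow> set is \<subseteq> ev D \<Longrightarrow> smooth_fun_on D U (partials is f)"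
  by (induction "is") (auto intro: smooth_partial)

lemma differentiable_on_cong:
  "f differentiable_on U \<Longrightarrow> (\<And>x. x \<in> U \<Longrightarrow> f x = g x) \<Longrightarrow> g differentiable_on U"
  unfolding differentiable_on_def
  by (metis differentiable_def has_derivative_transform)

text \<open>Smoothness is the largest property that implies differentiability and is inherited by
  partial derivatives. The step asks for equality on \<open>U\<close> only, because the values
  elsewhere are arbitrary.\<close>

lemma smooth_coinduct:
  assumes U: "dom_open D U" and "P f"
    and diff: "\<And>f. P f \<Longrightarrow> f differentiable_on U"
    and step: "\<And>f i. P f \<Longrightarrow> i \<in> ev D \<Longrightarrow> \<exists>g. P g \<and> (\<forall>x\<in>U. partial i f x = g x)"
  shows "smooth_fun_on D U f"
proof -
  have "\<exists>g. P g \<and> (\<forall>x\<in>U. partials is f x = g x)" if "set is \<subseteq> ev D" for "is"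
    using that
  proof (induction "is")
    case (Cons i "is")
    then obtain g where g: "P g" "\<forall>x\<in>U. partials is f x = g x" by auto
    obtain h where "P h" "\<forall>x\<in>U. partial i g x = h x" using step g Cons by (meson list.set_intros(1) subsetD)
    then show ?case using g partial_cong [OF U, of _ i "partials is f" g] Cons by auto
  qed (use \<open>P f\<close> in auto)
  note * = this
  show ?thesis unfolding smooth_fun_on_def
  proof (intro allI impI)
    fix "is" assume "set is \<subseteq> ev D"
    then obtain g where "P g" "\<forall>x\<in>U. partials is f x = g x" using * by blast
    then show "partials is f differentiable_on U"
      using differentiable_on_cong [OF diff [of g]] by simp
  qed
qed

lemma smooth_cong:
  assumes "dom_open D U" "smooth_fun_on D U f" "\<And>x. x \<in> U \<Longrightarrow> f x = g x"
  shows "smooth_fun_on D U g"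
  unfolding smooth_fun_on_def
proof (intro allI impI)
  fix "is" assume "set is \<subseteq> ev D"
  note sub = this
  show "partials is g differentiable_on U"
  proof (rule differentiable_on_cong)
    show "partials is f differentiable_on U" using assms(2) sub unfolding smooth_fun_on_def by blast
    show "partials is f x = partials is g x" if "x \<in> U" for x
      by (rule partials_cong [OF assms(1) sub assms(3) that])
  qed
qed

lemma smooth_subset: "smooth_fun_on D U f \<Longrightarrow> V \<subseteq> U \<Longrightarrow> smooth_fun_on D V f"
  unfolding smooth_fun_on_def using differentiable_on_subset by blast

lemma smooth_const [simp]: assumes "dom_open D U" shows "smooth_fun_on D U (\<lambda>x. c)"
  by (rule smooth_coinduct [OF assms, where P = "\<lambda>f. \<exists>c. f = (\<lambda>x. c)"])
     (auto simp: partial_def intro!: exI)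

lemma smooth_coordinate: assumes U: "dom_open D U" shows "smooth_fun_on D U (\<lambda>x. x $ i)"
proof (rule smooth_coinduct [OF U, where P = "\<lambda>f. f = (\<lambda>x. x $ i) \<or> (\<exists>c. f = (\<lambda>x. c))"])
  fix f :: "real ^ 'a \<Rightarrow> real" assume f: "f = (\<lambda>x. x $ i) \<or> (\<exists>c. f = (\<lambda>x. c))"
  moreover have "(\<lambda>x. x $ i) differentiable_on U"
    by (intro linear_imp_differentiable_on bounded_linear.linear bounded_linear_vec_nth)
  ultimately show "f differentiable_on U" by auto
  fix j
  have *: "partial j (\<lambda>x. x $ i) x = axis j 1 $ i" for x
    by (rule partial_eqI) (auto intro!: derivative_eq_intros)
  show "\<exists>g. (g = (\<lambda>x. x $ i) \<or> (\<exists>c. g = (\<lambda>x. c))) \<and> (\<forall>x\<in>U. partial j f x = g x)"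
    using f
  proof
    assume "\<exists>c. f = (\<lambda>x. c)"
    then show ?thesis by (intro exI [of _ "\<lambda>x. 0"]) (auto simp: partial_def)
  qed (use * in \<open>auto intro!: exI\<close>)
qed auto

lemma partial_coordinate: "partial j (\<lambda>x. x $ i) x = (if i = j then 1 else 0)"
proof -
  have "partial j (\<lambda>x. x $ i) x = axis j 1 $ i"
    by (rule partial_eqI) (auto intro!: derivative_eq_intros)
  then show ?thesis by (simp add: axis_def)
qed

lemma partial_const [simp]: "partial j (\<lambda>x. c) = (\<lambda>x. 0)"
  by (simp add: partial_def fun_eq_iff)

lemma partial_add:
  assumes "dom_open D U" "x \<in> U" "i \<in> ev D" "f differentiable_on U" "g differentiable_on U"
  shows "partial i (\<lambda>x. f x + g x) x = partial i f x + partial i g x"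
  by (rule partial_eqI)
     (use differentiable_partial [of f U D x i] differentiable_partial [of g U D x i] assms
      in \<open>auto intro!: derivative_eq_intros\<close>)

lemma partial_mult:
  assumes "dom_open D U" "x \<in> U" "i \<in> ev D" "f differentiable_on U" "g differentiable_on U"
  shows "partial i (\<lambda>x. f x * g x) x = partial i f x * g x + f x * partial i g x"
  by (rule partial_eqI)
     (use differentiable_partial [of f U D x i] differentiable_partial [of g U D x i] assms
      in \<open>auto intro!: derivative_eq_intros\<close>)

text \<open>
  A partial derivative of \<open>f \<circ> g\<close> is a sum of products of partial derivatives of \<open>g\<close> with composites
  of the same kind, so smoothness is proved for all such combinations at once, by coinduction.
\<close>

inductive alg_gen :: "((real ^ 'i::finite \<Rightarrow> real) \<Rightarrow> bool) \<Rightarrow> (real ^ 'i \<Rightarrow> real) \<Rightarrow> bool" for B where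
  gen: "B f \<Longrightarrow> alg_gen B f"
| add: "alg_gen B f \<Longrightarrow> alg_gen B g \<Longrightarrow> alg_gen B (\<lambda>x. f x + g x)"
| mult: "alg_gen B f \<Longrightarrow> alg_gen B g \<Longrightarrow> alg_gen B (\<lambda>x. f x * g x)"

lemma smooth_alg_gen:
  assumes U: "dom_open D U" and "alg_gen B f"
    and diff: "\<And>f. B f \<Longrightarrow> f differentiable_on U"
    and step: "\<And>f i. B f \<Longrightarrow> i \<in> ev D \<Longrightarrow> \<exists>g. alg_gen B g \<and> (\<forall>x\<in>U. partial i f x = g x)"
  shows "smooth_fun_on D U f"
proof (rule smooth_coinduct [OF U, where P = "alg_gen B"])
  show d: "f differentiable_on U" if "alg_gen B f" for f
    using that by induction (auto intro: diff differentiable_on_add differentiable_on_mult)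
  show "\<exists>g. alg_gen B g \<and> (\<forall>x\<in>U. partial i f x = g x)" if "alg_gen B f" "i \<in> ev D" for f i
    using that
  proof induction
    case (gen f)
    then show ?case using step by blast
  next
    case (add f g)
    then obtain f' g' where "alg_gen B f'" "\<forall>x\<in>U. partial i f x = f' x"
      "alg_gen B g'" "\<forall>x\<in>U. partial i g x = g' x" by blast
    then show ?case using add d U by (intro exI [of _ "\<lambda>x. f' x + g' x"])
      (auto simp: partial_add [where D = D and U = U] intro: alg_gen.intros)
  next
    case (mult f g)
    then obtain f' g' where "alg_gen B f'" "\<forall>x\<in>U. partial i f x = f' x"
      "alg_gen B g'" "\<forall>x\<in>U. partial i g x = g' x" by blast
    then show ?case using mult d U by (intro exI [of _ "\<lambda>x. f' x * g x + f x * g' x"])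
      (auto simp: partial_mult [where D = D and U = U] intro: alg_gen.intros)
  qed
qed fact

lemma smooth_alg_gen_smooth:
  assumes "dom_open D U" "alg_gen (smooth_fun_on D U) f" shows "smooth_fun_on D U f"
  by (rule smooth_alg_gen [OF assms]) (auto intro: smooth_differentiable smooth_partial alg_gen.gen)

lemma smooth_add:
  assumes "dom_open D U" "smooth_fun_on D U f" "smooth_fun_on D U g"
  shows "smooth_fun_on D U (\<lambda>x. f x + g x)"
  using assms by (intro smooth_alg_gen_smooth) (auto intro: alg_gen.intros)

lemma smooth_mult:
  assumes "dom_open D U" "smooth_fun_on D U f" "smooth_fun_on D U g"
  shows "smooth_fun_on D U (\<lambda>x. f x * g x)"
  using assms by (intro smooth_alg_gen_smooth) (auto intro: alg_gen.intros)

lemma smooth_sum: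
  assumes "dom_open D U" "\<And>k. k \<in> A \<Longrightarrow> smooth_fun_on D U (f k)"
  shows "smooth_fun_on D U (\<lambda>x. \<Sum>k\<in>A. f k x)"
  using assms(2) by (induction A rule: infinite_finite_induct) (simp_all add: smooth_add smooth_const assms(1))

lemma partial_cmult:
  assumes "dom_open D U" "x \<in> U" "i \<in> ev D" "smooth_fun_on D U f"
  shows "partial i (\<lambda>x. c * f x) x = c * partial i f x"
  using partial_mult [of D U x i "\<lambda>x. c" f] assms by (simp add: smooth_differentiable)

lemma partial_sum:
  assumes "dom_open D U" "x \<in> U" "i \<in> ev D" "\<And>k. k \<in> A \<Longrightarrow> smooth_fun_on D U (f k)"
  shows "partial i (\<lambda>x. \<Sum>k\<in>A. f k x) x = (\<Sum>k\<in>A. partial i (f k) x)"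
  using assms(4)
proof (induction A rule: infinite_finite_induct)
  case (insert k A)
  then show ?case using assms(1-3)
    using partial_add [OF assms(1-3), of "f k" "\<lambda>x. \<Sum>k\<in>A. f k x"]
      smooth_differentiable [OF smooth_sum [OF assms(1), of A f]]
    by (simp add: smooth_differentiable [of D U "f k"])
qed auto

section \<open>The classical chain rule and composition of smooth functions\<close>

lemma linear_body_space:
  assumes "linear f'" "v \<in> body_space D"
  shows "(f' v :: real) = (\<Sum>i\<in>ev D. v $ i * f' (axis i 1))"
proof -
  have "v = (\<Sum>i\<in>UNIV. v $ i *\<^sub>R axis i 1)"
    by (simp add: vec_eq_iff axis_def if_distrib cong: if_cong)
  also have "\<dots> = (\<Sum>i\<in>ev D. v $ i *\<^sub>R axis i 1)"
    using assms(2) by (intro sum.mono_neutral_right) (auto simp: body_space_def)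
  finally have "f' v = f' (\<Sum>i\<in>ev D. v $ i *\<^sub>R axis i 1)" by simp
  then show ?thesis using assms(1) by (simp add: linear_sum linear_scale)
qed

lemma partial_compose:
  fixes g :: "real ^ 'j::finite \<Rightarrow> real ^ 'i::finite"
  assumes U: "dom_open D' U" and V: "dom_open D V" and x: "x \<in> U" and j: "j \<in> ev D'"
    and f: "f differentiable_on V" and gV: "\<And>x. x \<in> U \<Longrightarrow> g x \<in> V"
    and g: "\<And>i. i \<in> ev D \<Longrightarrow> (\<lambda>x. g x $ i) differentiable_on U"
  shows "partial j (\<lambda>x. f (g x)) x = (\<Sum>i\<in>ev D. partial j (\<lambda>x. g x $ i) x * partial i f (g x))"
proof (rule partial_eqI)
  obtain f' where f': "(f has_derivative f') (at (g x) within V)"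
    using f gV x unfolding differentiable_on_def differentiable_def by blast
  \<comment> \<open>The velocity of the curve. Its components outside \<open>ev D\<close> are zero,
    in agreement with \<open>g\<close>, whose values on \<open>U\<close> lie in the body space;
    there differentiability comes from \<open>g\<close> being locally zero along the line, not from
    the assumption on \<open>g\<close>.\<close>
  define v where "v = (\<chi> i. if i \<in> ev D then partial j (\<lambda>x. g x $ i) x else 0)"
  have g0: "g y $ i = 0" if "y \<in> U" "i \<notin> ev D" for y i
    using dom_open_subset [OF V gV [OF that(1)]] that by (simp add: body_space_def)
  obtain e where e: "e > 0" "\<And>t. \<bar>t\<bar> < e \<Longrightarrow> x + t *\<^sub>R axis j 1 \<in> U"
    using dom_open_line U x j by blast
  have "((\<lambda>t. g (x + t *\<^sub>R axis j 1)) has_vector_derivative v) (at 0)"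
    unfolding has_vector_derivative_def
  proof (subst has_derivative_componentwise_within, rule ballI)
    fix b :: "real ^ 'i" assume "b \<in> Basis"
    then obtain i where b: "b = axis i 1" by (auto simp: Basis_vec_def)
    have "((\<lambda>t. g (x + t *\<^sub>R axis j 1) $ i) has_real_derivative v $ i) (at 0)"
    proof (cases "i \<in> ev D")
      case True
      then show ?thesis using differentiable_partial [OF g U x j] by (simp add: v_def)
    next
      case False
      have "\<forall>\<^sub>F t in nhds 0. g (x + t *\<^sub>R axis j 1) $ i = 0"
        using e g0 False unfolding eventually_nhds_metric by (metis dist_real_def diff_zero)
      moreover have "((\<lambda>t. 0) has_real_derivative v $ i) (at 0)" using False by (simp add: v_def)
      ultimately show ?thesis by (subst DERIV_cong_ev [where g = "\<lambda>t. 0"]) auto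
    qed
    then show "((\<lambda>t. g (x + t *\<^sub>R axis j 1) \<bullet> b) has_derivative (\<lambda>t. (t *\<^sub>R v) \<bullet> b)) (at 0)"
      by (simp add: b inner_axis has_field_derivative_def mult.commute [of _ "v $ i"])
  qed
  then have "((\<lambda>t. f (g (x + t *\<^sub>R axis j 1))) has_real_derivative f' v) (at 0)"
    using f' e gV by (intro has_derivative_along_curve [where U = V]) auto
  moreover have "f' v = (\<Sum>i\<in>ev D. v $ i * f' (axis i 1))"
    using f' by (intro linear_body_space has_derivative_linear) (auto simp: v_def body_space_def)
  moreover have "\<dots> = (\<Sum>i\<in>ev D. partial j (\<lambda>x. g x $ i) x * partial i f (g x))"
    using has_derivative_partial(2) [OF f' V] gV x by (intro sum.cong) (auto simp: v_def)
  ultimately show "((\<lambda>t. f (g (x + t *\<^sub>R axis j 1))) has_real_derivative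
      (\<Sum>i\<in>ev D. partial j (\<lambda>x. g x $ i) x * partial i f (g x))) (at 0)" by simp
qed

lemma smooth_compose:
  fixes g :: "real ^ 'j::finite \<Rightarrow> real ^ 'i::finite"
  assumes U: "dom_open D' U" and V: "dom_open D V"
    and f: "smooth_fun_on D V f" and gV: "\<And>x. x \<in> U \<Longrightarrow> g x \<in> V"
    and g: "\<And>i. i \<in> ev D \<Longrightarrow> smooth_fun_on D' U (\<lambda>x. g x $ i)"
  shows "smooth_fun_on D' U (\<lambda>x. f (g x))"
proof -
  let ?B = "\<lambda>h. smooth_fun_on D' U h \<or> (\<exists>f. smooth_fun_on D V f \<and> h = (\<lambda>x. f (g x)))"
  have gd: "g differentiable_on U"
    unfolding differentiable_on_def
  proof (rule ballI)
    fix x assume x: "x \<in> U"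
    show "g differentiable at x within U"
    proof (subst differentiable_componentwise_within, rule ballI)
      fix b :: "real ^ 'i" assume "b \<in> Basis"
      then obtain i where b: "b = axis i 1" by (auto simp: Basis_vec_def)
      have "(\<lambda>x. g x $ i) differentiable_on U"
      proof (cases "i \<in> ev D")
        case False
        then have "g y $ i = 0" if "y \<in> U" for y
          using dom_open_subset [OF V gV [OF that(1)]] by (simp add: body_space_def)
        then show ?thesis 
          by (intro differentiable_on_cong [OF differentiable_on_const [of 0 U], of "\<lambda>x. g x $ i"]) simp
      qed (use g smooth_differentiable in blast)
      then show "(\<lambda>x. g x \<bullet> b) differentiable at x within U"
        using x by (simp add: b inner_axis differentiable_on_def)
    qed
  qed
  have sum: "alg_gen ?B (\<lambda>x. \<Sum>k\<in>A. h k x)" if "\<And>k. k \<in> A \<Longrightarrow> alg_gen ?B (h k)" for A and h :: "'i \<Rightarrow> _"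
    using that by (induction A rule: infinite_finite_induct) (auto intro: alg_gen.intros simp: U)
  show ?thesis
  proof (rule smooth_alg_gen [OF U, where B = ?B])
    show "alg_gen ?B (\<lambda>x. f (g x))" using f by (intro alg_gen.gen) blast
    show "h differentiable_on U" if "?B h" for h
      using that
    proof
      assume "\<exists>f. smooth_fun_on D V f \<and> h = (\<lambda>x. f (g x))"
      then obtain f where f: "smooth_fun_on D V f" "h = (\<lambda>x. f (g x))" by blast
      then have "f differentiable_on g ` U" using gV
        by (intro differentiable_on_subset [OF smooth_differentiable]) auto
      then show ?thesis using differentiable_on_compose [OF gd] by (simp add: f o_def)
    qed (rule smooth_differentiable)
    show "\<exists>k. alg_gen ?B k \<and> (\<forall>x\<in>U. partial j h x = k x)" if "?B h" "j \<in> ev D'" for h j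
      using that(1)
    proof
      assume "smooth_fun_on D' U h"
      then show ?thesis using that by (intro exI [of _ "partial j h"]) (auto intro: alg_gen.gen smooth_partial)
    next
      assume "\<exists>f. smooth_fun_on D V f \<and> h = (\<lambda>x. f (g x))"
      then obtain f where f: "smooth_fun_on D V f" "h = (\<lambda>x. f (g x))" by blast
      have "alg_gen ?B (\<lambda>x. partial j (\<lambda>x. g x $ i) x * partial i f (g x))" if "i \<in> ev D" for i
      proof (rule alg_gen.mult)
        show "alg_gen ?B (\<lambda>x. partial i f (g x))" using f smooth_partial that by (blast intro: alg_gen.gen)
        have "smooth_fun_on D' U (partial j (\<lambda>x. g x $ i))" using g smooth_partial that \<open>j \<in> ev D'\<close> by blast
        then show "alg_gen ?B (\<lambda>x. partial j (\<lambda>x. g x $ i) x)" by (blast intro: alg_gen.gen)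
      qed
      then have "alg_gen ?B (\<lambda>x. \<Sum>i\<in>ev D. partial j (\<lambda>x. g x $ i) x * partial i f (g x))" by (rule sum)
      moreover have "partial j h x = (\<Sum>i\<in>ev D. partial j (\<lambda>x. g x $ i) x * partial i f (g x))" if "x \<in> U" for x
        unfolding f(2) by (rule partial_compose [OF U V that \<open>j \<in> ev D'\<close>])
          (use f g gV smooth_differentiable in blast)+
      ultimately show ?thesis by blast
    qed
  qed
qed

text \<open>The left-hand side is symmetric in \<open>i\<close> and \<open>j\<close>, whence Clairaut's theorem for \<open>h \<rightarrow> 0\<close>.\<close>

lemma second_difference:
  assumes U: "dom_open D U" and f: "smooth_fun_on D U f" and ij: "i \<in> ev D" "j \<in> ev D" and h: "h > 0"
    and box: "\<And>s t. 0 \<le> s \<Longrightarrow> s \<le> h \<Longrightarrow> 0 \<le> t \<Longrightarrow> t \<le> h \<Longrightarrow> x + s *\<^sub>R axis i 1 + t *\<^sub>R axis j 1 \<in> U"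
  shows "\<exists>s t. 0 < s \<and> s < h \<and> 0 < t \<and> t < h \<and>
    f (x + h *\<^sub>R axis i 1 + h *\<^sub>R axis j 1) - f (x + h *\<^sub>R axis i 1) - f (x + h *\<^sub>R axis j 1) + f x =
    h * h * partial j (partial i f) (x + s *\<^sub>R axis i 1 + t *\<^sub>R axis j 1)"
proof -
  have D: "((\<lambda>t. k (y + t *\<^sub>R axis l 1)) has_real_derivative partial l k (y + s *\<^sub>R axis l 1)) (at s)"
    if "smooth_fun_on D U k" "l \<in> ev D" "y + s *\<^sub>R axis l 1 \<in> U" for k l y s
  proof -
    have "((\<lambda>t. k (y + s *\<^sub>R axis l 1 + t *\<^sub>R axis l 1)) has_real_derivative partial l k (y + s *\<^sub>R axis l 1)) (at 0)"
      using differentiable_partial [OF smooth_differentiable [OF that(1)] U that(3,2)] .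
    then have "((\<lambda>t. k (y + (s + t) *\<^sub>R axis l 1)) has_real_derivative partial l k (y + s *\<^sub>R axis l 1)) (at 0)"
      by (simp add: algebra_simps)
    then show ?thesis using DERIV_at_within_shift [of "\<lambda>t. k (y + t *\<^sub>R axis l 1)" _ s 0 UNIV] by simp
  qed
  \<comment> \<open>\<open>\<phi>\<close> is the increment of \<open>f\<close> in direction
    \<open>j\<close> as a function of the displacement \<open>s\<close> in direction
    \<open>i\<close>. The mean value theorem in \<open>s\<close>, then in \<open>t\<close>, turns
    the second difference into a mixed derivative at an interior point.\<close>
  define \<phi> where "\<phi> s = f (x + h *\<^sub>R axis j 1 + s *\<^sub>R axis i 1) - f (x + s *\<^sub>R axis i 1)" for s
  have "\<exists>s. 0 < s \<and> s < h \<and> \<phi> h - \<phi> 0 = (h - 0) *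
      (partial i f (x + h *\<^sub>R axis j 1 + s *\<^sub>R axis i 1) - partial i f (x + s *\<^sub>R axis i 1))"
  proof (rule MVT2 [OF h])
    fix s assume s: "0 \<le> s" "s \<le> h"
    then have "x + h *\<^sub>R axis j 1 + s *\<^sub>R axis i 1 \<in> U" "x + s *\<^sub>R axis i 1 \<in> U"
      using box [of s h] box [of s 0] h by (auto simp: algebra_simps)
    then show "(\<phi> has_real_derivative partial i f (x + h *\<^sub>R axis j 1 + s *\<^sub>R axis i 1) -
        partial i f (x + s *\<^sub>R axis i 1)) (at s)"
      unfolding \<phi>_def [abs_def] by (intro DERIV_diff D f ij)
  qed
  then obtain s where s: "0 < s" "s < h" "\<phi> h - \<phi> 0 = h *
      (partial i f (x + h *\<^sub>R axis j 1 + s *\<^sub>R axis i 1) - partial i f (x + s *\<^sub>R axis i 1))" by auto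
  have "\<exists>t. 0 < t \<and> t < h \<and> partial i f (x + s *\<^sub>R axis i 1 + h *\<^sub>R axis j 1) -
      partial i f (x + s *\<^sub>R axis i 1 + 0 *\<^sub>R axis j 1) =
      (h - 0) * partial j (partial i f) (x + s *\<^sub>R axis i 1 + t *\<^sub>R axis j 1)"
    by (rule MVT2 [OF h]) (use s box in \<open>auto intro!: D smooth_partial f ij\<close>)
  then obtain t where t: "0 < t" "t < h" "partial i f (x + s *\<^sub>R axis i 1 + h *\<^sub>R axis j 1) -
      partial i f (x + s *\<^sub>R axis i 1) = h * partial j (partial i f) (x + s *\<^sub>R axis i 1 + t *\<^sub>R axis j 1)"
    by auto
  have "\<phi> h - \<phi> 0 = h * h * partial j (partial i f) (x + s *\<^sub>R axis i 1 + t *\<^sub>R axis j 1)"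
    using s(3) t(3) by (simp add: algebra_simps)
  then show ?thesis using s(1,2) t(1,2) by (intro exI [of _ s] exI [of _ t]) (simp add: \<phi>_def algebra_simps)
qed

theorem partial_commute:
  assumes U: "dom_open D U" and f: "smooth_fun_on D U f" and ij: "i \<in> ev D" "j \<in> ev D" and x: "x \<in> U"
  shows "partial i (partial j f) x = partial j (partial i f) x"
proof (rule ccontr)
  let ?A = "partial i (partial j f)" and ?B = "partial j (partial i f)"
  assume neq: "?A x \<noteq> ?B x"
  \<comment> \<open>Half the gap: a common value of the two mixed derivatives at nearby points
    cannot be closer than this to both \<open>?A x\<close> and \<open>?B x\<close>.\<close>
  define \<epsilon> where "\<epsilon> = \<bar>?A x - ?B x\<bar> / 2"
  have "\<epsilon> > 0" using neq by (simp add: \<epsilon>_def)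
  have cont: "continuous_on U ?A" "continuous_on U ?B"
    using f ij by (auto intro!: differentiable_imp_continuous_on smooth_differentiable smooth_partial)
  obtain a where a: "a > 0" "\<And>y. y \<in> U \<Longrightarrow> dist y x < a \<Longrightarrow> dist (?A y) (?A x) < \<epsilon>"
    using cont(1) x \<open>\<epsilon> > 0\<close> unfolding continuous_on_iff by meson
  obtain b where b: "b > 0" "\<And>y. y \<in> U \<Longrightarrow> dist y x < b \<Longrightarrow> dist (?B y) (?B x) < \<epsilon>"
    using cont(2) x \<open>\<epsilon> > 0\<close> unfolding continuous_on_iff by meson
  obtain e where e: "e > 0" "\<And>y. y \<in> body_space D \<Longrightarrow> dist y x < e \<Longrightarrow> y \<in> U"
    using dom_open_ball U x by blast
  \<comment> \<open>A point of the square is at distance at most \<open>2 * h\<close> from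
    \<open>x\<close>, which the factor four keeps below all three radii.\<close>
  define h where "h = min (min a b) e / 4"
  have h: "h > 0" "2 * h < a" "2 * h < b" "2 * h < e" using a(1) b(1) e(1) by (auto simp: h_def)
  have near: "dist (x + s *\<^sub>R axis k 1 + t *\<^sub>R axis l 1) x \<le> 2 * h"
    if "0 \<le> s" "s \<le> h" "0 \<le> t" "t \<le> h" for s t k l
  proof -
    have "norm (s *\<^sub>R axis k 1 + t *\<^sub>R axis l 1 :: real ^ 'a) \<le> norm (s *\<^sub>R axis k 1 :: real ^ 'a) + norm (t *\<^sub>R axis l 1 :: real ^ 'a)"
      by (rule norm_triangle_ineq)
    then show ?thesis using that by (simp add: dist_norm add.assoc)
  qed
  have inU: "x + s *\<^sub>R axis k 1 + t *\<^sub>R axis l 1 \<in> U"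
    if "0 \<le> s" "s \<le> h" "0 \<le> t" "t \<le> h" "k \<in> ev D" "l \<in> ev D" for s t k l
    using near [OF that(1-4), of k l] h that dom_open_subset [OF U x]
    by (intro e(2) body_space_shift) auto
  obtain s t where st: "0 < s" "s < h" "0 < t" "t < h"
    "f (x + h *\<^sub>R axis i 1 + h *\<^sub>R axis j 1) - f (x + h *\<^sub>R axis i 1) - f (x + h *\<^sub>R axis j 1) + f x =
    h * h * ?B (x + s *\<^sub>R axis i 1 + t *\<^sub>R axis j 1)"
    using second_difference [OF U f ij h(1) inU] ij by blast
  obtain s' t' where st': "0 < s'" "s' < h" "0 < t'" "t' < h"
    "f (x + h *\<^sub>R axis j 1 + h *\<^sub>R axis i 1) - f (x + h *\<^sub>R axis j 1) - f (x + h *\<^sub>R axis i 1) + f x =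
    h * h * ?A (x + s' *\<^sub>R axis j 1 + t' *\<^sub>R axis i 1)"
    using second_difference [OF U f ij(2,1) h(1) inU] ij by blast
  have "h * h * ?B (x + s *\<^sub>R axis i 1 + t *\<^sub>R axis j 1) = h * h * ?A (x + s' *\<^sub>R axis j 1 + t' *\<^sub>R axis i 1)"
    unfolding st(5) [symmetric] st'(5) [symmetric] by (simp add: algebra_simps)
  then have eq: "?B (x + s *\<^sub>R axis i 1 + t *\<^sub>R axis j 1) = ?A (x + s' *\<^sub>R axis j 1 + t' *\<^sub>R axis i 1)"
    using h(1) by simp
  have "dist (?B (x + s *\<^sub>R axis i 1 + t *\<^sub>R axis j 1)) (?B x) < \<epsilon>"
  proof (rule b(2))
    show "x + s *\<^sub>R axis i 1 + t *\<^sub>R axis j 1 \<in> U" using st(1-4) ij by (intro inU) auto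
    show "dist (x + s *\<^sub>R axis i 1 + t *\<^sub>R axis j 1) x < b"
      using near [of s t i j] st(1-4) h(3) by linarith
  qed
  moreover have "dist (?A (x + s' *\<^sub>R axis j 1 + t' *\<^sub>R axis i 1)) (?A x) < \<epsilon>"
  proof (rule a(2))
    show "x + s' *\<^sub>R axis j 1 + t' *\<^sub>R axis i 1 \<in> U" using st'(1-4) ij by (intro inU) auto
    show "dist (x + s' *\<^sub>R axis j 1 + t' *\<^sub>R axis i 1) x < a"
      using near [of s' t' j i] st'(1-4) h(2) by linarith
  qed
  moreover have "False" if "\<bar>u - v\<bar> < \<bar>w - v\<bar> / 2" "\<bar>u - w\<bar> < \<bar>w - v\<bar> / 2" for u v w :: real
    using that by (simp add: abs_if split: if_splits)
  ultimately show False unfolding eq \<epsilon>_def dist_real_def by blast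
qed

lemma partials_partial_commute:
  assumes U: "dom_open D U" and f: "smooth_fun_on D U f" and "i \<in> ev D" "set is \<subseteq> ev D" "x \<in> U"
  shows "partials is (partial i f) x = partial i (partials is f) x"
  using assms(4,5)
proof (induction "is" arbitrary: x)
  case (Cons j "is")
  have "partials (j # is) (partial i f) x = partial j (partial i (partials is f)) x"
    using Cons by (auto intro!: partial_cong [OF U])
  also have "\<dots> = partial i (partial j (partials is f)) x"
    using Cons assms by (intro partial_commute [OF U] smooth_partials f) auto
  finally show ?case by simp
qed simp

section \<open>Calculus of superfunctions\<close>

definition val :: "'i::finite sfun \<Rightarrow> real ^ 'i \<Rightarrow> 'i gr" where
  "val F x = Gr (\<lambda>S. F S x)"

lemma gc_val [simp]: "gc (val F x) S = F S x" by (simp add: val_def)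

lemma val_eq_iff: "val F x = val G y \<longleftrightarrow> (\<forall>S. F S x = G S y)"
  by (metis gc_val gr_eqI)

lemma sfun_eq_on_val: "sfun_eq_on U F G \<longleftrightarrow> (\<forall>x\<in>U. val F x = val G x)"
  by (simp add: sfun_eq_on_def val_eq_iff)

lemma even_on_val: "even_on U F \<longleftrightarrow> (\<forall>x\<in>U. gev (val F x))"
  by (simp add: even_on_def gev_iff)

lemma odd_on_val: "odd_on U F \<longleftrightarrow> (\<forall>x\<in>U. god (val F x))"
  by (simp add: odd_on_def god_iff)

definition gsoul :: "'i::{finite,linorder} gr \<Rightarrow> 'i gr" where
  "gsoul a = a - gc a {} *\<^sub>R 1"

definition stau :: "'i::{finite,linorder} sfun \<Rightarrow> 'i sfun" where
  "stau F = (\<lambda>S x. (- 1) ^ card S * F S x)"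

lemma val_simps [simp]:
  fixes F G :: "'i::{finite,linorder} sfun"
  shows "val (sadd F G) x = val F x + val G x"
    "val (sscale c F) x = c *\<^sub>R val F x"
    "val (ssum K A) x = (\<Sum>k\<in>A. val (K k) x)"
    "val (smul F G) x = val F x * val G x"
    "val sone x = (1 :: 'i gr)" "val szero x = (0 :: 'i gr)"
    "val (soul F) x = gsoul (val F x)" "val (stau F) x = gtau (val F x)"
  by (auto intro!: gr_eqI simp: sadd_def sscale_def ssum_def smul_def sone_def szero_def soul_def
      gsoul_def gc_mult gc_one stau_def)

lemma val_sprod [simp]: "val (sprod Fs) x = prod_list (map (\<lambda>F. val F x) Fs)"
  by (induction Fs) (auto simp: sprod_def)

lemma val_sderiv_odd: "i \<in> od D \<Longrightarrow> val (sderiv D i F) x = gd i (val F x)"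
  by (auto intro!: gr_eqI simp: sderiv_def gc_gd)

abbreviation superdomain :: "'i::finite sdim \<Rightarrow> (real ^ 'i) set \<Rightarrow> bool" where
  "superdomain D U \<equiv> ev D \<inter> od D = {} \<and> dom_open D U"

lemma coords_cases:
  assumes "i \<in> coords D" "ev D \<inter> od D = {}"
  obtains (even) "i \<in> ev D" "i \<notin> od D" | (odd) "i \<in> od D" "i \<notin> ev D"
  using assms by (auto simp: coords_def)

lemma superfun_smooth: "superfun_on D U F \<Longrightarrow> smooth_fun_on D U (F S)"
  by (simp add: superfun_on_def)

lemma superfun_vanish: "superfun_on D U F \<Longrightarrow> \<not> S \<subseteq> od D \<Longrightarrow> x \<in> U \<Longrightarrow> F S x = 0"
  by (simp add: superfun_on_def)

lemma superfun_subset: "superfun_on D U F \<Longrightarrow> V \<subseteq> U \<Longrightarrow> superfun_on D V F"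
  unfolding superfun_on_def by (meson smooth_subset subsetD)

lemma superfun_cong:
  assumes "dom_open D U" "superfun_on D U F" "\<And>x. x \<in> U \<Longrightarrow> val F x = val G x"
  shows "superfun_on D U G"
  unfolding superfun_on_def
proof (intro conjI allI impI ballI)
  have eq: "F S x = G S x" if "x \<in> U" for S x using assms(3) [OF that] by (simp add: val_eq_iff)
  show "smooth_fun_on D U (G S)" for S
    by (rule smooth_cong [OF assms(1) superfun_smooth [OF assms(2)]]) (rule eq)
  show "G S x = 0" if "\<not> S \<subseteq> od D" "x \<in> U" for S x
    using superfun_vanish [OF assms(2) that] eq that by simp
qed

lemma superfun_sadd:
  "dom_open D U \<Longrightarrow> superfun_on D U F \<Longrightarrow> superfun_on D U G \<Longrightarrow> superfun_on D U (sadd F G)"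
  by (auto simp: superfun_on_def sadd_def smooth_add)

lemma superfun_sscale:
  "dom_open D U \<Longrightarrow> superfun_on D U F \<Longrightarrow> superfun_on D U (sscale c F)"
  by (auto simp: superfun_on_def sscale_def smooth_mult)

lemma superfun_stau:
  "dom_open D U \<Longrightarrow> superfun_on D U F \<Longrightarrow> superfun_on D U (stau F)"
  by (auto simp: superfun_on_def stau_def smooth_mult)

lemma superfun_ssum:
  "dom_open D U \<Longrightarrow> (\<And>k. k \<in> A \<Longrightarrow> superfun_on D U (K k)) \<Longrightarrow> superfun_on D U (ssum K A)"
  by (auto simp: superfun_on_def ssum_def smooth_sum)

lemma superfun_sone: "dom_open D U \<Longrightarrow> superfun_on D U sone"
  by (auto simp: superfun_on_def sone_def)

lemma superfun_szero: "dom_open D U \<Longrightarrow> superfun_on D U szero"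
  by (auto simp: superfun_on_def szero_def)

lemma superfun_smul:
  assumes "dom_open D U" "superfun_on D U F" "superfun_on D U G"
  shows "superfun_on D U (smul F G)"
  unfolding superfun_on_def
proof (intro conjI allI impI ballI)
  show "smooth_fun_on D U (smul F G S)" for S
    unfolding smul_def using assms by (intro smooth_sum smooth_mult smooth_const superfun_smooth)
  fix S x assume S: "\<not> S \<subseteq> od D" and x: "x \<in> U"
  have "F R x = 0 \<or> G (S - R) x = 0" if "R \<in> Pow S" for R
  proof -
    have "\<not> R \<subseteq> od D \<or> \<not> S - R \<subseteq> od D" using S that by blast
    then show ?thesis using superfun_vanish assms x by blast
  qed
  then show "smul F G S x = 0" unfolding smul_def by (intro sum.neutral) auto
qed

lemma superfun_sprod:
  "dom_open D U \<Longrightarrow> (\<And>F. F \<in> set Fs \<Longrightarrow> superfun_on D U F) \<Longrightarrow> superfun_on D U (sprod Fs)"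
  by (induction Fs) (auto simp: sprod_def superfun_sone superfun_smul)

lemma smooth_if:
  "(b \<Longrightarrow> smooth_fun_on D U f) \<Longrightarrow> (\<not> b \<Longrightarrow> smooth_fun_on D U g) \<Longrightarrow>
   smooth_fun_on D U (\<lambda>x. if b then f x else g x)"
  by (cases b) simp_all

lemma superfun_soul: "dom_open D U \<Longrightarrow> superfun_on D U F \<Longrightarrow> superfun_on D U (soul F)"
  by (auto simp: superfun_on_def soul_def intro!: smooth_if)

lemma superfun_scoord: "dom_open D U \<Longrightarrow> superfun_on D U (scoord D i)"
  by (auto simp: superfun_on_def scoord_def intro!: smooth_if smooth_coordinate smooth_const)

lemma superfun_sderiv:
  assumes "superdomain D U" "superfun_on D U F" "i \<in> coords D"
  shows "superfun_on D U (sderiv D i F)"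
  unfolding superfun_on_def
proof (intro conjI allI impI ballI)
  note U = conjunct2 [OF assms(1)]
  show "smooth_fun_on D U (sderiv D i F S)" for S
    using assms U superfun_smooth [OF assms(2)]
    by (auto simp: sderiv_def coords_def intro!: smooth_if smooth_mult smooth_partial)
  fix S x assume S: "\<not> S \<subseteq> od D" and x: "x \<in> U"
  from assms(3) conjunct1 [OF assms(1)] show "sderiv D i F S x = 0"
  proof (cases rule: coords_cases)
    case even
    then have "partial i (F S) x = partial i (\<lambda>x. 0) x"
      using superfun_vanish [OF assms(2) S] by (intro partial_cong [OF U x]) auto
    then show ?thesis using even by (simp add: sderiv_def)
  next
    case odd
    then show ?thesis using superfun_vanish [OF assms(2) _ x, of "insert i S"] S by (auto simp: sderiv_def)
  qed
qed

lemma sderiv_cong: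
  assumes "superdomain D U" "i \<in> coords D" "x \<in> U" "\<And>y. y \<in> U \<Longrightarrow> val F y = val G y"
  shows "val (sderiv D i F) x = val (sderiv D i G) x"
proof (rule gr_eqI)
  have eq: "F S y = G S y" if "y \<in> U" for S y using assms(4) [OF that] by (simp add: val_eq_iff)
  fix S show "gc (val (sderiv D i F) x) S = gc (val (sderiv D i G) x) S"
    using assms(1-3) eq partial_cong [of D U x i "F S" "G S"] by (auto simp: sderiv_def coords_def)
qed

lemma sderiv_sadd:
  assumes "superdomain D U" "i \<in> coords D" "x \<in> U" "superfun_on D U F" "superfun_on D U G"
  shows "val (sderiv D i (sadd F G)) x = val (sderiv D i F) x + val (sderiv D i G) x"
proof (cases "i \<in> od D")
  case False
  then have "i \<in> ev D" using assms by (auto simp: coords_def)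
  then show ?thesis using False assms
    by (auto intro!: gr_eqI simp: sderiv_def sadd_def partial_add [where D = D and U = U]
        smooth_differentiable [OF superfun_smooth])
qed (simp add: val_sderiv_odd)

lemma sderiv_sscale:
  assumes "superdomain D U" "i \<in> coords D" "x \<in> U" "superfun_on D U F"
  shows "val (sderiv D i (sscale c F)) x = c *\<^sub>R val (sderiv D i F) x"
proof (cases "i \<in> od D")
  case False
  then have "i \<in> ev D" using assms by (auto simp: coords_def)
  then show ?thesis using False assms
    by (auto intro!: gr_eqI simp: sderiv_def sscale_def partial_cmult [where D = D and U = U] superfun_smooth)
qed (simp add: val_sderiv_odd)

lemma sderiv_ssum:
  assumes "superdomain D U" "i \<in> coords D" "x \<in> U" "\<And>k. k \<in> A \<Longrightarrow> superfun_on D U (K k)"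
  shows "val (sderiv D i (ssum K A)) x = (\<Sum>k\<in>A. val (sderiv D i (K k)) x)"
proof (cases "i \<in> od D")
  case False
  then have "i \<in> ev D" using assms by (auto simp: coords_def)
  then show ?thesis using False assms
    by (auto intro!: gr_eqI simp: sderiv_def ssum_def partial_sum [where D = D and U = U] superfun_smooth)
next
  case True
  then show ?thesis
    by (induction A rule: infinite_finite_induct) (auto simp: val_sderiv_odd)
qed

lemma sderiv_sone: "val (sderiv D i sone) x = 0"
  by (auto intro!: gr_eqI simp: sderiv_def sone_def)

text \<open>\<open>gpar b\<close> is the sign picked up when an object, odd iff \<open>b\<close>, moves past its argument.\<close>

definition gpar :: "bool \<Rightarrow> 'i::{finite,linorder} gr \<Rightarrow> 'i gr" where
  "gpar b a = (if b then gtau a else a)"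

lemma gpar_simps [simp]:
  "gpar True a = gtau a" "gpar False a = a" "gpar b (gpar b a) = a"
  "gpar b 0 = 0" "gpar b 1 = 1" "gpar b (x + y) = gpar b x + gpar b y" "gpar b (- x) = - gpar b x"
  "gpar b (x - y) = gpar b x - gpar b y" "gpar b (c *\<^sub>R a) = c *\<^sub>R gpar b a"
  by (auto simp: gpar_def)

lemma gpar_mult: "gpar b (x * y) = gpar b x * gpar b y" by (simp add: gpar_def gtau_mult)
lemma gpar_sum: "gpar b (sum f A) = (\<Sum>k\<in>A. gpar b (f k))" by (simp add: gpar_def gtau_sum)
text \<open>The Koszul sign for exchanging two objects with the given parities, where true means
  odd.\<close>

definition kos :: "bool \<Rightarrow> bool \<Rightarrow> real" where
  "kos b c = (if b \<and> c then - 1 else 1)"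

lemma kos_square [simp]: "kos b c * kos b c = 1" by (auto simp: kos_def)
lemma kos_sym: "kos b c = kos c b" by (auto simp: kos_def)
lemma kos_simps [simp]: "kos False c = 1" "kos b False = 1" "kos True True = -1" by (auto simp: kos_def)

definition has_parity :: "bool \<Rightarrow> 'i::{finite,linorder} gr \<Rightarrow> bool" where
  "has_parity b a \<longleftrightarrow> gtau a = (if b then - a else a)"

lemma has_parity_simps: "has_parity True a \<longleftrightarrow> god a" "has_parity False a \<longleftrightarrow> gev a"
  by (auto simp: has_parity_def god_def gev_def)

lemma gpar_has_parity: "has_parity c a \<Longrightarrow> gpar b a = kos b c *\<^sub>R a"
  by (auto simp: has_parity_def gpar_def kos_def)

lemma has_parity_commute: "has_parity c a \<Longrightarrow> a * b = gpar c b * a"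
  using gev_commute [of a b] god_commute [of a b] by (cases c) (auto simp: has_parity_simps)

lemma has_parity_commute': "has_parity c a \<Longrightarrow> b * a = a * gpar c b"
  using has_parity_commute [of c a "gpar c b"] by simp

lemma has_parity_mult: "has_parity b x \<Longrightarrow> has_parity c y \<Longrightarrow> has_parity (b \<noteq> c) (x * y)"
  by (auto simp: has_parity_def gtau_mult)

lemma has_parity_add: "has_parity b x \<Longrightarrow> has_parity b y \<Longrightarrow> has_parity b (x + y)"
  by (auto simp: has_parity_def)

lemma has_parity_scaleR: "has_parity b x \<Longrightarrow> has_parity b (r *\<^sub>R x)"
  by (auto simp: has_parity_def)

lemma has_parity_0 [simp]: "has_parity b 0"
  by (auto simp: has_parity_def)

lemma has_parity_sum: "(\<And>k. k \<in> A \<Longrightarrow> has_parity b (f k)) \<Longrightarrow> has_parity b (sum f A)"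
  by (induction A rule: infinite_finite_induct) (auto intro: has_parity_add)

lemma has_parity_eul: "has_parity b x \<Longrightarrow> has_parity b (eul x)"
  by (auto simp: has_parity_def simp flip: eul_gtau)

lemma has_parity_one: "has_parity False 1"
  by (simp add: has_parity_def)

lemma sderiv_smul:
  assumes "superdomain D U" "i \<in> coords D" "x \<in> U" "superfun_on D U F" "superfun_on D U G"
  shows "val (sderiv D i (smul F G)) x =
    val (sderiv D i F) x * val G x + gpar (i \<in> od D) (val F x) * val (sderiv D i G) x"
proof (cases "i \<in> od D")
  case False
  then have i: "i \<in> ev D" using assms by (auto simp: coords_def)
  note U = conjunct2 [OF assms(1)] and s = superfun_smooth [OF assms(4)] superfun_smooth [OF assms(5)]
  show ?thesis
  proof (rule gr_eqI)
    fix S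
    have "gc (val (sderiv D i (smul F G)) x) S = (\<Sum>R\<in>Pow S. partial i (\<lambda>x. gsign R (S - R) * F R x * G (S - R) x) x)"
      using False U by (simp add: sderiv_def smul_def)
        (intro partial_sum [OF U assms(3) i] smooth_mult s smooth_const)
    also have "\<dots> = (\<Sum>R\<in>Pow S. gsign R (S - R) * partial i (F R) x * G (S - R) x +
        gsign R (S - R) * F R x * partial i (G (S - R)) x)"
    proof (rule sum.cong [OF refl])
      fix R
      show "partial i (\<lambda>x. gsign R (S - R) * F R x * G (S - R) x) x =
          gsign R (S - R) * partial i (F R) x * G (S - R) x + gsign R (S - R) * F R x * partial i (G (S - R)) x"
        using partial_mult [OF U assms(3) i, of "\<lambda>x. gsign R (S - R) * F R x" "G (S - R)"]
          partial_cmult [OF U assms(3) i s(1), of "gsign R (S - R)" R]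
          smooth_differentiable [OF smooth_mult [OF U smooth_const [OF U] s(1)], of "gsign R (S - R)" R]
          smooth_differentiable [OF s(2)]
        by simp
    qed
    also have "\<dots> = gc (val (sderiv D i F) x * val G x + val F x * val (sderiv D i G) x) S"
      using False by (simp add: gc_mult sderiv_def sum.distrib)
    finally show "gc (val (sderiv D i (smul F G)) x) S =
      gc (val (sderiv D i F) x * val G x + gpar (i \<in> od D) (val F x) * val (sderiv D i G) x) S"
      using False by simp
  qed
qed (simp add: val_sderiv_odd gd_mult)

lemma sderiv_stau:
  assumes "superdomain D U" "i \<in> coords D" "x \<in> U" "superfun_on D U F"
  shows "val (sderiv D i (stau F)) x = kos (i \<in> od D) True *\<^sub>R gtau (val (sderiv D i F) x)"
proof (cases "i \<in> od D")
  case False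
  then have i: "i \<in> ev D" using assms by (auto simp: coords_def)
  show ?thesis using False i assms
    by (auto intro!: gr_eqI simp: sderiv_def stau_def partial_cmult [where D = D and U = U] superfun_smooth)
qed (simp add: val_sderiv_odd gd_gtau)

text \<open>Three mechanisms meet here: symmetry of second derivatives for two even coordinates,
  anticommutation of left derivatives for two odd ones, and linearity in the mixed case, because an
  odd derivative only relabels coefficients and multiplies them by constants.\<close>

lemma sderiv_commute:
  assumes "superdomain D U" "i \<in> coords D" "j \<in> coords D" "x \<in> U" "superfun_on D U F"
  shows "val (sderiv D i (sderiv D j F)) x = kos (i \<in> od D) (j \<in> od D) *\<^sub>R val (sderiv D j (sderiv D i F)) x"
proof -
  note U = conjunct2 [OF assms(1)] and s = superfun_smooth [OF assms(5)]
  have mixed: "val (sderiv D i (sderiv D j F)) x = val (sderiv D j (sderiv D i F)) x"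
    if "i \<in> ev D" "i \<notin> od D" "j \<in> od D" for i j
  proof (rule gr_eqI)
    fix S
    have "partial i (\<lambda>x. gsign {j} S * F (insert j S) x) x = gsign {j} S * partial i (F (insert j S)) x"
      by (rule partial_cmult [OF U assms(4) that(1) s])
    then show "gc (val (sderiv D i (sderiv D j F)) x) S = gc (val (sderiv D j (sderiv D i F)) x) S"
      using that by (simp add: sderiv_def)
  qed
  consider "i \<in> ev D" "i \<notin> od D" "j \<in> ev D" "j \<notin> od D" | "i \<in> ev D" "i \<notin> od D" "j \<in> od D"
    | "i \<in> od D" "j \<in> ev D" "j \<notin> od D" | "i \<in> od D" "j \<in> od D"
    using assms by (auto simp: coords_def)
  then show ?thesis
  proof cases
    case 1
    then show ?thesis
      by (auto intro!: gr_eqI simp: sderiv_def partial_commute [OF U s _ _ assms(4)])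
  next
    case 4
    then show ?thesis using gd_commute by (auto simp: val_sderiv_odd)
  qed (use mixed [of i j] mixed [of j i] in \<open>simp_all add: kos_def\<close>)
qed

lemma partial_if: "partial j (\<lambda>x. if b then f x else g x) x = (if b then partial j f x else partial j g x)"
  by (cases b) simp_all

lemma sderiv_scoord:
  assumes "i \<in> coords D" "j \<in> coords D" "ev D \<inter> od D = {}"
  shows "val (sderiv D j (scoord D i)) x = (if i = j then 1 else 0)"
  using assms
  by (auto intro!: gr_eqI simp: sderiv_def scoord_def coords_def gc_one partial_coordinate partial_if)

text \<open>Homogeneity on \<open>U\<close> is a linear equation between \<open>stau F\<close> and
  \<open>F\<close>; differentiating this equation gives the parity of the derivative.\<close>

lemma sderiv_has_parity:
  assumes "superdomain D U" "i \<in> coords D" "x \<in> U" "superfun_on D U F"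
    and "\<And>y. y \<in> U \<Longrightarrow> has_parity b (val F y)"
  shows "has_parity (b \<noteq> (i \<in> od D)) (val (sderiv D i F) x)"
proof -
  have "val (stau F) y = val (sscale (if b then - 1 else 1) F) y" if "y \<in> U" for y
    using assms(5) [OF that] by (auto simp: has_parity_def)
  then have "val (sderiv D i (stau F)) x = val (sderiv D i (sscale (if b then - 1 else 1) F)) x"
    by (intro sderiv_cong [OF assms(1-3)])
  then have "kos (i \<in> od D) True *\<^sub>R gtau (val (sderiv D i F) x) = (if b then - 1 else 1) *\<^sub>R val (sderiv D i F) x"
    using sderiv_stau [OF assms(1-4)] sderiv_sscale [OF assms(1-4)] by metis
  then show ?thesis
    by (cases b; cases "i \<in> od D") (auto simp: has_parity_def minus_equation_iff [of "gtau _"])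
qed

lemma scoord_has_parity: "has_parity (i \<in> od D) (val (scoord D i) x)"
  by (cases "i \<in> od D") (auto simp: has_parity_simps gev_iff god_iff scoord_def)

section \<open>Substitution at a point\<close>

definition spar :: "bool \<Rightarrow> 'i::{finite,linorder} sfun \<Rightarrow> 'i sfun" where
  "spar b F = (if b then stau F else F)"

lemma val_spar [simp]: "val (spar b F) x = gpar b (val F x)" by (simp add: spar_def)

lemma superfun_spar: "dom_open D U \<Longrightarrow> superfun_on D U F \<Longrightarrow> superfun_on D U (spar b F)"
  by (simp add: spar_def superfun_stau)

lemma gc_gsoul_empty [simp]: "gc (gsoul a) {} = 0" by (simp add: gsoul_def gc_one)
lemma eul_gsoul [simp]: "eul (gsoul a) = eul a" by (simp add: gsoul_def)
lemma has_parity_gsoul: "has_parity False a \<Longrightarrow> has_parity False (gsoul a)"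
  by (simp add: gsoul_def has_parity_def)

lemma has_parity_prod_list:
  "(\<And>a. a \<in> set as \<Longrightarrow> has_parity False a) \<Longrightarrow> has_parity False (prod_list as)"
proof (induction as)
  case (Cons a as)
  then show ?case using has_parity_mult [of False a False "prod_list as"] by simp
qed (simp add: has_parity_one)

definition gbody :: "'i::finite sdim \<Rightarrow> ('i \<Rightarrow> 'j::finite gr) \<Rightarrow> real ^ 'i" where
  "gbody D \<phi> = (\<chi> i. if i \<in> ev D then gc (\<phi> i) {} else 0)"

text \<open>The part of order \<open>l\<close> of the Taylor sum, with the factor
  \<open>1 / fact l\<close> left out: splitting off the first entry of the list then gives a
  recursion in \<open>l\<close> without denominators, see \<open>gtay_term_Suc\<close>.\<close>

definition gtay_term ::
  "'i::finite sdim \<Rightarrow> nat \<Rightarrow> (real ^ 'i \<Rightarrow> real) \<Rightarrow> ('i \<Rightarrow> 'j::{finite,linorder} gr) \<Rightarrow> 'j gr" where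
  "gtay_term D l f \<phi> = (\<Sum>is | set is \<subseteq> ev D \<and> length is = l.
     partials is f (gbody D \<phi>) *\<^sub>R prod_list (map (\<lambda>i. gsoul (\<phi> i)) is))"

definition gtay ::
  "'i::finite sdim \<Rightarrow> (real ^ 'i \<Rightarrow> real) \<Rightarrow> ('i \<Rightarrow> 'j::{finite,linorder} gr) \<Rightarrow> 'j gr" where
  "gtay D f \<phi> = (\<Sum>l\<le>CARD('j). (1 / fact l) *\<^sub>R gtay_term D l f \<phi>)"

definition gmon :: "('i::{finite,linorder} \<Rightarrow> 'j::{finite,linorder} gr) \<Rightarrow> 'i set \<Rightarrow> 'j gr" where
  "gmon \<phi> S = prod_list (map \<phi> (sorted_list_of_set S))"

text \<open>The value of \<open>spull D F \<Phi>\<close> at a point, as a function of the values \<open>\<phi>\<close> of \<open>\<Phi>\<close> at that point.\<close>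

definition gpull ::
  "'i::{finite,linorder} sdim \<Rightarrow> 'i sfun \<Rightarrow> ('i \<Rightarrow> 'j::{finite,linorder} gr) \<Rightarrow> 'j gr" where
  "gpull D F \<phi> = (\<Sum>S\<in>Pow (od D). gtay D (F S) \<phi> * gmon \<phi> S)"

lemma body_map_gbody: "body_map D \<Phi> x = gbody D (\<lambda>i. val (\<Phi> i) x)"
  by (simp add: body_map_def gbody_def vec_eq_iff)

lemma val_taylor: "val (taylor D f \<Phi>) x = gtay D f (\<lambda>i. val (\<Phi> i) x)"
proof (rule gr_eqI)
  fix S
  have "sprod (map (\<lambda>i. soul (\<Phi> i)) is) S x = gc (prod_list (map (\<lambda>i. gsoul (val (\<Phi> i) x)) is)) S" for "is"
  proof -
    have "sprod (map (\<lambda>i. soul (\<Phi> i)) is) S x = gc (val (sprod (map (\<lambda>i. soul (\<Phi> i)) is)) x) S" by (simp only: gc_val)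
    also have "\<dots> = gc (prod_list (map (\<lambda>i. gsoul (val (\<Phi> i) x)) is)) S"
      unfolding val_sprod by (simp add: o_def)
    finally show ?thesis .
  qed
  then show "gc (val (taylor D f \<Phi>) x) S = gc (gtay D f (\<lambda>i. val (\<Phi> i) x)) S"
    by (simp add: taylor_def gtay_def gtay_term_def body_map_gbody sum_distrib_left mult.assoc)
qed

lemma val_spull: "val (spull D F \<Phi>) x = gpull D F (\<lambda>i. val (\<Phi> i) x)"
  by (simp add: spull_def gpull_def gmon_def val_taylor o_def)

lemma sum_lists_Suc:
  "(\<Sum>is | set is \<subseteq> A \<and> length is = Suc l. h is) =
   (\<Sum>i\<in>(A :: 'i::finite set). \<Sum>is | set is \<subseteq> A \<and> length is = l. h (i # is))"
proof -
  have "{is. set is \<subseteq> A \<and> length is = Suc l} = (\<lambda>(i, is). i # is) ` (A \<times> {is. set is \<subseteq> A \<and> length is = l})"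
    by (force simp: length_Suc_conv image_iff)
  moreover have "inj_on (\<lambda>(i, is). i # is) (A \<times> {is. set is \<subseteq> A \<and> length is = l})"
    by (auto simp: inj_on_def)
  ultimately have "(\<Sum>is | set is \<subseteq> A \<and> length is = Suc l. h is) =
      (\<Sum>(i, is)\<in>A \<times> {is. set is \<subseteq> A \<and> length is = l}. h (i # is))"
    by (simp add: sum.reindex case_prod_unfold)
  then show ?thesis by (simp add: sum.cartesian_product)
qed

lemma gtay_term_0: "gtay_term D 0 f \<phi> = f (gbody D \<phi>) *\<^sub>R 1"
proof -
  have "{is. set is \<subseteq> ev D \<and> length is = 0} = {[]}" by auto
  then show ?thesis unfolding gtay_term_def by (simp del: length_0_conv)
qed

lemma gmon_insert_min:
  assumes "\<And>i. i \<in> S \<Longrightarrow> m < i" shows "gmon \<phi> (insert m S) = \<phi> m * gmon \<phi> S"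
proof -
  have "m \<notin> S" using assms by blast
  moreover have "insort m (sorted_list_of_set S) = m # sorted_list_of_set S"
    by (rule insort_is_Cons) (use assms less_imp_le in auto)
  ultimately show ?thesis by (simp add: gmon_def)
qed

lemma gmon_empty [simp]: "gmon \<phi> {} = 1" by (simp add: gmon_def)

lemma gc_gmon_empty:
  assumes "S \<noteq> {}" "\<And>i. i \<in> S \<Longrightarrow> gc (\<phi> i) {} = 0"
  shows "gc (gmon \<phi> S) {} = 0"
  unfolding gmon_def by (rule prod_list_nilpotent) (use assms in \<open>auto simp: card_gt_0_iff\<close>)

text \<open>The Leibniz rule differentiates one factor at a time. Carrying the odd element
  \<open>eul (\<phi> i)\<close> to the front costs \<open>gsign {i} (S - {i})\<close>, the same sign
  as in the left derivative of the monomial; hence the two match in \<open>euler\<close>.\<close>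

lemma eul_gmon:
  assumes "\<And>i. i \<in> S \<Longrightarrow> has_parity True (\<phi> i)"
  shows "eul (gmon \<phi> S) = (\<Sum>i\<in>S. gsign {i} (S - {i}) *\<^sub>R (eul (\<phi> i) * gmon \<phi> (S - {i})))"
proof -
  have "finite S" by simp
  then show ?thesis using assms
  proof (induction S rule: finite_linorder_min_induct)
    case (insert m S)
    then have mS: "m \<notin> S" by blast
    \<comment> \<open>The induction adds a new least label \<open>m\<close>. This creates one more
      inversion for each \<open>i\<close> in \<open>S\<close>, compensated by the sign for moving
      the odd \<open>eul (\<phi> i)\<close> past the odd \<open>\<phi> m\<close>.\<close>
    have 1: "gsign {i} (insert m S - {i}) *\<^sub>R (eul (\<phi> i) * gmon \<phi> (insert m S - {i})) =
        \<phi> m * (gsign {i} (S - {i}) *\<^sub>R (eul (\<phi> i) * gmon \<phi> (S - {i})))" if i: "i \<in> S" for i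
    proof -
      have m: "m < i" using insert i by blast
      have eq: "insert m S - {i} = insert m (S - {i})" using m by auto
      have "gsign {i} {m} = - 1" using m
      proof -
        have "{(s, t). s \<in> {i} \<and> t \<in> {m} \<and> t < s} = {(i, m)}" using m by auto
        then show ?thesis by (simp add: gsign_def)
      qed
      then have "gsign {i} (insert m S - {i}) = - gsign {i} (S - {i})"
        unfolding eq using gsign_un_right [of "{m}" "S - {i}" "{i}"] mS by simp
      moreover have "gmon \<phi> (insert m S - {i}) = \<phi> m * gmon \<phi> (S - {i})"
        unfolding eq using insert by (intro gmon_insert_min) auto
      moreover have "eul (\<phi> i) * \<phi> m = - (\<phi> m * eul (\<phi> i))"
      proof -
        have p: "has_parity True (eul (\<phi> i))" "has_parity True (\<phi> m)"
          using insert i by (auto intro: has_parity_eul)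
        show ?thesis using has_parity_commute [OF p(1), of "\<phi> m"] gpar_has_parity [OF p(2), of True] by simp
      qed
      ultimately show ?thesis by (simp flip: mult.assoc)
    qed
    have "gsign {m} S = 1"
    proof -
      have "{(s, t). s \<in> {m} \<and> t \<in> S \<and> t < s} = {}" using insert by auto
      then show ?thesis unfolding gsign_def by (metis card.empty power_0)
    qed
    then have 2: "gsign {m} (insert m S - {m}) *\<^sub>R (eul (\<phi> m) * gmon \<phi> (insert m S - {m})) = eul (\<phi> m) * gmon \<phi> S"
      using mS by simp
    have "eul (gmon \<phi> (insert m S)) = eul (\<phi> m) * gmon \<phi> S + \<phi> m * eul (gmon \<phi> S)"
      using insert by (simp add: gmon_insert_min eul_mult)
    also have "\<phi> m * eul (gmon \<phi> S) = (\<Sum>i\<in>S. gsign {i} (insert m S - {i}) *\<^sub>R (eul (\<phi> i) * gmon \<phi> (insert m S - {i})))"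
      using insert 1 by (simp add: sum_distrib_left)
    finally show ?case unfolding sum.insert [OF insert(1) mS] 2 .
  qed simp
qed

text \<open>
  A point \<open>\<phi>\<close> of \<open>V\<close> with values in a Grassmann algebra. Substitution at such a point is
  characterized by the rules \<open>gpull_body\<close> and \<open>euler\<close>.
\<close>

locale grassmann_point =
  fixes D :: "'i::{finite,linorder} sdim" and V and \<phi> :: "'i \<Rightarrow> 'j::{finite,linorder} gr"
  assumes dom: "superdomain D V"
    and par: "\<And>i. i \<in> coords D \<Longrightarrow> has_parity (i \<in> od D) (\<phi> i)"
    and pt: "gbody D \<phi> \<in> V"
begin

lemma Vopen: "dom_open D V" using dom by simp

lemma par_ev: "i \<in> ev D \<Longrightarrow> has_parity False (\<phi> i)"
proof -
  assume i: "i \<in> ev D"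
  then have "i \<notin> od D" using dom by blast
  then show ?thesis using par [of i] i by (simp add: coords_def)
qed

lemma par_od: "i \<in> od D \<Longrightarrow> has_parity True (\<phi> i)"
  using par [of i] by (auto simp: coords_def)

lemma gtay_term_Suc:
  assumes "smooth_fun_on D V f"
  shows "gtay_term D (Suc l) f \<phi> = (\<Sum>i\<in>ev D. gsoul (\<phi> i) * gtay_term D l (partial i f) \<phi>)"
  unfolding gtay_term_def sum_lists_Suc sum_distrib_left
  by (intro sum.cong refl)
    (simp add: partials_partial_commute [OF Vopen assms _ _ pt])

lemma gtay_term_cong:
  assumes "\<And>x. x \<in> V \<Longrightarrow> f x = g x" shows "gtay_term D l f \<phi> = gtay_term D l g \<phi>"
  unfolding gtay_term_def by (intro sum.cong refl) (simp add: partials_cong [OF Vopen _ assms pt])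

lemma gtay_cong: "(\<And>x. x \<in> V \<Longrightarrow> f x = g x) \<Longrightarrow> gtay D f \<phi> = gtay D g \<phi>"
  unfolding gtay_def using gtay_term_cong [of f g] by simp

lemma gtay_term_cmult:
  assumes "smooth_fun_on D V f" shows "gtay_term D l (\<lambda>x. c * f x) \<phi> = c *\<^sub>R gtay_term D l f \<phi>"
  using assms
proof (induction l arbitrary: f)
  case (Suc l)
  have "gtay_term D l (partial i (\<lambda>x. c * f x)) \<phi> = c *\<^sub>R gtay_term D l (partial i f) \<phi>" if "i \<in> ev D" for i
  proof -
    have "gtay_term D l (partial i (\<lambda>x. c * f x)) \<phi> = gtay_term D l (\<lambda>x. c * partial i f x) \<phi>"
      by (rule gtay_term_cong) (rule partial_cmult [OF Vopen _ that Suc(2)])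
    then show ?thesis using Suc that by (simp add: smooth_partial)
  qed
  moreover have "smooth_fun_on D V (\<lambda>x. c * f x)" using Suc(2) Vopen by (intro smooth_mult smooth_const)
  ultimately show ?case using Suc by (simp add: gtay_term_Suc scaleR_sum_right)
qed (simp add: gtay_term_0)

lemma gtay_cmult:
  "smooth_fun_on D V f \<Longrightarrow> gtay D (\<lambda>x. c * f x) \<phi> = c *\<^sub>R gtay D f \<phi>"
  by (simp add: gtay_def gtay_term_cmult scaleR_sum_right mult.commute)

lemma gtay_zero: "gtay D (\<lambda>x. 0) \<phi> = 0"
  using gtay_cmult [OF smooth_const [OF Vopen, of 0], of 0] by simp

lemma has_parity_gtay: "has_parity False (gtay D f \<phi>)"
  unfolding gtay_def gtay_term_def
  by (intro has_parity_sum has_parity_scaleR has_parity_prod_list)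
    (auto intro: has_parity_gsoul par_ev)

text \<open>Differentiating any of the \<open>Suc l\<close> souls contributes the same amount,
  because partial derivatives commute and the souls are even; hence the factor \<open>Suc l\<close>,
  which later turns \<open>1 / fact (Suc l)\<close> into \<open>1 / fact l\<close>.\<close>

lemma eul_gtay_term:
  assumes "smooth_fun_on D V f"
  shows "eul (gtay_term D (Suc l) f \<phi>) = real (Suc l) *\<^sub>R (\<Sum>i\<in>ev D. eul (\<phi> i) * gtay_term D l (partial i f) \<phi>)"
  using assms
proof (induction l arbitrary: f)
  case 0
  then show ?case by (simp add: gtay_term_Suc gtay_term_0 eul_sum)
next
  case (Suc l)
  let ?T = "\<lambda>l f. gtay_term D l f \<phi>"
  have "eul (?T (Suc (Suc l)) f) = (\<Sum>i\<in>ev D. eul (\<phi> i) * ?T (Suc l) (partial i f)) +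
      (\<Sum>i\<in>ev D. gsoul (\<phi> i) * eul (?T (Suc l) (partial i f)))"
    using Suc(2) by (simp add: gtay_term_Suc eul_sum eul_mult sum.distrib)
  also have "(\<Sum>i\<in>ev D. gsoul (\<phi> i) * eul (?T (Suc l) (partial i f))) =
      (\<Sum>i\<in>ev D. \<Sum>k\<in>ev D. real (Suc l) *\<^sub>R (eul (\<phi> k) * (gsoul (\<phi> i) * ?T l (partial i (partial k f)))))"
  proof (rule sum.cong [OF refl])
    fix i assume i: "i \<in> ev D"
    have "gsoul (\<phi> i) * (eul (\<phi> k) * ?T l (partial k (partial i f))) =
        eul (\<phi> k) * (gsoul (\<phi> i) * ?T l (partial i (partial k f)))" if k: "k \<in> ev D" for k
    proof -
      have "?T l (partial k (partial i f)) = ?T l (partial i (partial k f))"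
        by (rule gtay_term_cong) (rule partial_commute [OF Vopen Suc(2) k i])
      moreover have "gsoul (\<phi> i) * eul (\<phi> k) = eul (\<phi> k) * gsoul (\<phi> i)"
        using has_parity_commute [OF has_parity_gsoul [OF par_ev [OF i]], of "eul (\<phi> k)"] by simp
      ultimately show ?thesis by (simp flip: mult.assoc)
    qed
    then show "gsoul (\<phi> i) * eul (?T (Suc l) (partial i f)) =
        (\<Sum>k\<in>ev D. real (Suc l) *\<^sub>R (eul (\<phi> k) * (gsoul (\<phi> i) * ?T l (partial i (partial k f)))))"
      using Suc(1) [OF smooth_partial [OF Suc(2) i]]
      by (simp add: sum_distrib_left scaleR_sum_right del: of_nat_Suc)
  qed
  also have "\<dots> = real (Suc l) *\<^sub>R (\<Sum>k\<in>ev D. eul (\<phi> k) * ?T (Suc l) (partial k f))"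
    using Suc(2) by (subst sum.swap)
      (simp add: gtay_term_Suc smooth_partial sum_distrib_left scaleR_sum_right del: of_nat_Suc)
  finally show ?case unfolding of_nat_Suc [of "Suc l"] scaleR_add_left by (simp del: of_nat_Suc)
qed

lemma eul_gtay:
  assumes "smooth_fun_on D V f"
  shows "eul (gtay D f \<phi>) = (\<Sum>i\<in>ev D. eul (\<phi> i) * gtay D (partial i f) \<phi>)"
proof -
  let ?T = "\<lambda>l f. gtay_term D l f \<phi>" and ?N = "CARD('j)"
  \<comment> \<open>The Euler derivative lowers the order of the Taylor sum by one, so the sums on
    the two sides end one step apart. The missing top term is a product of
    \<open>CARD('j) + 1\<close> elements without body, and no monomial has that degree.\<close>
  have top: "eul (\<phi> i) * ?T ?N g = 0" for i g
  proof (rule gr_eqI)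
    fix S :: "'j set"
    have "gc (eul (\<phi> i) * prod_list (map (\<lambda>i. gsoul (\<phi> i)) is)) S = 0" if "length is = ?N" for "is"
    proof -
      have "card S < length (eul (\<phi> i) # map (\<lambda>i. gsoul (\<phi> i)) is)"
        using that card_mono [of UNIV S] by (simp add: le_imp_less_Suc)
      moreover have "gc a {} = 0" if "a \<in> set (eul (\<phi> i) # map (\<lambda>i. gsoul (\<phi> i)) is)" for a
        using that by auto
      ultimately have "gc (prod_list (eul (\<phi> i) # map (\<lambda>i. gsoul (\<phi> i)) is)) S = 0"
        by (intro prod_list_nilpotent)
      then show ?thesis by simp
    qed
    then show "gc (eul (\<phi> i) * ?T ?N g) S = gc 0 S"
      by (simp add: gtay_term_def sum_distrib_left)
  qed
  have "eul (gtay D f \<phi>) = eul (?T 0 f) + (\<Sum>l<?N. (1 / fact (Suc l)) *\<^sub>R eul (?T (Suc l) f))"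
    unfolding gtay_def by (simp add: eul_sum sum.atMost_shift)
  also have "eul (?T 0 f) = 0" by (simp add: gtay_term_0)
  also have "(\<Sum>l<?N. (1 / fact (Suc l)) *\<^sub>R eul (?T (Suc l) f)) =
      (\<Sum>l<?N. \<Sum>i\<in>ev D. (1 / fact l) *\<^sub>R (eul (\<phi> i) * ?T l (partial i f)))"
    unfolding eul_gtay_term [OF assms]
    by (intro sum.cong refl) (simp add: scaleR_sum_right divide_simps del: of_nat_Suc)
  also have "\<dots> = (\<Sum>l\<le>?N. \<Sum>i\<in>ev D. (1 / fact l) *\<^sub>R (eul (\<phi> i) * ?T l (partial i f)))"
    by (simp add: top flip: lessThan_Suc_atMost)
  also have "\<dots> = (\<Sum>i\<in>ev D. eul (\<phi> i) * gtay D (partial i f) \<phi>)"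
    by (subst sum.swap) (simp add: gtay_def sum_distrib_left)
  finally show ?thesis by simp
qed

lemma gpull_sderiv_odd:
  assumes "superfun_on D V F" "i \<in> od D"
  shows "gpull D (sderiv D i F) \<phi> =
    (\<Sum>S\<in>{S\<in>Pow (od D). i \<in> S}. gsign {i} (S - {i}) *\<^sub>R (gtay D (F S) \<phi> * gmon \<phi> (S - {i})))"
proof -
  let ?A = "{S\<in>Pow (od D). i \<notin> S}"
  have "gpull D (sderiv D i F) \<phi> = (\<Sum>S\<in>Pow (od D). gtay D (sderiv D i F S) \<phi> * gmon \<phi> S)"
    by (simp add: gpull_def)
  also have "\<dots> = (\<Sum>S\<in>?A. gtay D (sderiv D i F S) \<phi> * gmon \<phi> S)"
    by (rule sum.mono_neutral_right) (use assms in \<open>auto simp: sderiv_def gtay_zero\<close>)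
  also have "\<dots> = (\<Sum>S\<in>?A. gsign {i} S *\<^sub>R (gtay D (F (insert i S)) \<phi> * gmon \<phi> S))"
    by (rule sum.cong) (use assms in \<open>auto simp: sderiv_def gtay_cmult superfun_smooth\<close>)
  also have "\<dots> = (\<Sum>S\<in>{S\<in>Pow (od D). i \<in> S}. gsign {i} (S - {i}) *\<^sub>R (gtay D (F S) \<phi> * gmon \<phi> (S - {i})))"
    by (rule sum.reindex_bij_witness [where j = "insert i" and i = "\<lambda>S. S - {i}"])
      (use assms in \<open>auto simp: insert_absorb\<close>)
  finally show ?thesis .
qed

lemma gpull_sderiv_even:
  assumes "i \<in> ev D" shows "gpull D (sderiv D i F) \<phi> = (\<Sum>S\<in>Pow (od D). gtay D (partial i (F S)) \<phi> * gmon \<phi> S)"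
proof -
  have "i \<notin> od D" using assms dom by blast
  then show ?thesis by (simp add: gpull_def sderiv_def cong: sum.cong)
qed

lemma euler:
  assumes "superfun_on D V F"
  shows "eul (gpull D F \<phi>) = (\<Sum>i\<in>coords D. eul (\<phi> i) * gpull D (sderiv D i F) \<phi>)"
proof -
  note s = superfun_smooth [OF assms]
  have "eul (gpull D F \<phi>) = (\<Sum>S\<in>Pow (od D). eul (gtay D (F S) \<phi>) * gmon \<phi> S) +
      (\<Sum>S\<in>Pow (od D). gtay D (F S) \<phi> * eul (gmon \<phi> S))"
    by (simp add: gpull_def eul_sum eul_mult sum.distrib)
  also have "(\<Sum>S\<in>Pow (od D). eul (gtay D (F S) \<phi>) * gmon \<phi> S) =
      (\<Sum>i\<in>ev D. eul (\<phi> i) * gpull D (sderiv D i F) \<phi>)"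
    by (simp add: eul_gtay [OF s] gpull_sderiv_even sum_distrib_left sum_distrib_right mult.assoc)
      (rule sum.swap)
  also have "(\<Sum>S\<in>Pow (od D). gtay D (F S) \<phi> * eul (gmon \<phi> S)) =
      (\<Sum>S\<in>Pow (od D). \<Sum>i | i \<in> od D \<and> i \<in> S. gsign {i} (S - {i}) *\<^sub>R (eul (\<phi> i) * (gtay D (F S) \<phi> * gmon \<phi> (S - {i}))))"
  proof (rule sum.cong [OF refl])
    fix S assume "S \<in> Pow (od D)"
    then have S: "S \<subseteq> od D" by simp
    \<comment> \<open>Taylor sums are even, so the Euler derivative of an odd component passes to
      the front without a sign.\<close>
    have "gtay D (F S) \<phi> * (eul (\<phi> i) * a) = eul (\<phi> i) * (gtay D (F S) \<phi> * a)" for i a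
      using has_parity_commute [OF has_parity_gtay, of "F S" "eul (\<phi> i)"] by (simp flip: mult.assoc)
    then have "gtay D (F S) \<phi> * eul (gmon \<phi> S) =
        (\<Sum>i\<in>S. gsign {i} (S - {i}) *\<^sub>R (eul (\<phi> i) * (gtay D (F S) \<phi> * gmon \<phi> (S - {i}))))"
      using S par_od by (subst eul_gmon) (auto simp: sum_distrib_left)
    moreover have "{i. i \<in> od D \<and> i \<in> S} = S" using S by auto
    ultimately show "gtay D (F S) \<phi> * eul (gmon \<phi> S) =
        (\<Sum>i | i \<in> od D \<and> i \<in> S. gsign {i} (S - {i}) *\<^sub>R (eul (\<phi> i) * (gtay D (F S) \<phi> * gmon \<phi> (S - {i}))))"
      by simp
  qed
  also have "\<dots> = (\<Sum>i\<in>od D. \<Sum>S | S \<in> Pow (od D) \<and> i \<in> S. gsign {i} (S - {i}) *\<^sub>R (eul (\<phi> i) * (gtay D (F S) \<phi> * gmon \<phi> (S - {i}))))"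
    by (rule sum.swap_restrict) auto
  also have "\<dots> = (\<Sum>i\<in>od D. eul (\<phi> i) * gpull D (sderiv D i F) \<phi>)"
    by (intro sum.cong refl) (simp add: gpull_sderiv_odd [OF assms] sum_distrib_left)
  also have "(\<Sum>i\<in>ev D. eul (\<phi> i) * gpull D (sderiv D i F) \<phi>) + \<dots> = (\<Sum>i\<in>coords D. eul (\<phi> i) * gpull D (sderiv D i F) \<phi>)"
    unfolding coords_def using dom by (intro sum.union_disjoint [symmetric]) auto
  finally show ?thesis .
qed

lemma gpull_body: "gc (gpull D F \<phi>) {} = F {} (gbody D \<phi>)"
proof -
  have t: "gc (gtay_term D l f \<phi>) {} = (if l = 0 then f (gbody D \<phi>) else 0)" for l f
  proof (cases l)
    case (Suc k)
    then show ?thesis by (simp add: gtay_term_def sum_lists_Suc)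
  qed (simp add: gtay_term_0 gc_one)
  have "gc (gtay D f \<phi>) {} = f (gbody D \<phi>)" for f
    by (simp add: gtay_def t if_distrib cong: if_cong)
  moreover have "gc (gmon \<phi> S) {} = (if S = {} then 1 else 0)" if "S \<in> Pow (od D)" for S
    using that gc_gmon_empty [of S \<phi>] par_od by (force simp: gc_one has_parity_simps god_iff)
  ultimately have "gc (gpull D F \<phi>) {} = (\<Sum>S\<in>Pow (od D). if S = {} then F {} (gbody D \<phi>) else 0)"
    unfolding gpull_def gc_sum gc_mult_empty by (intro sum.cong) auto
  then show ?thesis by simp
qed

lemma gpull_cong:
  assumes "\<And>x. x \<in> V \<Longrightarrow> val F x = val G x" shows "gpull D F \<phi> = gpull D G \<phi>"
proof -
  have "gtay D (F S) \<phi> = gtay D (G S) \<phi>" for S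
    by (rule gtay_cong) (use assms in \<open>simp add: val_eq_iff\<close>)
  then show ?thesis by (simp add: gpull_def)
qed

text \<open>An operation on functions that obeys the body rule and the Euler rule can thus be
  recognized as a substitution without looking at Taylor sums. The rules are assumed for all
  \<open>F\<close> simultaneously, since the Euler rule leads from \<open>F\<close> to its
  derivatives.\<close>

lemma gpull_unique:
  assumes "\<And>F. superfun_on D V F \<Longrightarrow> gc (Q F) {} = F {} (gbody D \<phi>)"
    and "\<And>F. superfun_on D V F \<Longrightarrow> eul (Q F) = (\<Sum>i\<in>coords D. eul (\<phi> i) * Q (sderiv D i F))"
    and "superfun_on D V F"
  shows "Q F = gpull D F \<phi>"
proof (rule deg_eq_imp_eq)
  fix n show "deg_eq n (Q F) (gpull D F \<phi>)" using assms(3)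
  proof (induction n arbitrary: F)
    case (Suc n)
    show ?case
    proof (rule deg_eq_eul)
      show "gc (Q F) {} = gc (gpull D F \<phi>) {}" using Suc assms by (simp add: gpull_body)
      show "deg_eq (Suc n) (eul (Q F)) (eul (gpull D F \<phi>))"
        unfolding assms(2) [OF Suc(2)] euler [OF Suc(2)]
        using Suc superfun_sderiv [OF dom] by (intro deg_eq_sum deg_eq_mult_nilpotent) auto
    qed
  qed simp
qed

section \<open>Substitution as a homomorphism of superalgebras\<close>

lemma gpull_sadd:
  assumes "superfun_on D V F" "superfun_on D V G"
  shows "gpull D (sadd F G) \<phi> = gpull D F \<phi> + gpull D G \<phi>"
proof (rule deg_eq_imp_eq)
  fix n show "deg_eq n (gpull D (sadd F G) \<phi>) (gpull D F \<phi> + gpull D G \<phi>)" using assms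
  proof (induction n arbitrary: F G)
    case (Suc n)
    show ?case
    proof (rule deg_eq_eul)
      show "gc (gpull D (sadd F G) \<phi>) {} = gc (gpull D F \<phi> + gpull D G \<phi>) {}" by (simp add: gpull_body sadd_def)
      have eq: "gpull D (sderiv D i (sadd F G)) \<phi> = gpull D (sadd (sderiv D i F) (sderiv D i G)) \<phi>"
        if "i \<in> coords D" for i
        using sderiv_sadd [OF dom that _ Suc(2,3)] by (intro gpull_cong) simp
      have "eul (gpull D F \<phi> + gpull D G \<phi>) =
          (\<Sum>i\<in>coords D. eul (\<phi> i) * (gpull D (sderiv D i F) \<phi> + gpull D (sderiv D i G) \<phi>))"
        by (simp add: euler Suc sum.distrib distrib_left)
      moreover have "eul (gpull D (sadd F G) \<phi>) = (\<Sum>i\<in>coords D. eul (\<phi> i) * gpull D (sadd (sderiv D i F) (sderiv D i G)) \<phi>)"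
        using Suc Vopen by (simp add: euler superfun_sadd eq)
      ultimately show "deg_eq (Suc n) (eul (gpull D (sadd F G) \<phi>)) (eul (gpull D F \<phi> + gpull D G \<phi>))"
        using Suc superfun_sderiv [OF dom] by (auto intro!: deg_eq_sum deg_eq_mult_nilpotent)
    qed
  qed simp
qed

lemma gpull_sscale:
  assumes "superfun_on D V F" shows "gpull D (sscale c F) \<phi> = c *\<^sub>R gpull D F \<phi>"
  unfolding gpull_def sscale_def by (simp add: gtay_cmult superfun_smooth [OF assms] scaleR_sum_right)

lemma gpull_szero: "gpull D szero \<phi> = 0"
  by (simp add: gpull_def szero_def gtay_zero)

lemma gpull_ssum:
  assumes "\<And>k. k \<in> A \<Longrightarrow> superfun_on D V (K k)"
  shows "gpull D (ssum K A) \<phi> = (\<Sum>k\<in>A. gpull D (K k) \<phi>)"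
  using assms
proof (induction A rule: infinite_finite_induct)
  case (insert k A)
  have "gpull D (ssum K (insert k A)) \<phi> = gpull D (sadd (K k) (ssum K A)) \<phi>"
    by (rule gpull_cong) (use insert in simp)
  then show ?case using insert Vopen by (simp add: gpull_sadd superfun_ssum)
qed (use gpull_szero in \<open>simp_all add: ssum_def szero_def\<close>)

lemma gpull_sone: "gpull D sone \<phi> = 1"
proof (rule eul_eq_imp_eq)
  show "gc (gpull D sone \<phi>) {} = gc 1 {}" by (simp add: gpull_body sone_def gc_one)
  have "gpull D (sderiv D i sone) \<phi> = 0" for i
    using gpull_cong [of "sderiv D i sone" szero] by (simp add: sderiv_sone gpull_szero)
  then show "eul (gpull D sone \<phi>) = eul 1" by (simp add: euler [OF superfun_sone [OF Vopen]])
qed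

lemma gpull_scoord:
  assumes "i \<in> coords D" shows "gpull D (scoord D i) \<phi> = \<phi> i"
proof (rule eul_eq_imp_eq)
  show "gc (gpull D (scoord D i) \<phi>) {} = gc (\<phi> i) {}"
    using assms dom par_od [of i] by (auto simp: gpull_body scoord_def gbody_def coords_def has_parity_simps god_iff)
  have "gpull D (sderiv D k (scoord D i)) \<phi> = (if i = k then 1 else 0)" if "k \<in> coords D" for k
    using gpull_cong [of "sderiv D k (scoord D i)" "if i = k then sone else szero"] sderiv_scoord [OF assms that] dom
    by (simp add: gpull_szero gpull_sone split: if_splits)
  then have "eul (\<phi> k) * gpull D (sderiv D k (scoord D i)) \<phi> = (if i = k then eul (\<phi> k) else 0)"
    if "k \<in> coords D" for k using that by simp
  then show "eul (gpull D (scoord D i) \<phi>) = eul (\<phi> i)"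
    using assms by (simp add: euler superfun_scoord Vopen cong: sum.cong)
qed

text \<open>Uniqueness is applied to pulling back \<open>stau F\<close> and undoing the involution
  afterwards: the sign from \<open>sderiv_stau\<close> and the sign of
  \<open>gtau (eul (\<phi> i))\<close> are equal and cancel.\<close>

lemma gpull_spar:
  assumes "superfun_on D V F" shows "gpull D (spar b F) \<phi> = gpar b (gpull D F \<phi>)"
proof (cases b)
  case True
  have "gtau (gpull D (stau F) \<phi>) = gpull D F \<phi>"
  proof (rule gpull_unique [OF _ _ assms])
    fix F assume F: "superfun_on D V F"
    show "gc (gtau (gpull D (stau F) \<phi>)) {} = F {} (gbody D \<phi>)" by (simp add: gpull_body stau_def)
    have "gtau (eul (\<phi> i) * gpull D (sderiv D i (stau F)) \<phi>) = eul (\<phi> i) * gtau (gpull D (stau (sderiv D i F)) \<phi>)"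
      if i: "i \<in> coords D" for i
    proof -
      let ?k = "kos (i \<in> od D) True"
      have "gpull D (sderiv D i (stau F)) \<phi> = gpull D (sscale ?k (stau (sderiv D i F))) \<phi>"
        using sderiv_stau [OF dom i _ F] by (intro gpull_cong) simp
      then have "gpull D (sderiv D i (stau F)) \<phi> = ?k *\<^sub>R gpull D (stau (sderiv D i F)) \<phi>"
        using gpull_sscale superfun_stau Vopen superfun_sderiv [OF dom F i] by metis
      moreover have "gtau (eul (\<phi> i)) = ?k *\<^sub>R eul (\<phi> i)"
        using gpar_has_parity [OF has_parity_eul [OF par [OF i]], of True] by (simp add: kos_sym)
      ultimately show ?thesis by (simp add: gtau_mult)
    qed
    then show "eul (gtau (gpull D (stau F) \<phi>)) = (\<Sum>i\<in>coords D. eul (\<phi> i) * gtau (gpull D (stau (sderiv D i F)) \<phi>))"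
      using F Vopen by (simp add: eul_gtau euler superfun_stau gtau_sum)
  qed
  then have "gtau (gtau (gpull D (stau F) \<phi>)) = gtau (gpull D F \<phi>)" by simp
  then show ?thesis using True by (simp add: spar_def)
qed (simp add: spar_def)

text \<open>The induction runs over all pairs \<open>F\<close>, \<open>G\<close> at once, because
  the Leibniz rule replaces either factor by a derivative. The involution that it puts on
  \<open>F\<close> is the one that appears when \<open>eul (\<phi> i)\<close> is carried across
  \<open>gpull D F \<phi>\<close>.\<close>

lemma gpull_smul:
  assumes "superfun_on D V F" "superfun_on D V G"
  shows "gpull D (smul F G) \<phi> = gpull D F \<phi> * gpull D G \<phi>"
proof (rule deg_eq_imp_eq)
  fix n show "deg_eq n (gpull D (smul F G) \<phi>) (gpull D F \<phi> * gpull D G \<phi>)" using assms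
  proof (induction n arbitrary: F G)
    case (Suc n)
    note FG = Suc(2,3)
    show ?case
    proof (rule deg_eq_eul)
      show "gc (gpull D (smul F G) \<phi>) {} = gc (gpull D F \<phi> * gpull D G \<phi>) {}" by (simp add: gpull_body smul_def)
      let ?s = "\<lambda>i. spar (i \<in> od D)"
      have "eul (gpull D (smul F G) \<phi>) = (\<Sum>i\<in>coords D. eul (\<phi> i) *
          (gpull D (smul (sderiv D i F) G) \<phi> + gpull D (smul (?s i F) (sderiv D i G)) \<phi>))"
      proof -
        have "gpull D (sderiv D i (smul F G)) \<phi> =
            gpull D (smul (sderiv D i F) G) \<phi> + gpull D (smul (?s i F) (sderiv D i G)) \<phi>" if i: "i \<in> coords D" for i
        proof -
          have "gpull D (sderiv D i (smul F G)) \<phi> =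
              gpull D (sadd (smul (sderiv D i F) G) (smul (?s i F) (sderiv D i G))) \<phi>"
            using sderiv_smul [OF dom i _ FG] by (intro gpull_cong) simp
          also have "\<dots> = gpull D (smul (sderiv D i F) G) \<phi> + gpull D (smul (?s i F) (sderiv D i G)) \<phi>"
            by (intro gpull_sadd superfun_smul superfun_spar superfun_sderiv Vopen dom FG i)
          finally show ?thesis .
        qed
        then show ?thesis using FG Vopen by (simp add: euler superfun_smul)
      qed
      moreover have "eul (gpull D F \<phi> * gpull D G \<phi>) = (\<Sum>i\<in>coords D. eul (\<phi> i) *
          (gpull D (sderiv D i F) \<phi> * gpull D G \<phi> + gpull D (?s i F) \<phi> * gpull D (sderiv D i G) \<phi>))"
      proof -
        have "gpull D F \<phi> * (eul (\<phi> i) * a) = eul (\<phi> i) * (gpull D (?s i F) \<phi> * a)" if i: "i \<in> coords D" for i a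
          using has_parity_commute' [OF has_parity_eul [OF par [OF i]], of "gpull D F \<phi>"] gpull_spar [OF FG(1)]
          by (simp flip: mult.assoc)
        then show ?thesis using FG
          by (simp add: eul_mult euler sum_distrib_left sum_distrib_right distrib_left sum.distrib mult.assoc)
      qed
      ultimately show "deg_eq (Suc n) (eul (gpull D (smul F G) \<phi>)) (eul (gpull D F \<phi> * gpull D G \<phi>))"
        using FG Vopen superfun_sderiv [OF dom] superfun_spar
        by (auto intro!: deg_eq_sum deg_eq_mult_nilpotent deg_eq_add Suc(1))
    qed
  qed simp
qed

lemma gpull_has_parity:
  assumes "superfun_on D V F" "\<And>x. x \<in> V \<Longrightarrow> has_parity b (val F x)"
  shows "has_parity b (gpull D F \<phi>)"
proof -
  have "gpull D (spar True F) \<phi> = gpull D (sscale (if b then - 1 else 1) F) \<phi>"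
    by (rule gpull_cong) (use assms(2) in \<open>auto simp: has_parity_def\<close>)
  then show ?thesis
    using gpull_spar [OF assms(1), of True] gpull_sscale [OF assms(1)] by (auto simp: has_parity_def)
qed

end

lemma gpull_point_cong:
  assumes "\<And>i. i \<in> coords D \<Longrightarrow> \<phi> i = \<psi> i" shows "gpull D F \<phi> = gpull D F \<psi>"
proof -
  have b: "gbody D \<phi> = gbody D \<psi>" using assms by (auto simp: gbody_def coords_def vec_eq_iff)
  have t: "gtay D f \<phi> = gtay D f \<psi>" for f
    unfolding gtay_def gtay_term_def b using assms
    by (intro sum.cong refl arg_cong2 [where f = scaleR] arg_cong [where f = prod_list] map_cong)
      (auto simp: coords_def)
  have m: "gmon \<phi> S = gmon \<psi> S" if "S \<in> Pow (od D)" for S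
    unfolding gmon_def using assms that by (intro arg_cong [where f = prod_list] map_cong) (auto simp: coords_def)
  show ?thesis unfolding gpull_def by (intro sum.cong refl) (simp add: t m)
qed

section \<open>Morphisms of superdomains\<close>

definition seul :: "'i::{finite,linorder} sfun \<Rightarrow> 'i sfun" where
  "seul F = (\<lambda>S x. real (card S) * F S x)"

lemma val_seul [simp]: "val (seul F) x = eul (val F x)"
  by (auto intro!: gr_eqI simp: seul_def)

lemma superfun_fmul:
  "dom_open D U \<Longrightarrow> smooth_fun_on D U h \<Longrightarrow> superfun_on D U F \<Longrightarrow> superfun_on D U (\<lambda>S x. h x * F S x)"
  by (auto simp: superfun_on_def smooth_mult)

lemma superfun_seul: "dom_open D U \<Longrightarrow> superfun_on D U F \<Longrightarrow> superfun_on D U (seul F)"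
  by (auto simp: superfun_on_def seul_def smooth_mult)

lemma sderiv_seul:
  assumes "superdomain D U" "i \<in> coords D" "x \<in> U" "superfun_on D U F"
  shows "val (sderiv D i (seul F)) x =
    eul (val (sderiv D i F) x) + (if i \<in> od D then 1 else 0) *\<^sub>R val (sderiv D i F) x"
proof (cases "i \<in> od D")
  case False
  then have i: "i \<in> ev D" using assms by (auto simp: coords_def)
  show ?thesis using False i assms
    by (auto intro!: gr_eqI simp: sderiv_def seul_def partial_cmult [where D = D and U = U] superfun_smooth)
qed (simp add: val_sderiv_odd eul_gd)

text \<open>Variant for elements obtained by differentiation: the shift \<open>c\<close> is the
  degree lost, so the coefficient of degree \<open>k\<close> is multiplied by \<open>k + c\<close>.
  The body has to be compared separately only if \<open>c = 0\<close>.\<close>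

lemma deg_eq_eul_shift:
  fixes c :: real
  assumes "c \<ge> 0" "c = 0 \<Longrightarrow> gc a {} = gc b {}"
    and "deg_eq n (eul a + c *\<^sub>R a) (eul b + c *\<^sub>R b)"
  shows "deg_eq n a b"
  unfolding deg_eq_def
proof (intro allI impI)
  fix S :: "'a set" assume "card S < n"
  then have "(card S + c) * gc a S = (card S + c) * gc b S"
    using assms(3) by (auto simp: deg_eq_def algebra_simps)
  then show "gc a S = gc b S"
  proof (cases "S = {} \<and> c = 0")
    case False
    then have "card S + c \<noteq> 0" using assms(1) by (auto simp: add_nonneg_eq_0_iff)
    then show ?thesis using \<open>(card S + c) * gc a S = _\<close> by simp
  qed (use assms(2) in auto)
qed

locale superdomain_morphism =
  fixes D' :: "'j::{finite,linorder} sdim" and U and D :: "'i::{finite,linorder} sdim" and V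
    and \<Phi> :: "'i \<Rightarrow> 'j sfun"
  assumes dom': "superdomain D' U" and dom: "superdomain D V"
    and sf: "\<And>i. i \<in> coords D \<Longrightarrow> superfun_on D' U (\<Phi> i)"
    and par: "\<And>i x. i \<in> coords D \<Longrightarrow> x \<in> U \<Longrightarrow> has_parity (i \<in> od D) (val (\<Phi> i) x)"
    and body: "\<And>x. x \<in> U \<Longrightarrow> body_map D \<Phi> x \<in> V"
begin

lemma Uopen: "dom_open D' U" and Vopen: "dom_open D V" using dom dom' by auto

lemma point: "x \<in> U \<Longrightarrow> grassmann_point D V (\<lambda>i. val (\<Phi> i) x)"
  using dom par body by unfold_locales (auto simp: body_map_gbody)

lemma superfun_taylor:
  assumes "smooth_fun_on D V f" shows "superfun_on D' U (taylor D f \<Phi>)"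
proof -
  \<comment> \<open>Regrouped so that each summand is an ordinary smooth function, namely a
    derivative of \<open>f\<close> composed with the body map, times a product of
    superfunctions.\<close>
  have eq: "taylor D f \<Phi> = ssum (\<lambda>l. ssum (\<lambda>is R x. (1 / fact l * partials is f (body_map D \<Phi> x)) *
      sprod (map (\<lambda>i. soul (\<Phi> i)) is) R x) {is. set is \<subseteq> ev D \<and> length is = l}) {..CARD('j)}"
    by (simp add: taylor_def ssum_def)
  have "superfun_on D' U (\<lambda>R x. (1 / fact l * partials is f (body_map D \<Phi> x)) *
      sprod (map (\<lambda>i. soul (\<Phi> i)) is) R x)" if "set is \<subseteq> ev D" for l "is"
  proof (rule superfun_fmul [OF Uopen])
    show "superfun_on D' U (sprod (map (\<lambda>i. soul (\<Phi> i)) is))"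
      using that by (intro superfun_sprod Uopen) (auto intro!: superfun_soul Uopen sf simp: coords_def)
    have "smooth_fun_on D' U (\<lambda>x. partials is f (body_map D \<Phi> x))"
    proof (rule smooth_compose [OF Uopen Vopen smooth_partials [OF assms that] body])
      fix i assume "i \<in> ev D"
      then show "smooth_fun_on D' U (\<lambda>x. body_map D \<Phi> x $ i)"
        using superfun_smooth [OF sf, of i "{}"] by (simp add: body_map_def coords_def)
    qed
    then show "smooth_fun_on D' U (\<lambda>x. 1 / fact l * partials is f (body_map D \<Phi> x))"
      by (intro smooth_mult Uopen smooth_const)
  qed
  then show ?thesis unfolding eq by (intro superfun_ssum Uopen) auto
qed

lemma superfun_spull:
  assumes "superfun_on D V F" shows "superfun_on D' U (spull D F \<Phi>)"
  unfolding spull_def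
  by (intro superfun_ssum superfun_smul superfun_sprod superfun_taylor Uopen superfun_smooth [OF assms])
    (auto intro!: sf simp: coords_def)

lemma val_spull_cong:
  "x \<in> U \<Longrightarrow> (\<And>y. y \<in> V \<Longrightarrow> val F y = val G y) \<Longrightarrow> val (spull D F \<Phi>) x = val (spull D G \<Phi>) x"
  unfolding val_spull by (rule grassmann_point.gpull_cong [OF point])

lemma euler_spull:
  assumes "superfun_on D V F" "x \<in> U"
  shows "eul (val (spull D F \<Phi>) x) =
    (\<Sum>i\<in>coords D. eul (val (\<Phi> i) x) * val (spull D (sderiv D i F) \<Phi>) x)"
  unfolding val_spull by (rule grassmann_point.euler [OF point [OF assms(2)] assms(1)])

lemma sderiv_\<Phi>_parity:
  assumes "i \<in> coords D" "j \<in> coords D'" "x \<in> U"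
  shows "has_parity ((i \<in> od D) \<noteq> (j \<in> od D')) (val (sderiv D' j (\<Phi> i)) x)"
  by (rule sderiv_has_parity [OF dom' assms(2,3) sf [OF assms(1)]]) (rule par [OF assms(1)])

text \<open>On bodies the claim is the classical chain rule along the even coordinates. The odd ones
  contribute nothing, because for even \<open>j\<close> the derivative of an odd component is odd
  and has no body.\<close>

lemma chain_rule_body:
  assumes "superfun_on D V F" "x \<in> U" "j \<in> coords D'" "j \<notin> od D'"
  shows "gc (val (sderiv D' j (spull D F \<Phi>)) x) {} =
    gc (\<Sum>i\<in>coords D. val (sderiv D' j (\<Phi> i)) x * val (spull D (sderiv D i F) \<Phi>) x) {}"
proof -
  have j: "j \<in> ev D'" using assms by (auto simp: coords_def)
  have b: "gc (val (spull D G \<Phi>) y) {} = G {} (body_map D \<Phi> y)" if "y \<in> U" for G y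
    unfolding val_spull body_map_gbody by (rule grassmann_point.gpull_body [OF point [OF that]])
  have "gc (val (sderiv D' j (spull D F \<Phi>)) x) {} = partial j (spull D F \<Phi> {}) x"
    using assms by (simp add: sderiv_def)
  also have "\<dots> = partial j (\<lambda>y. F {} (body_map D \<Phi> y)) x"
    using b by (intro partial_cong [OF Uopen assms(2) j]) simp
  also have "\<dots> = (\<Sum>i\<in>ev D. partial j (\<lambda>y. body_map D \<Phi> y $ i) x * partial i (F {}) (body_map D \<Phi> x))"
  proof (rule partial_compose [OF Uopen Vopen assms(2) j _ body])
    show "F {} differentiable_on V" using assms(1) smooth_differentiable superfun_smooth by blast
    fix i assume "i \<in> ev D"
    then show "(\<lambda>y. body_map D \<Phi> y $ i) differentiable_on U"
      using smooth_differentiable [OF superfun_smooth [OF sf, of i "{}"]] by (simp add: body_map_def coords_def)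
  qed
  also have "\<dots> = (\<Sum>i\<in>ev D. gc (val (sderiv D' j (\<Phi> i)) x * val (spull D (sderiv D i F) \<Phi>) x) {})"
  proof (rule sum.cong [OF refl])
    fix i assume i: "i \<in> ev D"
    then have "i \<notin> od D" using dom by blast
    then have "gc (val (spull D (sderiv D i F) \<Phi>) x) {} = partial i (F {}) (body_map D \<Phi> x)"
      unfolding b [OF assms(2)] by (simp add: sderiv_def)
    then show "partial j (\<lambda>y. body_map D \<Phi> y $ i) x * partial i (F {}) (body_map D \<Phi> x) =
        gc (val (sderiv D' j (\<Phi> i)) x * val (spull D (sderiv D i F) \<Phi>) x) {}"
      using i assms by (simp add: sderiv_def body_map_def)
  qed
  also have "\<dots> = (\<Sum>i\<in>coords D. gc (val (sderiv D' j (\<Phi> i)) x * val (spull D (sderiv D i F) \<Phi>) x) {})"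
  proof (rule sum.mono_neutral_left)
    show "\<forall>i\<in>coords D - ev D. gc (val (sderiv D' j (\<Phi> i)) x * val (spull D (sderiv D i F) \<Phi>) x) {} = 0"
    proof
      fix i assume "i \<in> coords D - ev D"
      then have "i \<in> coords D" "i \<in> od D" by (auto simp: coords_def)
      then have "god (val (sderiv D' j (\<Phi> i)) x)"
        using sderiv_\<Phi>_parity [OF _ assms(3,2)] assms(4) by (fastforce simp: has_parity_simps)
      then have "gc (val (sderiv D' j (\<Phi> i)) x) {} = 0" unfolding god_iff by simp
      then show "gc (val (sderiv D' j (\<Phi> i)) x * val (spull D (sderiv D i F) \<Phi>) x) {} = 0" by simp
    qed
  qed (auto simp: coords_def)
  finally show ?thesis by simp
qed

text \<open>Both sides satisfy the same recursion under the shifted Euler operator: besides common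
  terms it involves the corresponding sides for the derivatives of \<open>F\<close>, multiplied by
  elements without body. Agreement to order \<open>n\<close> thus improves to order
  \<open>Suc n\<close>.\<close>

theorem chain_rule:
  assumes "superfun_on D V F" "x \<in> U" "j \<in> coords D'"
  shows "val (sderiv D' j (spull D F \<Phi>)) x =
    (\<Sum>i\<in>coords D. val (sderiv D' j (\<Phi> i)) x * val (spull D (sderiv D i F) \<Phi>) x)"
    (is "?L F = ?R F")
proof (rule deg_eq_imp_eq)
  fix n show "deg_eq n (?L F) (?R F)" using assms(1)
  proof (induction n arbitrary: F)
    case (Suc n)
    define c where "c = (if j \<in> od D' then 1 else 0 :: real)"
    let ?A = "\<lambda>F. val (spull D F \<Phi>) x" and ?d = "\<lambda>i. val (sderiv D' j (\<Phi> i)) x"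
    let ?k = "\<lambda>i. kos (i \<in> od D) (j \<in> od D')"
    have dF: "superfun_on D V (sderiv D i F)" if "i \<in> coords D" for i
      by (rule superfun_sderiv [OF dom Suc(2) that])
    have "eul (?L F) + c *\<^sub>R ?L F = val (sderiv D' j (seul (spull D F \<Phi>))) x"
      unfolding c_def by (rule sderiv_seul [OF dom' assms(3,2) superfun_spull [OF Suc(2)], symmetric])
    also have "\<dots> = val (sderiv D' j (ssum (\<lambda>k. smul (seul (\<Phi> k)) (spull D (sderiv D k F) \<Phi>)) (coords D))) x"
      by (rule sderiv_cong [OF dom' assms(3,2)]) (simp add: euler_spull [OF Suc(2)])
    also have "\<dots> = (\<Sum>k\<in>coords D. val (sderiv D' j (smul (seul (\<Phi> k)) (spull D (sderiv D k F) \<Phi>))) x)"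
      by (rule sderiv_ssum [OF dom' assms(3,2)])
        (intro superfun_smul superfun_seul superfun_spull Uopen sf dF)
    also have "\<dots> = (\<Sum>k\<in>coords D. (eul (?d k) + c *\<^sub>R ?d k) * ?A (sderiv D k F) +
        ?k k *\<^sub>R (eul (val (\<Phi> k) x) * ?L (sderiv D k F)))"
    proof (rule sum.cong [OF refl])
      fix k assume k: "k \<in> coords D"
      have "gpar (j \<in> od D') (eul (val (\<Phi> k) x)) = ?k k *\<^sub>R eul (val (\<Phi> k) x)"
        using gpar_has_parity [OF has_parity_eul [OF par [OF k assms(2)]], of "j \<in> od D'"] by (simp add: kos_sym)
      moreover have "val (sderiv D' j (smul (seul (\<Phi> k)) (spull D (sderiv D k F) \<Phi>))) x =
          val (sderiv D' j (seul (\<Phi> k))) x * ?A (sderiv D k F) +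
          gpar (j \<in> od D') (val (seul (\<Phi> k)) x) * ?L (sderiv D k F)"
        by (rule sderiv_smul [OF dom' assms(3,2)]) (intro superfun_seul superfun_spull Uopen sf dF k)+
      moreover have "val (sderiv D' j (seul (\<Phi> k))) x = eul (?d k) + c *\<^sub>R ?d k"
        unfolding c_def by (rule sderiv_seul [OF dom' assms(3,2) sf [OF k]])
      ultimately show "val (sderiv D' j (smul (seul (\<Phi> k)) (spull D (sderiv D k F) \<Phi>))) x =
          (eul (?d k) + c *\<^sub>R ?d k) * ?A (sderiv D k F) + ?k k *\<^sub>R (eul (val (\<Phi> k) x) * ?L (sderiv D k F))"
        by simp
    qed
    finally have L: "eul (?L F) + c *\<^sub>R ?L F = (\<Sum>k\<in>coords D. (eul (?d k) + c *\<^sub>R ?d k) * ?A (sderiv D k F) +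
        ?k k *\<^sub>R (eul (val (\<Phi> k) x) * ?L (sderiv D k F)))" .
    \<comment> \<open>Exchanging the derivatives gives a sign depending on \<open>k\<close> and
      \<open>i\<close>; carrying \<open>?d i\<close>, whose parity is the sum of those of
      \<open>i\<close> and \<open>j\<close>, across \<open>eul (val (\<Phi> k) x)\<close> gives
      another. Their product no longer involves \<open>i\<close>, so the sum over \<open>i\<close>
      reassembles to the right-hand side for \<open>sderiv D k F\<close>.\<close>
    have swap: "?d i * (eul (val (\<Phi> k) x) * ?A (sderiv D k (sderiv D i F))) =
        ?k k *\<^sub>R (eul (val (\<Phi> k) x) * (?d i * ?A (sderiv D i (sderiv D k F))))"
      if i: "i \<in> coords D" and k: "k \<in> coords D" for i k
    proof -
      let ?c = "kos (k \<in> od D) (i \<in> od D)"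
      have "?A (sderiv D k (sderiv D i F)) = ?A (sscale ?c (sderiv D i (sderiv D k F)))"
        by (rule val_spull_cong [OF assms(2)]) (simp add: sderiv_commute [OF dom k i _ Suc(2)])
      also have "\<dots> = ?c *\<^sub>R ?A (sderiv D i (sderiv D k F))"
        unfolding val_spull
        by (rule grassmann_point.gpull_sscale [OF point [OF assms(2)] superfun_sderiv [OF dom dF [OF k] i]])
      finally have 1: "?A (sderiv D k (sderiv D i F)) = ?c *\<^sub>R ?A (sderiv D i (sderiv D k F))" .
      have "?d i * eul (val (\<Phi> k) x) = eul (val (\<Phi> k) x) * gpar (k \<in> od D) (?d i)"
        by (rule has_parity_commute' [OF has_parity_eul [OF par [OF k assms(2)]]])
      also have "gpar (k \<in> od D) (?d i) = kos (k \<in> od D) ((i \<in> od D) \<noteq> (j \<in> od D')) *\<^sub>R ?d i"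
        by (rule gpar_has_parity [OF sderiv_\<Phi>_parity [OF i assms(3,2)]])
      finally have 2: "?d i * eul (val (\<Phi> k) x) =
          kos (k \<in> od D) ((i \<in> od D) \<noteq> (j \<in> od D')) *\<^sub>R (eul (val (\<Phi> k) x) * ?d i)" by simp
      have 3: "?c * kos (k \<in> od D) ((i \<in> od D) \<noteq> (j \<in> od D')) = ?k k" by (auto simp: kos_def)
      show ?thesis unfolding 1 mult.assoc [symmetric] 2 mult_scaleR_right mult_scaleR_left scaleR_scaleR 3 ..
    qed
    have "eul (?R F) + c *\<^sub>R ?R F = (\<Sum>i\<in>coords D. (eul (?d i) + c *\<^sub>R ?d i) * ?A (sderiv D i F)) +
        (\<Sum>i\<in>coords D. \<Sum>k\<in>coords D. ?d i * (eul (val (\<Phi> k) x) * ?A (sderiv D k (sderiv D i F))))"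
      by (simp add: eul_sum eul_mult euler_spull [OF dF assms(2)] sum_distrib_left sum.distrib
          scaleR_sum_right algebra_simps)
    also have "(\<Sum>i\<in>coords D. \<Sum>k\<in>coords D. ?d i * (eul (val (\<Phi> k) x) * ?A (sderiv D k (sderiv D i F)))) =
        (\<Sum>k\<in>coords D. ?k k *\<^sub>R (eul (val (\<Phi> k) x) * ?R (sderiv D k F)))"
      by (subst sum.swap) (simp add: swap sum_distrib_left scaleR_sum_right)
    finally have R: "eul (?R F) + c *\<^sub>R ?R F = (\<Sum>k\<in>coords D. (eul (?d k) + c *\<^sub>R ?d k) * ?A (sderiv D k F) +
        ?k k *\<^sub>R (eul (val (\<Phi> k) x) * ?R (sderiv D k F)))" by (simp add: sum.distrib)
    show ?case
    proof (rule deg_eq_eul_shift [of c])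
      show "c = 0 \<Longrightarrow> gc (?L F) {} = gc (?R F) {}"
        by (rule chain_rule_body [OF Suc(2) assms(2,3)]) (auto simp: c_def split: if_splits)
      show "deg_eq (Suc n) (eul (?L F) + c *\<^sub>R ?L F) (eul (?R F) + c *\<^sub>R ?R F)"
        unfolding L R
        by (intro deg_eq_sum deg_eq_add deg_eq_refl deg_eq_scaleR deg_eq_mult_nilpotent Suc(1) dF) simp
    qed (simp add: c_def)
  qed simp
qed

lemma spull_hom:
  assumes "x \<in> U"
  shows "superfun_on D V F \<Longrightarrow> superfun_on D V G \<Longrightarrow>
      val (spull D (sadd F G) \<Phi>) x = val (spull D F \<Phi>) x + val (spull D G \<Phi>) x"
    and "superfun_on D V F \<Longrightarrow> superfun_on D V G \<Longrightarrow>
      val (spull D (smul F G) \<Phi>) x = val (spull D F \<Phi>) x * val (spull D G \<Phi>) x"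
    and "superfun_on D V F \<Longrightarrow> val (spull D (sscale c F) \<Phi>) x = c *\<^sub>R val (spull D F \<Phi>) x"
    and "(\<And>k. k \<in> A \<Longrightarrow> superfun_on D V (K k)) \<Longrightarrow>
      val (spull D (ssum K A) \<Phi>) x = (\<Sum>k\<in>A. val (spull D (K k) \<Phi>) x)"
    and "i \<in> coords D \<Longrightarrow> val (spull D (scoord D i) \<Phi>) x = val (\<Phi> i) x"
    and "superfun_on D V F \<Longrightarrow> val (spull D (spar b F) \<Phi>) x = gpar b (val (spull D F \<Phi>) x)"
    and "val (spull D szero \<Phi>) x = 0"
    and "superfun_on D V F \<Longrightarrow> (\<And>y. y \<in> V \<Longrightarrow> has_parity b (val F y)) \<Longrightarrow> has_parity b (val (spull D F \<Phi>) x)"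
proof -
  interpret p: grassmann_point D V "\<lambda>i. val (\<Phi> i) x" by (rule point [OF assms])
  show "superfun_on D V F \<Longrightarrow> superfun_on D V G \<Longrightarrow>
      val (spull D (sadd F G) \<Phi>) x = val (spull D F \<Phi>) x + val (spull D G \<Phi>) x"
    "superfun_on D V F \<Longrightarrow> superfun_on D V G \<Longrightarrow>
      val (spull D (smul F G) \<Phi>) x = val (spull D F \<Phi>) x * val (spull D G \<Phi>) x"
    "superfun_on D V F \<Longrightarrow> val (spull D (sscale c F) \<Phi>) x = c *\<^sub>R val (spull D F \<Phi>) x"
    "(\<And>k. k \<in> A \<Longrightarrow> superfun_on D V (K k)) \<Longrightarrow>
      val (spull D (ssum K A) \<Phi>) x = (\<Sum>k\<in>A. val (spull D (K k) \<Phi>) x)"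
    "i \<in> coords D \<Longrightarrow> val (spull D (scoord D i) \<Phi>) x = val (\<Phi> i) x"
    "superfun_on D V F \<Longrightarrow> val (spull D (spar b F) \<Phi>) x = gpar b (val (spull D F \<Phi>) x)"
    "val (spull D szero \<Phi>) x = 0"
    "superfun_on D V F \<Longrightarrow> (\<And>y. y \<in> V \<Longrightarrow> has_parity b (val F y)) \<Longrightarrow> has_parity b (val (spull D F \<Phi>) x)"
    unfolding val_spull
    by (rule p.gpull_sadd p.gpull_smul p.gpull_sscale p.gpull_ssum p.gpull_scoord p.gpull_spar
        p.gpull_szero p.gpull_has_parity; assumption)+
qed

end

text \<open>For fixed \<open>z\<close>, pulling \<open>F\<close> back in two stages obeys the rules
  that characterize substitution at the composed point. The Euler rule for \<open>\<Psi>\<close>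
  produces derivatives of \<open>spull D F \<Phi>\<close>; the chain rule splits them, and summing
  over the middle coordinates first yields \<open>eul (\<phi> i)\<close>.\<close>

theorem spull_spull:
  assumes "superdomain_morphism D'' W D' U \<Psi>" "superdomain_morphism D' U D V \<Phi>"
    and F: "superfun_on D V F" and z: "z \<in> W"
  shows "val (spull D' (spull D F \<Phi>) \<Psi>) z = val (spull D F (\<lambda>i. spull D' (\<Phi> i) \<Psi>)) z"
proof -
  interpret \<Psi>: superdomain_morphism D'' W D' U \<Psi> by fact
  interpret \<Phi>: superdomain_morphism D' U D V \<Phi> by fact
  define \<psi> where "\<psi> j = val (\<Psi> j) z" for j
  define \<phi> where "\<phi> i = gpull D' (\<Phi> i) \<psi>" for i
  interpret p: grassmann_point D' U \<psi> unfolding \<psi>_def by (rule \<Psi>.point [OF z])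
  have b: "gbody D \<phi> = body_map D \<Phi> (gbody D' \<psi>)"
    by (simp add: gbody_def [of D \<phi>] \<phi>_def p.gpull_body body_map_def vec_eq_iff)
  interpret q: grassmann_point D V \<phi>
  proof
    show "superdomain D V" by (rule \<Phi>.dom)
    show "gbody D \<phi> \<in> V" unfolding b by (rule \<Phi>.body [OF p.pt])
    show "has_parity (i \<in> od D) (\<phi> i)" if "i \<in> coords D" for i
      unfolding \<phi>_def by (rule p.gpull_has_parity [OF \<Phi>.sf [OF that] \<Phi>.par [OF that]])
  qed
  have "gpull D' (spull D F \<Phi>) \<psi> = gpull D F \<phi>"
  proof (rule q.gpull_unique [OF _ _ F])
    fix F assume F: "superfun_on D V F"
    have "spull D F \<Phi> {} (gbody D' \<psi>) = gc (gpull D F (\<lambda>i. val (\<Phi> i) (gbody D' \<psi>))) {}"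
      unfolding val_spull [symmetric] gc_val ..
    also have "\<dots> = F {} (body_map D \<Phi> (gbody D' \<psi>))"
      unfolding body_map_gbody by (rule grassmann_point.gpull_body [OF \<Phi>.point [OF p.pt]])
    finally show "gc (gpull D' (spull D F \<Phi>) \<psi>) {} = F {} (gbody D \<phi>)" by (simp add: p.gpull_body b)
    let ?A = "\<lambda>i. spull D (sderiv D i F) \<Phi>"
    have A: "superfun_on D' U (?A i)" if "i \<in> coords D" for i
      by (rule \<Phi>.superfun_spull [OF superfun_sderiv [OF \<Phi>.dom F that]])
    have dF: "superfun_on D' U (sderiv D' j (\<Phi> i))" if "i \<in> coords D" "j \<in> coords D'" for i j
      by (rule superfun_sderiv [OF \<Phi>.dom' \<Phi>.sf [OF that(1)] that(2)])
    have 1: "gpull D' (sderiv D' j (spull D F \<Phi>)) \<psi> = (\<Sum>i\<in>coords D. gpull D' (sderiv D' j (\<Phi> i)) \<psi> * gpull D' (?A i) \<psi>)"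
      if j: "j \<in> coords D'" for j
    proof -
      have "gpull D' (sderiv D' j (spull D F \<Phi>)) \<psi> = gpull D' (ssum (\<lambda>i. smul (sderiv D' j (\<Phi> i)) (?A i)) (coords D)) \<psi>"
        by (rule p.gpull_cong) (simp add: \<Phi>.chain_rule [OF F _ j])
      also have "\<dots> = (\<Sum>i\<in>coords D. gpull D' (smul (sderiv D' j (\<Phi> i)) (?A i)) \<psi>)"
        by (intro p.gpull_ssum superfun_smul p.Vopen A dF j)
      also have "\<dots> = (\<Sum>i\<in>coords D. gpull D' (sderiv D' j (\<Phi> i)) \<psi> * gpull D' (?A i) \<psi>)"
        by (intro sum.cong refl p.gpull_smul A dF j)
      finally show ?thesis .
    qed
    have "eul (gpull D' (spull D F \<Phi>) \<psi>) =
        (\<Sum>j\<in>coords D'. \<Sum>i\<in>coords D. eul (\<psi> j) * gpull D' (sderiv D' j (\<Phi> i)) \<psi> * gpull D' (?A i) \<psi>)"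
      by (simp add: p.euler [OF \<Phi>.superfun_spull [OF F]] 1 sum_distrib_left mult.assoc)
    also have "\<dots> = (\<Sum>i\<in>coords D. \<Sum>j\<in>coords D'. eul (\<psi> j) * gpull D' (sderiv D' j (\<Phi> i)) \<psi> * gpull D' (?A i) \<psi>)"
      by (rule sum.swap)
    also have "\<dots> = (\<Sum>i\<in>coords D. eul (\<phi> i) * gpull D' (?A i) \<psi>)"
      by (intro sum.cong refl) (simp add: \<phi>_def p.euler [OF \<Phi>.sf] sum_distrib_right)
    finally show "eul (gpull D' (spull D F \<Phi>) \<psi>) = (\<Sum>i\<in>coords D. eul (\<phi> i) * gpull D' (?A i) \<psi>)" .
  qed
  then show ?thesis unfolding val_spull by (simp add: \<psi>_def [abs_def] \<phi>_def [abs_def])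
qed

lemma spull_point_cong:
  "(\<And>i. i \<in> coords D \<Longrightarrow> val (\<Phi> i) x = val (\<Psi> i) x) \<Longrightarrow> val (spull D F \<Phi>) x = val (spull D F \<Psi>) x"
  unfolding val_spull by (rule gpull_point_cong)

lemma morphism_scoord: assumes "superdomain D U" shows "superdomain_morphism D U D U (scoord D)"
proof
  show "body_map D (scoord D) x \<in> U" if "x \<in> U" for x
  proof -
    have "i \<notin> od D" if "i \<in> ev D" for i using assms that by blast
    then have "body_map D (scoord D) x = x"
      using dom_open_subset [OF conjunct2 [OF assms] that]
      by (auto simp: body_map_def scoord_def body_space_def vec_eq_iff)
    then show ?thesis using that by simp
  qed
qed (use assms in \<open>auto simp: superfun_scoord scoord_has_parity\<close>)

text \<open>Euler's identity for homogeneous polynomials, in the odd variables: each coordinate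
  occurring in a monomial is removed and put back, and the number of such coordinates is the
  degree.\<close>

lemma eul_odd_coordinates:
  assumes "\<And>S. \<not> S \<subseteq> od D \<Longrightarrow> gc a S = 0"
  shows "eul a = (\<Sum>i\<in>od D. val (scoord D i) x * gd i a)"
proof (rule gr_eqI)
  fix S
  have "gc (val (scoord D i) x * gd i a) S = (if i \<in> S then gc a S else 0)" if "i \<in> od D" for i
  proof (cases "i \<in> S")
    case True
    then have "gc (val (scoord D i) x * gd i a) S = (\<Sum>R\<in>Pow S. if R = {i} then gsign {i} (S - {i}) * gc (gd i a) (S - {i}) else 0)"
      unfolding gc_mult using that by (intro sum.cong) (auto simp: scoord_def)
    then show ?thesis using True by (simp add: gc_gd insert_absorb)
  next
    case False
    then show ?thesis unfolding gc_mult using that by (simp, intro sum.neutral) (auto simp: scoord_def)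
  qed
  then have "gc (\<Sum>i\<in>od D. val (scoord D i) x * gd i a) S = card (od D \<inter> S) * gc a S"
    by (simp add: sum.inter_restrict [symmetric])
  moreover have "card (od D \<inter> S) * gc a S = card S * gc a S"
    using assms [of S] by (cases "S \<subseteq> od D") (auto simp: Int_absorb1)
  ultimately show "gc (eul a) S = gc (\<Sum>i\<in>od D. val (scoord D i) x * gd i a) S" by simp
qed

text \<open>Evaluation at \<open>x\<close> is itself a candidate in \<open>gpull_unique\<close>. Its
  Euler rule is \<open>eul_odd_coordinates\<close>; the even coordinates drop out because they have
  no soul and are killed by the Euler field.\<close>

lemma spull_scoord:
  assumes "superdomain D U" "superfun_on D U F" "x \<in> U"
  shows "val (spull D F (scoord D)) x = val F x"
proof -
  interpret p: grassmann_point D U "\<lambda>i. val (scoord D i) x"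
    by (rule superdomain_morphism.point [OF morphism_scoord [OF assms(1)] assms(3)])
  have b: "gbody D (\<lambda>i. val (scoord D i) x) = x"
  proof -
    have "i \<notin> od D" if "i \<in> ev D" for i using assms that by blast
    then show ?thesis
      using dom_open_subset [OF conjunct2 [OF assms(1)] assms(3)]
      by (auto simp: gbody_def scoord_def body_space_def vec_eq_iff)
  qed
  have "val F x = gpull D F (\<lambda>i. val (scoord D i) x)"
  proof (rule p.gpull_unique [OF _ _ assms(2)])
    fix F assume F: "superfun_on D U F"
    show "gc (val F x) {} = F {} (gbody D (\<lambda>i. val (scoord D i) x))" by (simp add: b)
    have "eul (val F x) = (\<Sum>i\<in>od D. val (scoord D i) x * gd i (val F x))"
      by (rule eul_odd_coordinates) (use superfun_vanish [OF F _ assms(3)] in simp)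
    also have "\<dots> = (\<Sum>i\<in>od D. eul (val (scoord D i) x) * val (sderiv D i F) x)"
    proof (rule sum.cong [OF refl])
      fix i assume "i \<in> od D"
      then have "eul (val (scoord D i) x) = val (scoord D i) x"
        by (auto intro!: gr_eqI simp: scoord_def)
      then show "val (scoord D i) x * gd i (val F x) = eul (val (scoord D i) x) * val (sderiv D i F) x"
        using \<open>i \<in> od D\<close> by (simp add: val_sderiv_odd)
    qed
    also have "\<dots> = (\<Sum>i\<in>coords D. eul (val (scoord D i) x) * val (sderiv D i F) x)"
    proof (rule sum.mono_neutral_left)
      show "\<forall>i\<in>coords D - od D. eul (val (scoord D i) x) * val (sderiv D i F) x = 0"
      proof
        fix i assume "i \<in> coords D - od D"
        then have "eul (val (scoord D i) x) = 0" by (auto intro!: gr_eqI simp: scoord_def)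
        then show "eul (val (scoord D i) x) * val (sderiv D i F) x = 0" by simp
      qed
    qed (auto simp: coords_def)
    finally show "eul (val F x) = (\<Sum>i\<in>coords D. eul (val (scoord D i) x) * val (sderiv D i F) x)" .
  qed
  then show ?thesis by (simp add: val_spull)
qed

section \<open>The cotangent bundle of a superdomain\<close>

lemma cot_dim_simps [simp]:
  "Pos a \<in> ev (cot_dim D) \<longleftrightarrow> a \<in> ev D" "Mom a \<in> ev (cot_dim D) \<longleftrightarrow> a \<in> ev D"
  "Pos a \<in> od (cot_dim D) \<longleftrightarrow> a \<in> od D" "Mom a \<in> od (cot_dim D) \<longleftrightarrow> a \<in> od D"
  "Pos a \<in> coords (cot_dim D) \<longleftrightarrow> a \<in> coords D" "Mom a \<in> coords (cot_dim D) \<longleftrightarrow> a \<in> coords D"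
  by (auto simp: cot_dim_def coords_def)

lemma sum_cot_coords:
  fixes h :: "'a::finite cot \<Rightarrow> 'b::comm_monoid_add"
  shows "(\<Sum>u\<in>coords (cot_dim D). h u) = (\<Sum>a\<in>coords D. h (Pos a)) + (\<Sum>a\<in>coords D. h (Mom a))"
proof -
  have "coords (cot_dim D) = Pos ` coords D \<union> Mom ` coords D" by (auto simp: coords_def cot_dim_def)
  moreover have "sum h (Pos ` coords D \<union> Mom ` coords D) = sum h (Pos ` coords D) + sum h (Mom ` coords D)"
    by (rule sum.union_disjoint) auto
  ultimately show ?thesis by (simp add: sum.reindex inj_on_def)
qed

lemma cot_dom_mono: "U \<subseteq> V \<Longrightarrow> cot_dom D U \<subseteq> cot_dom D V"
  by (auto simp: cot_dom_def)

lemma superdomain_cot: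
  fixes D :: "'a::{finite,linorder} sdim"
  assumes "superdomain D U" shows "superdomain (cot_dim D) (cot_dom D U)"
proof
  show "ev (cot_dim D) \<inter> od (cot_dim D) = {}" using assms by (auto simp: cot_dim_def)
  let ?\<pi> = "\<lambda>z :: real ^ 'a cot. \<chi> i. z $ Pos i"
  obtain T where T: "open T" "U = T \<inter> body_space D" using assms by (auto simp: openin_open)
  have "continuous_on UNIV ?\<pi>" by (intro continuous_intros)
  then have "open (?\<pi> -` T)" using T(1) by (rule open_vimage [rotated])
  moreover have "cot_dom D U = body_space (cot_dim D) \<inter> ?\<pi> -` T"
    unfolding cot_dom_def T(2) by (auto simp: body_space_def)
  ultimately show "dom_open (cot_dim D) (cot_dom D U)" by (auto simp: openin_open)
qed

lemma spar_twist: "twist D a F = spar (a \<in> od D) F"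
  by (auto simp: twist_def spar_def stau_def fun_eq_iff minus_one_power_iff)

lemma par_sign_kos: "par_sign D a = kos (a \<in> od D) (a \<in> od D)"
  by (auto simp: par_sign_def kos_def)

lemma sderiv_spar:
  assumes "superdomain D U" "i \<in> coords D" "x \<in> U" "superfun_on D U F"
  shows "val (sderiv D i (spar b F)) x = kos b (i \<in> od D) *\<^sub>R gpar b (val (sderiv D i F) x)"
  using sderiv_stau [OF assms] by (simp add: spar_def gpar_def kos_sym)

locale cot_domain =
  fixes D :: "'a::{finite,linorder} sdim" and U
  assumes dom: "superdomain D U"
begin

abbreviation "D2 \<equiv> cot_dim D"
abbreviation "W \<equiv> cot_dom D U"

lemma dom2: "superdomain D2 W" by (rule superdomain_cot [OF dom])
lemma Uopen: "dom_open D U" and Wopen: "dom_open D2 W" using dom dom2 by auto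

sublocale proj: superdomain_morphism D2 W D U "\<lambda>i. scoord D2 (Pos i)"
proof
  fix z assume z: "z \<in> W"
  have "i \<notin> od D" if "i \<in> ev D" for i using dom that by blast
  then have "body_map D (\<lambda>i. scoord D2 (Pos i)) z = (\<chi> i. z $ Pos i)"
    using z by (auto simp: body_map_def scoord_def vec_eq_iff cot_dom_def body_space_def)
  then show "body_map D (\<lambda>i. scoord D2 (Pos i)) z \<in> U" using z by (simp add: cot_dom_def)
next
  fix i z
  show "has_parity (i \<in> od D) (val (scoord D2 (Pos i)) z)"
    using scoord_has_parity [of "Pos i" D2 z] by simp
qed (use dom2 dom Wopen in \<open>auto simp: superfun_scoord\<close>)

lemma superfun_cot_pull: "superfun_on D U f \<Longrightarrow> superfun_on D2 W (cot_pull D f)"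
  unfolding cot_pull_def by (rule proj.superfun_spull)

lemma cot_pull_cong:
  "z \<in> W \<Longrightarrow> (\<And>x. x \<in> U \<Longrightarrow> val f x = val g x) \<Longrightarrow> val (cot_pull D f) z = val (cot_pull D g) z"
  unfolding cot_pull_def by (rule proj.val_spull_cong)

lemma cot_pull_parity:
  "superfun_on D U f \<Longrightarrow> (\<And>x. x \<in> U \<Longrightarrow> has_parity b (val f x)) \<Longrightarrow> z \<in> W \<Longrightarrow> has_parity b (val (cot_pull D f) z)"
  unfolding cot_pull_def by (rule proj.spull_hom(8))

lemma sderiv_cot_pull:
  assumes "superfun_on D U f" "z \<in> W" "a \<in> coords D"
  shows "val (sderiv D2 (Pos a) (cot_pull D f)) z = val (cot_pull D (sderiv D a f)) z"
    and "val (sderiv D2 (Mom a) (cot_pull D f)) z = 0"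
proof -
  have d: "val (sderiv D2 u (scoord D2 (Pos i))) z = (if Pos i = u then 1 else 0)"
    if "u \<in> coords D2" "i \<in> coords D" for u i
    using sderiv_scoord [of "Pos i" D2 u z] that dom2 by simp
  show "val (sderiv D2 (Pos a) (cot_pull D f)) z = val (cot_pull D (sderiv D a f)) z"
    unfolding cot_pull_def using assms
    by (simp add: proj.chain_rule d if_distrib [where f = "\<lambda>x. x * _"] cong: if_cong)
  show "val (sderiv D2 (Mom a) (cot_pull D f)) z = 0"
    unfolding cot_pull_def using assms by (simp add: proj.chain_rule d)
qed

lemma superfun_mom: "superfun_on D2 W (scoord D2 u)"
  by (rule superfun_scoord [OF Wopen])

lemma sderiv_D2:
  "superfun_on D2 W F \<Longrightarrow> a \<in> coords D \<Longrightarrow> superfun_on D2 W (sderiv D2 (Pos a) F)"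
  "superfun_on D2 W F \<Longrightarrow> a \<in> coords D \<Longrightarrow> superfun_on D2 W (sderiv D2 (Mom a) F)"
  by (auto intro: superfun_sderiv [OF dom2])

text \<open>The bracket for possibly inhomogeneous \<open>F\<close>, with the signs moved out of the derivatives.\<close>

definition bracket :: "'a cot sfun \<Rightarrow> 'a cot sfun \<Rightarrow> 'a cot sfun" where
  "bracket F G = ssum (\<lambda>a.
     sadd (smul (spar (a \<in> od D) (sderiv D2 (Mom a) F)) (sderiv D2 (Pos a) G))
          (sscale (- kos (a \<in> od D) (a \<in> od D))
            (smul (spar (a \<in> od D) (sderiv D2 (Pos a) F)) (sderiv D2 (Mom a) G)))) (coords D)"

lemma val_poisson:
  assumes "superfun_on D2 W F" "z \<in> W"
  shows "val (poisson D F G) z = val (bracket F G) z"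
  unfolding poisson_def bracket_def val_simps spar_twist par_sign_kos
  by (intro sum.cong refl) (simp add: sderiv_spar [OF dom2 _ assms(2,1)])

lemma superfun_bracket:
  assumes "superfun_on D2 W F" "superfun_on D2 W G" shows "superfun_on D2 W (bracket F G)"
  unfolding bracket_def
  by (intro superfun_ssum superfun_sadd superfun_smul superfun_sscale superfun_spar sderiv_D2 assms Wopen)

lemma superfun_poisson:
  assumes "superfun_on D2 W F" "superfun_on D2 W G" shows "superfun_on D2 W (poisson D F G)"
  by (rule superfun_cong [OF Wopen superfun_bracket [OF assms]]) (simp add: val_poisson [OF assms(1)])

text \<open>\<open>case_cot (scoord D) g\<close> is the section of the cotangent bundle with momenta
  \<open>g\<close>. It serves for the graph of the differential of \<open>r\<close> and for the zero
  section.\<close>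

lemma morphism_section:
  assumes "\<And>a. a \<in> coords D \<Longrightarrow> superfun_on D U (g a)"
    and "\<And>a x. a \<in> coords D \<Longrightarrow> x \<in> U \<Longrightarrow> has_parity (a \<in> od D) (val (g a) x)"
  shows "superdomain_morphism D U D2 W (case_cot (scoord D) g)"
proof
  fix u assume u: "u \<in> coords D2"
  show "superfun_on D U (case u of Pos x \<Rightarrow> scoord D x | Mom x \<Rightarrow> g x)"
    using u assms Uopen by (cases u) (auto simp: superfun_scoord)
  show "has_parity (u \<in> od D2) (val (case u of Pos x \<Rightarrow> scoord D x | Mom x \<Rightarrow> g x) x)" if "x \<in> U" for x
    using u assms that scoord_has_parity [of _ D] by (cases u) auto
next
  fix x assume x: "x \<in> U"
  have "i \<notin> od D" if "i \<in> ev D" for i using dom that by blast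
  then have "(\<chi> i. body_map D2 (case_cot (scoord D) g) x $ Pos i) = x"
    using dom_open_subset [OF Uopen x] by (auto simp: body_map_def scoord_def body_space_def vec_eq_iff)
  moreover have "body_map D2 (case_cot (scoord D) g) x \<in> body_space D2"
    by (simp add: body_map_def body_space_def)
  ultimately show "body_map D2 (case_cot (scoord D) g) x \<in> W" using x by (simp add: cot_dom_def)
qed (use dom dom2 in auto)

text \<open>A section followed by the bundle projection is the identity, so functoriality reduces
  the claim to \<open>spull_scoord\<close>.\<close>

lemma section_cot_pull:
  assumes "superdomain_morphism D U D2 W (case_cot (scoord D) g)" "superfun_on D U f" "x \<in> U"
  shows "val (spull D2 (cot_pull D f) (case_cot (scoord D) g)) x = val f x"
proof -
  interpret s: superdomain_morphism D U D2 W "case_cot (scoord D) g" by fact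
  have "val (spull D2 (cot_pull D f) (case_cot (scoord D) g)) x =
      val (spull D f (\<lambda>i. spull D2 (scoord D2 (Pos i)) (case_cot (scoord D) g))) x"
    unfolding cot_pull_def by (rule spull_spull [OF assms(1) proj.superdomain_morphism_axioms assms(2,3)])
  also have "\<dots> = val (spull D f (scoord D)) x"
    by (rule spull_point_cong) (simp add: s.spull_hom(5) [OF assms(3)])
  also have "\<dots> = val f x" by (rule spull_scoord [OF dom assms(2,3)])
  finally show ?thesis .
qed

end

section \<open>Translation of the fibres by the differential of an even function\<close>

locale cot_shift = cot_domain D U for D :: "'a::{finite,linorder} sdim" and U +
  fixes r :: "'a sfun"
  assumes r: "superfun_on D U r" and r_even: "\<And>x. x \<in> U \<Longrightarrow> has_parity False (val r x)"
begin

abbreviation "dr a \<equiv> sderiv D a r"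
abbreviation "y a \<equiv> cot_pull D (dr a)"

definition \<sigma> :: "'a cot \<Rightarrow> 'a cot sfun" where
  "\<sigma> u = (case u of Pos a \<Rightarrow> scoord D2 (Pos a) | Mom a \<Rightarrow> sadd (scoord D2 (Mom a)) (y a))"

lemma \<sigma>_simps [simp]: "\<sigma> (Pos a) = scoord D2 (Pos a)" "\<sigma> (Mom a) = sadd (scoord D2 (Mom a)) (y a)"
  by (auto simp: \<sigma>_def)

lemma dr: "a \<in> coords D \<Longrightarrow> superfun_on D U (dr a)"
  by (rule superfun_sderiv [OF dom r])

lemma dr_parity: "a \<in> coords D \<Longrightarrow> x \<in> U \<Longrightarrow> has_parity (a \<in> od D) (val (dr a) x)"
  using sderiv_has_parity [OF dom _ _ r r_even, of a x] by simp

lemma y: "a \<in> coords D \<Longrightarrow> superfun_on D2 W (y a)"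
  by (intro superfun_cot_pull dr)

lemma y_parity: "a \<in> coords D \<Longrightarrow> z \<in> W \<Longrightarrow> has_parity (a \<in> od D) (val (y a) z)"
  by (intro cot_pull_parity dr dr_parity)

sublocale shift: superdomain_morphism D2 W D2 W \<sigma>
proof
  fix u assume u: "u \<in> coords D2"
  show "superfun_on D2 W (\<sigma> u)"
    using u by (cases u) (auto intro!: superfun_sadd superfun_mom y Wopen)
  show "has_parity (u \<in> od D2) (val (\<sigma> u) z)" if "z \<in> W" for z
    using u that scoord_has_parity [of u D2 z] by (cases u) (auto intro!: has_parity_add y_parity)
next
  fix z assume z: "z \<in> W"
  have "i \<notin> od D" if "i \<in> ev D" for i using dom that by blast
  then have "(\<chi> i. body_map D2 \<sigma> z $ Pos i) = (\<chi> i. z $ Pos i)"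
    using z by (auto simp: body_map_def scoord_def vec_eq_iff cot_dom_def body_space_def)
  moreover have "body_map D2 \<sigma> z \<in> body_space D2"
    by (simp add: body_map_def body_space_def)
  ultimately show "body_map D2 \<sigma> z \<in> W" using z by (simp add: cot_dom_def)
qed (use dom2 in auto)

text \<open>Translation along the fibres covers the identity of the base.\<close>

lemma shift_cot_pull:
  assumes "superfun_on D U f" "z \<in> W" shows "val (spull D2 (cot_pull D f) \<sigma>) z = val (cot_pull D f) z"
proof -
  have "val (spull D2 (cot_pull D f) \<sigma>) z = val (spull D f (\<lambda>i. spull D2 (scoord D2 (Pos i)) \<sigma>)) z"
    unfolding cot_pull_def
    by (rule spull_spull [OF shift.superdomain_morphism_axioms proj.superdomain_morphism_axioms assms])
  also have "\<dots> = val (cot_pull D f) z"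
    unfolding cot_pull_def by (rule spull_point_cong) (simp add: shift.spull_hom(5) [OF assms(2)])
  finally show ?thesis .
qed

lemma sderiv_\<sigma>:
  assumes "a \<in> coords D" "b \<in> coords D" "z \<in> W"
  shows "val (sderiv D2 (Pos a) (\<sigma> (Pos b))) z = (if a = b then 1 else 0)"
    "val (sderiv D2 (Mom a) (\<sigma> (Pos b))) z = 0"
    "val (sderiv D2 (Mom a) (\<sigma> (Mom b))) z = (if a = b then 1 else 0)"
    "val (sderiv D2 (Pos a) (\<sigma> (Mom b))) z = val (cot_pull D (sderiv D a (dr b))) z"
  using assms dom2 sderiv_cot_pull [OF dr [OF assms(2)] assms(3,1)]
  by (simp_all add: sderiv_scoord sderiv_sadd [where D = D2 and U = W] superfun_mom y)

abbreviation "R a b \<equiv> cot_pull D (sderiv D a (dr b))"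

lemma sderiv_shift:
  assumes "superfun_on D2 W F" "a \<in> coords D" "z \<in> W"
  shows "val (sderiv D2 (Mom a) (spull D2 F \<sigma>)) z = val (spull D2 (sderiv D2 (Mom a) F) \<sigma>) z"
    and "val (sderiv D2 (Pos a) (spull D2 F \<sigma>)) z = val (spull D2 (sderiv D2 (Pos a) F) \<sigma>) z +
      (\<Sum>b\<in>coords D. val (R a b) z * val (spull D2 (sderiv D2 (Mom b) F) \<sigma>) z)"
  using assms by (simp_all add: shift.chain_rule sum_cot_coords sderiv_\<sigma> del: \<sigma>_simps
      add: if_distrib [where f = "\<lambda>x. x * _"] cong: if_cong)

lemma R_parity:
  assumes "a \<in> coords D" "b \<in> coords D" "z \<in> W"
  shows "has_parity ((a \<in> od D) \<noteq> (b \<in> od D)) (val (R a b) z)"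
proof (rule cot_pull_parity [OF _ _ assms(3)])
  show "superfun_on D U (sderiv D a (dr b))" by (rule superfun_sderiv [OF dom dr assms(1)]) fact
  show "has_parity ((a \<in> od D) \<noteq> (b \<in> od D)) (val (sderiv D a (dr b)) x)" if "x \<in> U" for x
    using sderiv_has_parity [OF dom assms(1) that dr [OF assms(2)] dr_parity [OF assms(2)]]
    by (simp add: eq_commute [of "a \<in> od D"])
qed

lemma R_sym:
  assumes "a \<in> coords D" "b \<in> coords D" "z \<in> W"
  shows "val (R b a) z = kos (a \<in> od D) (b \<in> od D) *\<^sub>R val (R a b) z"
proof -
  let ?k = "kos (a \<in> od D) (b \<in> od D)"
  have "val (R b a) z = val (cot_pull D (sscale ?k (sderiv D a (dr b)))) z"
    by (rule cot_pull_cong [OF assms(3)]) (simp add: sderiv_commute [OF dom assms(2,1) _ r] kos_sym)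
  also have "\<dots> = ?k *\<^sub>R val (R a b) z"
    unfolding cot_pull_def by (rule proj.spull_hom(3) [OF assms(3) superfun_sderiv [OF dom dr [OF assms(2)] assms(1)]])
  finally show ?thesis .
qed

text \<open>The graph of \<open>dr\<close> is Lagrangian: the terms with second derivatives of \<open>r\<close> cancel in pairs.\<close>

theorem poisson_shift:
  assumes "superfun_on D2 W F" "superfun_on D2 W G" "z \<in> W"
  shows "val (poisson D (spull D2 F \<sigma>) (spull D2 G \<sigma>)) z = val (spull D2 (poisson D F G) \<sigma>) z"
proof -
  let ?p = "\<lambda>a. a \<in> od D" and ?R = "\<lambda>a b. val (R a b) z"
  let ?P = "\<lambda>F a. val (spull D2 (sderiv D2 (Mom a) F) \<sigma>) z"
    and ?X = "\<lambda>F a. val (spull D2 (sderiv D2 (Pos a) F) \<sigma>) z"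
  let ?k = "\<lambda>a. kos (?p a) (?p a)"
  \<comment> \<open>\<open>?A\<close> and \<open>?B\<close> collect the terms with second
    derivatives of \<open>r\<close>, one from each half of the bracket.\<close>
  let ?A = "\<Sum>a\<in>coords D. \<Sum>b\<in>coords D. gpar (?p a) (?P F a) * (?R a b * ?P G b)"
  let ?B = "\<Sum>a\<in>coords D. \<Sum>b\<in>coords D. ?k a *\<^sub>R (gpar (?p a) (?R a b * ?P F b) * ?P G a)"
  have "val (poisson D (spull D2 F \<sigma>) (spull D2 G \<sigma>)) z =
      (\<Sum>a\<in>coords D. gpar (?p a) (?P F a) * ?X G a - ?k a *\<^sub>R (gpar (?p a) (?X F a) * ?P G a)) + (?A - ?B)"
    using assms
    by (simp add: val_poisson shift.superfun_spull bracket_def sderiv_shift algebra_simps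
        sum.distrib sum_subtractf sum_negf sum_distrib_left sum_distrib_right scaleR_sum_right gpar_sum)
  also have "(\<Sum>a\<in>coords D. gpar (?p a) (?P F a) * ?X G a - ?k a *\<^sub>R (gpar (?p a) (?X F a) * ?P G a)) =
      val (spull D2 (bracket F G) \<sigma>) z"
    unfolding bracket_def using assms(3) Wopen
    by (subst shift.spull_hom(4)) (auto simp: shift.spull_hom assms sderiv_D2
        superfun_sadd superfun_smul superfun_spar superfun_sscale intro!: sum.cong)
  also have "\<dots> = val (spull D2 (poisson D F G) \<sigma>) z"
    by (rule shift.val_spull_cong [OF assms(3)]) (simp add: val_poisson [OF assms(1)])
  also have "?A = ?B"
  proof -
    \<comment> \<open>The summand of \<open>?A\<close> at \<open>(a, b)\<close> equals that of
      \<open>?B\<close> at \<open>(b, a)\<close>. Three signs cancel: one from the graded symmetry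
      of \<open>?R\<close>, one from applying \<open>gpar\<close> to the homogeneous
      \<open>?R a b\<close>, and \<open>?k b\<close> from the bracket.\<close>
    have "gpar (?p a) (?P F a) * (?R a b * ?P G b) = ?k b *\<^sub>R (gpar (?p b) (?R b a * ?P F a) * ?P G b)"
      if ab: "a \<in> coords D" "b \<in> coords D" for a b
    proof -
      have g: "gpar (?p a \<noteq> ?p b) (gpar (?p a) (?P F a)) = gpar (?p b) (?P F a)"
        by (cases "?p a"; cases "?p b") auto
      have k: "?k b * kos (?p a) (?p b) * kos (?p b) (?p a \<noteq> ?p b) = 1" by (auto simp: kos_def)
      have "gpar (?p a) (?P F a) * ?R a b = ?R a b * gpar (?p b) (?P F a)"
        unfolding has_parity_commute' [OF R_parity [OF ab assms(3)]] g ..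
      moreover have "gpar (?p b) (?R b a * ?P F a) =
          (kos (?p a) (?p b) * kos (?p b) (?p a \<noteq> ?p b)) *\<^sub>R (?R a b * gpar (?p b) (?P F a))"
        using gpar_has_parity [OF R_parity [OF ab assms(3)]] by (simp add: gpar_mult R_sym [OF ab assms(3)])
      ultimately show ?thesis using k by (simp add: mult.assoc [symmetric])
    qed
    then show ?thesis by (subst sum.swap) (simp cong: sum.cong)
  qed
  finally show ?thesis by simp
qed

text \<open>The Hamiltonian action of \<open>r\<close> is the vertical derivative along \<open>dr\<close>, an even derivation.\<close>

definition sdel :: "'a cot sfun \<Rightarrow> 'a cot sfun" where
  "sdel F = ssum (\<lambda>a. smul (y a) (sderiv D2 (Mom a) F)) (coords D)"

text \<open>Since \<open>r\<close> does not depend on the momenta, only the first half of the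
  bracket survives. Moving \<open>y a\<close>, which has the parity of \<open>a\<close>, to the
  front removes the involution that the bracket puts on the derivative of \<open>F\<close>.\<close>

lemma val_poisson_r:
  assumes "superfun_on D2 W F" "z \<in> W"
  shows "val (poisson D F (cot_pull D r)) z = val (sdel F) z"
proof -
  have "gpar (a \<in> od D) (val (sderiv D2 (Mom a) F) z) * val (y a) z = val (y a) z * val (sderiv D2 (Mom a) F) z"
    if "a \<in> coords D" for a
    by (rule has_parity_commute [OF y_parity [OF that assms(2)], symmetric])
  then show ?thesis
    unfolding val_poisson [OF assms] bracket_def sdel_def val_simps val_spar
    using sderiv_cot_pull [OF r assms(2)] by (intro sum.cong refl) simp
qed

lemma sdel_cong:
  "z \<in> W \<Longrightarrow> (\<And>z. z \<in> W \<Longrightarrow> val F z = val G z) \<Longrightarrow> val (sdel F) z = val (sdel G) z"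
  unfolding sdel_def val_simps
  by (intro sum.cong refl arg_cong2 [where f = "(*)"] sderiv_cong [OF dom2]) auto

lemma sdel_mom:
  assumes "a \<in> coords D" "z \<in> W" shows "val (sdel (scoord D2 (Mom a))) z = val (y a) z"
  using assms dom2
  by (simp add: sdel_def sderiv_scoord if_distrib [where f = "\<lambda>x. _ * x"] cong: if_cong)

lemma sdel_cot_pull:
  assumes "superfun_on D U f" "z \<in> W" shows "val (sdel (cot_pull D f)) z = 0"
  by (simp add: sdel_def sderiv_cot_pull [OF assms])

text \<open>Each summand pairs a derivative with a coefficient of the same parity, so no sign
  remains: carrying \<open>y a\<close> across \<open>F\<close> undoes the involution of the graded
  Leibniz rule.\<close>

lemma sdel_smul:
  assumes "superfun_on D2 W F" "superfun_on D2 W G" "z \<in> W"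
  shows "val (sdel (smul F G)) z = val (sdel F) z * val G z + val F z * val (sdel G) z"
proof -
  have "val (y a) z * val (sderiv D2 (Mom a) (smul F G)) z =
      val (y a) z * val (sderiv D2 (Mom a) F) z * val G z + val F z * (val (y a) z * val (sderiv D2 (Mom a) G) z)"
    if a: "a \<in> coords D" for a
  proof -
    have "val (y a) z * gpar (a \<in> od D) (val F z) = val F z * val (y a) z"
      using has_parity_commute [OF y_parity [OF a assms(3)], of "gpar (a \<in> od D) (val F z)"] by simp
    then have "val (y a) z * (gpar (a \<in> od D) (val F z) * b) = val F z * (val (y a) z * b)" for b
      by (simp flip: mult.assoc)
    then show ?thesis using sderiv_smul [OF dom2 _ assms(3,1,2), of "Mom a"] a
      by (simp add: distrib_left mult.assoc)
  qed
  then show ?thesis by (simp add: sdel_def sum.distrib sum_distrib_left sum_distrib_right)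
qed

lemma sdel_sadd:
  assumes "superfun_on D2 W F" "superfun_on D2 W G" "z \<in> W"
  shows "val (sdel (sadd F G)) z = val (sdel F) z + val (sdel G) z"
  using assms by (simp add: sdel_def sderiv_sadd [OF dom2] distrib_left sum.distrib)

lemma sdel_sscale:
  assumes "superfun_on D2 W F" "z \<in> W"
  shows "val (sdel (sscale c F)) z = c *\<^sub>R val (sdel F) z"
  using assms by (simp add: sdel_def sderiv_sscale [OF dom2] scaleR_sum_right)

lemma sdel_ssum:
  assumes "\<And>k. k \<in> A \<Longrightarrow> superfun_on D2 W (K k)" "z \<in> W"
  shows "val (sdel (ssum K A)) z = (\<Sum>k\<in>A. val (sdel (K k)) z)"
proof -
  have "val (sdel (ssum K A)) z = (\<Sum>a\<in>coords D. \<Sum>k\<in>A. val (y a) z * val (sderiv D2 (Mom a) (K k)) z)"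
    using assms by (simp add: sdel_def sderiv_ssum [OF dom2] sum_distrib_left)
  also have "\<dots> = (\<Sum>k\<in>A. val (sdel (K k)) z)"
    by (subst sum.swap) (simp add: sdel_def)
  finally show ?thesis .
qed

lemma morphism_dr: "superdomain_morphism D U D2 W (case_cot (scoord D) dr)"
  by (rule morphism_section) (auto intro: dr dr_parity)

end

section \<open>Fiberwise quadratic Hamiltonians\<close>

locale quadratic = cot_shift +
  fixes h :: "'a \<Rightarrow> 'a \<Rightarrow> 'a sfun" and H :: "'a cot sfun"
  assumes h: "\<And>a b. a \<in> coords D \<Longrightarrow> b \<in> coords D \<Longrightarrow> superfun_on D U (h a b)"
    and H: "superfun_on D2 W H"
    and H_eq: "\<And>z. z \<in> W \<Longrightarrow> val H z = val (sscale (1 / 2) (ssum (\<lambda>(a, b).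
        smul (cot_pull D (h a b)) (smul (scoord D2 (Mom b)) (scoord D2 (Mom a)))) (coords D \<times> coords D))) z"
begin

text \<open>Leaving the quadratic monomial \<open>q a b\<close> open makes the Hamiltonian, its
  brackets with \<open>r\<close> and its value on the differential instances of one shape, with
  \<open>p\<close> gradually replaced by \<open>y\<close>.\<close>

abbreviation "form q \<equiv> sscale (1 / 2) (ssum (\<lambda>(a, b). smul (cot_pull D (h a b)) (q a b)) (coords D \<times> coords D))"
abbreviation "p a \<equiv> scoord D2 (Mom a)"

lemma val_form: "val (form q) z = (1 / 2) *\<^sub>R (\<Sum>(a, b)\<in>coords D \<times> coords D. val (cot_pull D (h a b)) z * val (q a b) z)"
  by (simp add: case_prod_unfold)

lemma H_form: "z \<in> W \<Longrightarrow> val H z = val (form (\<lambda>a b. smul (p b) (p a))) z"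
  by (rule H_eq)

text \<open>The coefficients are functions of the base and hence constants for the vertical
  derivation, which therefore acts on \<open>q\<close> alone.\<close>

lemma sdel_form:
  assumes q: "\<And>a b. a \<in> coords D \<Longrightarrow> b \<in> coords D \<Longrightarrow> superfun_on D2 W (q a b)" and "z \<in> W"
  shows "val (sdel (form q)) z = val (form (\<lambda>a b. sdel (q a b))) z"
proof -
  have s: "superfun_on D2 W (case k of (a, b) \<Rightarrow> smul (cot_pull D (h a b)) (q a b))"
    if "k \<in> coords D \<times> coords D" for k
    using that by (auto intro!: superfun_smul superfun_cot_pull h Wopen q)
  have "val (sdel (smul (cot_pull D (h a b)) (q a b))) z = val (cot_pull D (h a b)) z * val (sdel (q a b)) z"
    if "a \<in> coords D" "b \<in> coords D" for a b
    using sdel_smul [OF superfun_cot_pull [OF h] q assms(2)] sdel_cot_pull [OF h assms(2)] that by simp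
  moreover have "val (sdel (form q)) z = (1 / 2) *\<^sub>R (\<Sum>k\<in>coords D \<times> coords D.
      val (sdel (case k of (a, b) \<Rightarrow> smul (cot_pull D (h a b)) (q a b))) z)"
    by (subst sdel_sscale [OF _ assms(2)], intro superfun_ssum Wopen s, assumption,
        subst sdel_ssum [OF _ assms(2)], rule s, assumption, rule refl)
  ultimately show ?thesis
    unfolding val_form by (simp only:) (intro arg_cong [where f = "scaleR _"] sum.cong, auto)
qed

lemma form_cong:
  "(\<And>a b. a \<in> coords D \<Longrightarrow> b \<in> coords D \<Longrightarrow> val (q a b) z = val (q' a b) z) \<Longrightarrow> val (form q) z = val (form q') z"
  unfolding val_form by (intro arg_cong [where f = "scaleR _"] sum.cong) auto

lemma poisson_H_r:
  assumes "z \<in> W"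
  shows "val (poisson D H (cot_pull D r)) z = val (form (\<lambda>a b. sadd (smul (y b) (p a)) (smul (p b) (y a)))) z"
proof -
  have "val (poisson D H (cot_pull D r)) z = val (sdel H) z" by (rule val_poisson_r [OF H assms])
  also have "\<dots> = val (sdel (form (\<lambda>a b. smul (p b) (p a)))) z"
    using assms H_form by (rule sdel_cong)
  also have "\<dots> = val (form (\<lambda>a b. sdel (smul (p b) (p a)))) z"
    by (rule sdel_form [OF superfun_smul [OF Wopen superfun_mom superfun_mom] assms])
  also have "\<dots> = val (form (\<lambda>a b. sadd (smul (y b) (p a)) (smul (p b) (y a)))) z"
    by (rule form_cong) (simp add: sdel_smul superfun_mom sdel_mom assms)
  finally show ?thesis .
qed

text \<open>The factor two counts the two orders of replacement: each of
  \<open>smul (y b) (p a)\<close> and \<open>smul (p b) (y a)\<close> yields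
  \<open>smul (y b) (y a)\<close>, while \<open>y\<close> itself is killed by the
  derivation.\<close>

lemma poisson_H_r_r:
  assumes "z \<in> W"
  shows "val (poisson D (poisson D H (cot_pull D r)) (cot_pull D r)) z = 2 *\<^sub>R val (form (\<lambda>a b. smul (y b) (y a))) z"
proof -
  have s: "superfun_on D2 W (sadd (smul (y b) (p a)) (smul (p b) (y a)))" if "a \<in> coords D" "b \<in> coords D" for a b
    using that by (intro superfun_sadd superfun_smul superfun_mom y Wopen)
  have "val (poisson D (poisson D H (cot_pull D r)) (cot_pull D r)) z = val (sdel (poisson D H (cot_pull D r))) z"
    by (rule val_poisson_r [OF superfun_poisson [OF H superfun_cot_pull [OF r]] assms])
  also have "\<dots> = val (sdel (form (\<lambda>a b. sadd (smul (y b) (p a)) (smul (p b) (y a))))) z"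
    using assms poisson_H_r by (rule sdel_cong)
  also have "\<dots> = val (form (\<lambda>a b. sdel (sadd (smul (y b) (p a)) (smul (p b) (y a))))) z"
    by (rule sdel_form [OF s assms])
  also have "\<dots> = val (form (\<lambda>a b. sscale 2 (smul (y b) (y a)))) z"
    by (rule form_cong) (simp add: sdel_smul sdel_sadd superfun_smul Wopen superfun_mom y sdel_mom
        sdel_cot_pull [OF dr] assms scaleR_2)
  also have "\<dots> = 2 *\<^sub>R val (form (\<lambda>a b. smul (y b) (y a))) z"
    unfolding val_form by (simp add: scaleR_sum_right case_prod_unfold)
  finally show ?thesis .
qed

lemma spull_form:
  assumes "superdomain_morphism D' U' D2 W \<Psi>" "x \<in> U'"
    and q: "\<And>a b. a \<in> coords D \<Longrightarrow> b \<in> coords D \<Longrightarrow> superfun_on D2 W (q a b)"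
  shows "val (spull D2 (form q) \<Psi>) x = (1 / 2) *\<^sub>R (\<Sum>(a, b)\<in>coords D \<times> coords D.
    val (spull D2 (cot_pull D (h a b)) \<Psi>) x * val (spull D2 (q a b) \<Psi>) x)"
proof -
  interpret m: superdomain_morphism D' U' D2 W \<Psi> by fact
  have s: "superfun_on D2 W (case k of (a, b) \<Rightarrow> smul (cot_pull D (h a b)) (q a b))"
    if "k \<in> coords D \<times> coords D" for k
    using that by (auto intro!: superfun_smul superfun_cot_pull h Wopen q)
  have "val (spull D2 (form q) \<Psi>) x = (1 / 2) *\<^sub>R (\<Sum>k\<in>coords D \<times> coords D.
      val (spull D2 (case k of (a, b) \<Rightarrow> smul (cot_pull D (h a b)) (q a b)) \<Psi>) x)"
    by (subst m.spull_hom(3) [OF assms(2)], intro superfun_ssum Wopen s, assumption,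
        subst m.spull_hom(4) [OF assms(2)], rule s, assumption, rule refl)
  then show ?thesis
    using m.spull_hom(2) [OF assms(2) superfun_cot_pull [OF h] q]
    by (simp add: case_prod_unfold cong: sum.cong) (intro arg_cong [where f = "scaleR _"] sum.cong, auto)
qed

text \<open>Substitution is multiplicative, so the product of the translated momenta expands into
  parts of degree two, one and zero in \<open>p\<close>. The last part is kept as a form because it
  measures the failure of the equation for \<open>r\<close>.\<close>

theorem shift_H:
  assumes "z \<in> W"
  shows "val (spull D2 H \<sigma>) z = val H z + val (poisson D H (cot_pull D r)) z +
    val (form (\<lambda>a b. smul (y b) (y a))) z"
proof -
  have "val (spull D2 H \<sigma>) z = val (spull D2 (form (\<lambda>a b. smul (p b) (p a))) \<sigma>) z"
    using assms H_form by (rule shift.val_spull_cong)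
  also have "\<dots> = val (form (\<lambda>a b. smul (sadd (p b) (y b)) (sadd (p a) (y a)))) z"
    unfolding val_form
      spull_form [OF shift.superdomain_morphism_axioms assms superfun_smul [OF Wopen superfun_mom superfun_mom]]
    by (intro arg_cong [where f = "scaleR _"] sum.cong)
      (auto simp: shift_cot_pull [OF h assms] shift.spull_hom(2,5) [OF assms] superfun_mom)
  also have "\<dots> = val (form (\<lambda>a b. smul (p b) (p a))) z +
      val (form (\<lambda>a b. sadd (smul (y b) (p a)) (smul (p b) (y a)))) z + val (form (\<lambda>a b. smul (y b) (y a))) z"
    unfolding val_form
    by (simp add: algebra_simps case_prod_unfold sum.distrib flip: scaleR_add_right)
  finally show ?thesis using H_form [OF assms] poisson_H_r [OF assms] by simp
qed

lemma spull_H_dr: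
  assumes "x \<in> U"
  shows "val (spull D2 H (case_cot (scoord D) dr)) x =
    (1 / 2) *\<^sub>R (\<Sum>(a, b)\<in>coords D \<times> coords D. val (h a b) x * (val (dr b) x * val (dr a) x))"
proof -
  interpret s: superdomain_morphism D U D2 W "case_cot (scoord D) dr" by (rule morphism_dr)
  have "val (spull D2 H (case_cot (scoord D) dr)) x =
      val (spull D2 (form (\<lambda>a b. smul (p b) (p a))) (case_cot (scoord D) dr)) x"
    using assms H_form by (rule s.val_spull_cong)
  also have "\<dots> = (1 / 2) *\<^sub>R (\<Sum>(a, b)\<in>coords D \<times> coords D. val (h a b) x * (val (dr b) x * val (dr a) x))"
    unfolding spull_form [OF morphism_dr assms superfun_smul [OF Wopen superfun_mom superfun_mom]]
    by (intro arg_cong [where f = "scaleR _"] sum.cong)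
      (auto simp: section_cot_pull [OF morphism_dr h assms] s.spull_hom(2,5) [OF assms] superfun_mom)
  finally show ?thesis .
qed

text \<open>Links the momentum-free part of \<open>shift_H\<close> with the Hamiltonian evaluated on
  the differential of \<open>r\<close>, which lives on the base.\<close>

lemma form_dr:
  assumes "z \<in> W"
  shows "val (cot_pull D (spull D2 H (case_cot (scoord D) dr))) z = val (form (\<lambda>a b. smul (y b) (y a))) z"
proof -
  let ?q = "sscale (1 / 2) (ssum (\<lambda>(a, b). smul (h a b) (smul (dr b) (dr a))) (coords D \<times> coords D))"
  have s: "superfun_on D U (case k of (a, b) \<Rightarrow> smul (h a b) (smul (dr b) (dr a)))"
    if "k \<in> coords D \<times> coords D" for k
    using that by (auto intro!: superfun_smul h dr Uopen)
  have "val (cot_pull D (spull D2 H (case_cot (scoord D) dr))) z = val (cot_pull D ?q) z"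
    by (rule cot_pull_cong [OF assms]) (simp add: spull_H_dr case_prod_unfold)
  also have "\<dots> = (1 / 2) *\<^sub>R (\<Sum>k\<in>coords D \<times> coords D.
      val (cot_pull D (case k of (a, b) \<Rightarrow> smul (h a b) (smul (dr b) (dr a)))) z)"
    unfolding cot_pull_def
    by (subst proj.spull_hom(3) [OF assms], intro superfun_ssum Uopen s, assumption,
        subst proj.spull_hom(4) [OF assms], rule s, assumption, rule refl)
  also have "\<dots> = val (form (\<lambda>a b. smul (y b) (y a))) z"
    unfolding val_form
    by (intro arg_cong [where f = "scaleR _"] sum.cong)
      (auto simp: cot_pull_def proj.spull_hom(2) [OF assms] superfun_smul h dr Uopen)
  finally show ?thesis .
qed

text \<open>The bracket lives on the cotangent bundle and the equation on the base. Pullback to the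
  bundle loses nothing, since composing with a section, here the graph of the differential, recovers
  the original function.\<close>

lemma vanishing_iff:
  "(\<forall>x\<in>U. val (spull D2 H (case_cot (scoord D) dr)) x = 0) \<longleftrightarrow>
   (\<forall>z\<in>W. val (poisson D (poisson D H (cot_pull D r)) (cot_pull D r)) z = 0)"
proof -
  let ?f = "spull D2 H (case_cot (scoord D) dr)"
  interpret s: superdomain_morphism D U D2 W "case_cot (scoord D) dr" by (rule morphism_dr)
  have "(\<forall>x\<in>U. val ?f x = 0) \<longleftrightarrow> (\<forall>z\<in>W. val (cot_pull D ?f) z = 0)"
  proof (intro iffI ballI)
    fix z assume "\<forall>x\<in>U. val ?f x = 0" "z \<in> W"
    then have "val (cot_pull D ?f) z = val (cot_pull D szero) z" by (intro cot_pull_cong) auto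
    then show "val (cot_pull D ?f) z = 0" using \<open>z \<in> W\<close> by (simp add: cot_pull_def proj.spull_hom(7))
  next
    fix x assume *: "\<forall>z\<in>W. val (cot_pull D ?f) z = 0" and x: "x \<in> U"
    have "val ?f x = val (spull D2 (cot_pull D ?f) (case_cot (scoord D) dr)) x"
      by (rule section_cot_pull [OF morphism_dr s.superfun_spull [OF H] x, symmetric])
    also have "\<dots> = val (spull D2 szero (case_cot (scoord D) dr)) x"
      using * by (intro s.val_spull_cong x) simp
    finally show "val ?f x = 0" using x by (simp add: s.spull_hom(7))
  qed
  then show ?thesis by (simp add: form_dr poisson_H_r_r)
qed

end

section \<open>Globalization\<close>

locale super_mfd =
  fixes M :: "('m, 'a::{finite,linorder}, 'c) smfd"
  assumes M: "supermanifold M"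
begin

abbreviation "D \<equiv> sdim M"
abbreviation "DT \<equiv> cot_dim D"

lemma disjoint: "ev D \<inter> od D = {}" using M by (simp add: supermanifold_def)

lemma chart_map:
  assumes "c \<in> charts M"
  shows "openin (carrier_top M) (chart_dom M c)" "dom_open D (img M c)"
    "homeomorphic_map (subtopology (carrier_top M) (chart_dom M c)) (top_of_set (img M c)) (chart M c)"
  using M assms by (auto simp: supermanifold_def)

lemma superdomain_img: "c \<in> charts M \<Longrightarrow> superdomain D (img M c)"
  using disjoint chart_map by blast

lemma overlap_subset: "overlap M c d \<subseteq> img M c"
  by (auto simp: overlap_def img_def)

text \<open>A chart is a homeomorphism onto its image, so the overlap is open in the image, which is
  open in the body space.\<close>

lemma superdomain_overlap:
  assumes "c \<in> charts M" "d \<in> charts M" shows "superdomain D (overlap M c d)"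
proof
  let ?X = "subtopology (carrier_top M) (chart_dom M c)"
  have "openin ?X (chart_dom M c \<inter> chart_dom M d)"
    using chart_map(1) [OF assms(2)] by (auto simp: openin_subtopology)
  then have "openin (top_of_set (img M c)) (overlap M c d)"
    using homeomorphic_imp_open_map [OF chart_map(3) [OF assms(1)]] by (simp add: open_map_def overlap_def)
  then show "dom_open D (overlap M c d)" using chart_map(2) [OF assms(1)] openin_trans by blast
qed (rule disjoint)

lemma trans_body:
  assumes "c \<in> charts M" "d \<in> charts M" "q \<in> chart_dom M c \<inter> chart_dom M d"
  shows "body_map D (trans M c d) (chart M c q) = chart M d q"
proof -
  have "chart M d q \<in> img M d" using assms by (auto simp: img_def)
  then have "chart M d q $ i = 0" if "i \<notin> ev D" for i
    using dom_open_subset [OF chart_map(2) [OF assms(2)]] that by (simp add: body_space_def)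
  moreover have "trans M c d i {} (chart M c q) = chart M d q $ i" if "i \<in> ev D" for i
    using M assms that unfolding supermanifold_def by blast
  ultimately show ?thesis by (auto simp: body_map_def vec_eq_iff)
qed

lemma trans_morphism:
  assumes "c \<in> charts M" "d \<in> charts M"
  shows "superdomain_morphism D (overlap M c d) D (overlap M d c) (trans M c d)"
proof
  have ev: "superfun_on D (overlap M c d) (trans M c d i) \<and> even_on (overlap M c d) (trans M c d i)"
    if "i \<in> ev D" for i using M assms that unfolding supermanifold_def by blast
  have od: "superfun_on D (overlap M c d) (trans M c d i) \<and> odd_on (overlap M c d) (trans M c d i)"
    if "i \<in> od D" for i using M assms that unfolding supermanifold_def by blast
  fix i assume i: "i \<in> coords D"
  show "superfun_on D (overlap M c d) (trans M c d i)" using i ev od by (auto simp: coords_def)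
  show "has_parity (i \<in> od D) (val (trans M c d i) x)" if "x \<in> overlap M c d" for x
    using i disjoint
    by (rule coords_cases) (use ev od that in \<open>auto simp: has_parity_simps even_on_val odd_on_val\<close>)
next
  fix x assume "x \<in> overlap M c d"
  then obtain q where q: "q \<in> chart_dom M c \<inter> chart_dom M d" "x = chart M c q" by (auto simp: overlap_def)
  then have "body_map D (trans M c d) x = chart M d q" using trans_body [OF assms] by simp
  then show "body_map D (trans M c d) x \<in> overlap M d c" using q by (auto simp: overlap_def)
qed (use superdomain_overlap assms in auto)

text \<open>The cocycle condition is applied to the charts \<open>c\<close>, \<open>d\<close>,
  \<open>c\<close>, and the transition from \<open>c\<close> to itself is the identity.\<close>

lemma trans_inverse:
  assumes "c \<in> charts M" "d \<in> charts M" "superfun_on D (overlap M c d) f" "x \<in> overlap M c d"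
  shows "val (spull D (spull D f (trans M d c)) (trans M c d)) x = val f x"
proof -
  have "val (spull D (spull D f (trans M d c)) (trans M c d)) x =
      val (spull D f (\<lambda>i. spull D (trans M d c i) (trans M c d))) x"
    by (rule spull_spull [OF trans_morphism trans_morphism]) (use assms in auto)
  also have "\<dots> = val (spull D f (scoord D)) x"
  proof (rule spull_point_cong)
    fix i assume i: "i \<in> coords D"
    have "sfun_eq_on (chart M c ` (chart_dom M c \<inter> chart_dom M d \<inter> chart_dom M c))
        (trans M c c i) (spull D (trans M d c i) (trans M c d))"
      using M assms i unfolding supermanifold_def by blast
    moreover have "x \<in> chart M c ` (chart_dom M c \<inter> chart_dom M d \<inter> chart_dom M c)"
      using assms(4) by (auto simp: overlap_def)
    ultimately have "val (spull D (trans M d c i) (trans M c d)) x = val (trans M c c i) x"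
      unfolding sfun_eq_on_val by metis
    moreover have "sfun_eq_on (img M c) (trans M c c i) (scoord D i)"
      using M assms i unfolding supermanifold_def by blast
    ultimately show "val (spull D (trans M d c i) (trans M c d)) x = val (scoord D i) x"
      using overlap_subset assms(4) by (auto simp: sfun_eq_on_val)
  qed
  also have "\<dots> = val f x"
    by (rule spull_scoord [OF superdomain_overlap assms(3,4)]) (use assms in auto)
  finally show ?thesis .
qed

lemma chart_cot_shift:
  assumes "r \<in> smooth_functions M" "fun_even M r" "c \<in> charts M"
  shows "cot_shift D (img M c) (r c)"
proof
  show "superfun_on D (img M c) (r c)" using assms by (simp add: smooth_functions_def)
  show "has_parity False (val (r c) x)" if "x \<in> img M c" for x
    using assms that by (simp add: fun_even_def even_on_val has_parity_simps)
qed (use superdomain_img assms in blast)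

lemma overlap_cot_shift:
  assumes "r \<in> smooth_functions M" "fun_even M r" "c \<in> charts M" "d \<in> charts M"
  shows "cot_shift D (overlap M c d) (r c)"
proof -
  interpret cot_shift D "img M c" "r c" by (rule chart_cot_shift [OF assms(1-3)])
  show ?thesis
  proof
    show "superfun_on D (overlap M c d) (r c)" by (rule superfun_subset [OF r overlap_subset])
    show "has_parity False (val (r c) x)" if "x \<in> overlap M c d" for x
      using that overlap_subset by (blast intro: r_even)
  qed (use superdomain_overlap assms in blast)
qed

end

lemma shift_momenta_\<sigma>:
  assumes "cot_shift (sdim M) U (r c)"
  shows "shift_momenta M H r c = spull (cot_dim (sdim M)) (H c) (cot_shift.\<sigma> (sdim M) (r c))"
proof -
  have "cot_shift.\<sigma> (sdim M) (r c) = (\<lambda>u. case u of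
      Pos a \<Rightarrow> scoord (cot_dim (sdim M)) (Pos a)
    | Mom a \<Rightarrow> sadd (scoord (cot_dim (sdim M)) (Mom a)) (cot_pull (sdim M) (sderiv (sdim M) a (r c))))"
    by (rule ext) (rule cot_shift.\<sigma>_def [OF assms])
  then show ?thesis by (simp add: shift_momenta_def)
qed

section \<open>Coordinate changes of the cotangent bundle\<close>

locale transition = super_mfd M for M :: "('m, 'a::{finite,linorder}, 'c) smfd" +
  fixes c d assumes c: "c \<in> charts M" and d: "d \<in> charts M"
begin

abbreviation "t \<equiv> trans M c d"
abbreviation "s \<equiv> trans M d c"
abbreviation "T \<equiv> cot_trans M c d"

sublocale t: superdomain_morphism D "overlap M c d" D "overlap M d c" t
  by (rule trans_morphism [OF c d])
sublocale s: superdomain_morphism D "overlap M d c" D "overlap M c d" s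
  by (rule trans_morphism [OF d c])
sublocale C: cot_domain D "overlap M c d" by unfold_locales (rule superdomain_overlap [OF c d])
sublocale C': cot_domain D "overlap M d c" by unfold_locales (rule superdomain_overlap [OF d c])

text \<open>The derivative of the coordinate \<open>a\<close> of the chart \<open>c\<close> by the
  coordinate \<open>b\<close> of the chart \<open>d\<close>, expressed in the coordinates of
  \<open>c\<close>: the coefficient in the transformation of momenta.\<close>

abbreviation "jac b a \<equiv> spull D (sderiv D b (s a)) t"

lemma superfun_jac:
  assumes "a \<in> coords D" "b \<in> coords D" shows "superfun_on D (overlap M c d) (jac b a)"
  by (rule t.superfun_spull [OF superfun_sderiv [OF s.dom' s.sf [OF assms(1)] assms(2)]])

lemma jac_parity:
  assumes "a \<in> coords D" "b \<in> coords D" "x \<in> overlap M c d"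
  shows "has_parity ((a \<in> od D) \<noteq> (b \<in> od D)) (val (jac b a) x)"
  by (rule t.spull_hom(8) [OF assms(3) superfun_sderiv [OF s.dom' s.sf [OF assms(1)] assms(2)]])
    (rule s.sderiv_\<Phi>_parity [OF assms(1,2)])

lemma T_simps:
  "T (Pos i) = cot_pull D (t i)"
  "T (Mom b) = ssum (\<lambda>a. smul (cot_pull D (jac b a)) (scoord DT (Mom a))) (coords D)"
  by (simp_all add: cot_trans_def)

sublocale T: superdomain_morphism DT C.W DT C'.W T
proof
  fix u assume u: "u \<in> coords DT"
  show "superfun_on DT C.W (T u)"
    using u by (cases u) (auto simp: T_simps intro!: C.superfun_cot_pull t.sf superfun_ssum superfun_smul
        C.superfun_mom superfun_jac C.Wopen)
  show "has_parity (u \<in> od DT) (val (T u) z)" if z: "z \<in> C.W" for z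
  proof (cases u)
    case (Pos i)
    then show ?thesis using u z by (auto simp: T_simps intro!: C.cot_pull_parity t.sf t.par)
  next
    case (Mom b)
    have "has_parity (b \<in> od D) (val (cot_pull D (jac b a)) z * val (scoord DT (Mom a)) z)" if a: "a \<in> coords D" for a
    proof -
      have b: "b \<in> coords D" using u Mom by simp
      have "has_parity ((a \<in> od D) \<noteq> (b \<in> od D)) (val (cot_pull D (jac b a)) z)"
        by (rule C.cot_pull_parity [OF superfun_jac [OF a b] jac_parity [OF a b] z])
      then have "has_parity (((a \<in> od D) \<noteq> (b \<in> od D)) \<noteq> (a \<in> od D)) (val (cot_pull D (jac b a)) z * val (scoord DT (Mom a)) z)"
        using scoord_has_parity [of "Mom a" DT z] by (intro has_parity_mult) auto
      moreover have "(((a \<in> od D) \<noteq> (b \<in> od D)) \<noteq> (a \<in> od D)) = (b \<in> od D)" by auto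
      ultimately show ?thesis by simp
    qed
    then show ?thesis using Mom by (auto simp: T_simps intro!: has_parity_sum)
  qed
next
  fix z assume z: "z \<in> C.W"
  let ?x = "\<chi> i. z $ Pos i"
  have "z \<in> body_space DT" and x: "?x \<in> overlap M c d" using z by (auto simp: cot_dom_def)
  \<comment> \<open>Apart from the support condition, only the base coordinates decide whether a
    point lies in the target domain, and on these the lifted transition has the body of
    \<open>t\<close>.\<close>
  have "(\<chi> i. body_map DT T z $ Pos i) = body_map D t ?x"
  proof -
    have "cot_pull D f {} z = f {} ?x" for f
    proof -
      have "cot_pull D f {} z = gc (gpull D f (\<lambda>i. val (scoord DT (Pos i)) z)) {}"
        unfolding cot_pull_def val_spull [symmetric] gc_val ..
      also have "\<dots> = f {} (gbody D (\<lambda>i. val (scoord DT (Pos i)) z))"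
        by (rule grassmann_point.gpull_body [OF C.proj.point [OF z]])
      also have "gbody D (\<lambda>i. val (scoord DT (Pos i)) z) = ?x"
      proof -
        have "i \<notin> od D" if "i \<in> ev D" for i using disjoint that by blast
        then show ?thesis using \<open>z \<in> body_space DT\<close> by (auto simp: gbody_def scoord_def body_space_def vec_eq_iff)
      qed
      finally show ?thesis .
    qed
    then show ?thesis by (simp add: body_map_def T_simps vec_eq_iff)
  qed
  moreover have "body_map DT T z \<in> body_space DT" by (simp add: body_map_def body_space_def)
  ultimately show "body_map DT T z \<in> C'.W" using t.body [OF x] by (simp add: cot_dom_def)
qed (use C.dom2 C'.dom2 in auto)

text \<open>The lifted transition covers \<open>t\<close>: changing the chart and projecting agrees
  with projecting and changing the chart. Functoriality reduces both sides to the pullback of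
  \<open>f\<close> along this common map.\<close>

lemma T_cot_pull:
  assumes "superfun_on D (overlap M d c) f" "z \<in> C.W"
  shows "val (spull DT (cot_pull D f) T) z = val (cot_pull D (spull D f t)) z"
proof -
  have "val (spull DT (cot_pull D f) T) z = val (spull D f (\<lambda>i. spull DT (scoord DT (Pos i)) T)) z"
    unfolding cot_pull_def
    by (rule spull_spull [OF T.superdomain_morphism_axioms C'.proj.superdomain_morphism_axioms assms])
  also have "\<dots> = val (spull D f (\<lambda>i. spull D (t i) (\<lambda>i. scoord DT (Pos i)))) z"
    by (rule spull_point_cong) (simp add: T.spull_hom(5) [OF assms(2)] T_simps cot_pull_def)
  also have "\<dots> = val (cot_pull D (spull D f t)) z"
    unfolding cot_pull_def
    by (rule spull_spull [OF C.proj.superdomain_morphism_axioms t.superdomain_morphism_axioms assms, symmetric])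
  finally show ?thesis .
qed

text \<open>Partial derivatives of \<open>r\<close> transform with the same Jacobian as the momenta.
  This is why adding them to the momenta does not depend on the chart.\<close>

lemma differential_transform:
  assumes rc: "superfun_on D (overlap M c d) rc"
    and rd: "\<And>y. y \<in> overlap M d c \<Longrightarrow> val rd y = val (spull D rc s) y"
    and b: "b \<in> coords D" and x: "x \<in> overlap M c d"
  shows "val (spull D (sderiv D b rd) t) x = (\<Sum>a\<in>coords D. val (jac b a) x * val (sderiv D a rc) x)"
proof -
  have dr: "superfun_on D (overlap M c d) (sderiv D a rc)" if "a \<in> coords D" for a
    by (rule superfun_sderiv [OF C.dom rc that])
  have ds: "superfun_on D (overlap M d c) (sderiv D b (s a))" if "a \<in> coords D" for a
    by (rule superfun_sderiv [OF s.dom' s.sf [OF that] b])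
  have "val (spull D (sderiv D b rd) t) x =
      val (spull D (ssum (\<lambda>a. smul (sderiv D b (s a)) (spull D (sderiv D a rc) s)) (coords D)) t) x"
  proof (rule t.val_spull_cong [OF x])
    fix y assume y: "y \<in> overlap M d c"
    have "val (sderiv D b rd) y = val (sderiv D b (spull D rc s)) y"
      by (rule sderiv_cong [OF s.dom' b y rd])
    then show "val (sderiv D b rd) y =
        val (ssum (\<lambda>a. smul (sderiv D b (s a)) (spull D (sderiv D a rc) s)) (coords D)) y"
      by (simp add: s.chain_rule [OF rc y b])
  qed
  also have "\<dots> = (\<Sum>a\<in>coords D. val (spull D (smul (sderiv D b (s a)) (spull D (sderiv D a rc) s)) t) x)"
    by (intro t.spull_hom(4) x superfun_smul t.Vopen ds s.superfun_spull dr)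
  also have "\<dots> = (\<Sum>a\<in>coords D. val (jac b a) x * val (sderiv D a rc) x)"
    by (intro sum.cong refl)
      (simp add: t.spull_hom(2) [OF x ds s.superfun_spull [OF dr]] trans_inverse [OF c d dr x])
  finally show ?thesis .
qed

lemma shift_transition:
  assumes "H \<in> cot_functions M" "r \<in> smooth_functions M" "fun_even M r" "z \<in> C.W"
  shows "val (shift_momenta M H r c) z = val (spull DT (shift_momenta M H r d) T) z"
proof -
  interpret c: cot_shift D "overlap M c d" "r c" by (rule overlap_cot_shift [OF assms(2,3) c d])
  interpret d: cot_shift D "overlap M d c" "r d" by (rule overlap_cot_shift [OF assms(2,3) d c])
  have H: "superfun_on DT C'.W (H d)"
    using assms(1) d superfun_subset cot_dom_mono [OF overlap_subset] unfolding cot_functions_def by blast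
  have Hc: "val (H c) z = val (spull DT (H d) T) z" if "z \<in> C.W" for z
    using assms(1) c d that by (auto simp: cot_functions_def sfun_eq_on_val)
  have rd: "val (r d) y = val (spull D (r c) s) y" if "y \<in> overlap M d c" for y
    using assms(2) c d that by (auto simp: smooth_functions_def sfun_eq_on_val)
  \<comment> \<open>The square of morphisms commutes: translating in \<open>c\<close> and then
    changing the chart equals changing the chart and then translating in \<open>d\<close>. It
    suffices to compare components; for a momentum, linearity of \<open>T (Mom b)\<close> splits off
    the contribution of \<open>r\<close>, which \<open>differential_transform\<close>
    identifies.\<close>
  have key: "val (spull DT (T u) c.\<sigma>) z = val (spull DT (d.\<sigma> u) T) z" if u: "u \<in> coords DT" for u
  proof (cases u)
    case (Pos i)
    then show ?thesis using u assms(4) by (simp add: T_simps c.shift_cot_pull t.sf T.spull_hom(5))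
  next
    case (Mom b)
    then have b: "b \<in> coords D" using u by simp
    have "val (spull DT (T u) c.\<sigma>) z =
        (\<Sum>a\<in>coords D. val (spull DT (smul (cot_pull D (jac b a)) (scoord DT (Mom a))) c.\<sigma>) z)"
      unfolding Mom T_simps
      by (intro c.shift.spull_hom(4) assms(4) superfun_smul C.Wopen C.superfun_mom C.superfun_cot_pull superfun_jac b)
    also have "\<dots> = (\<Sum>a\<in>coords D. val (cot_pull D (jac b a)) z * (val (scoord DT (Mom a)) z + val (c.y a) z))"
      using assms(4) b
      by (intro sum.cong refl) (simp add: c.shift.spull_hom(2,5) C.superfun_mom C.superfun_cot_pull superfun_jac
          c.shift_cot_pull)
    also have "\<dots> = val (T (Mom b)) z + (\<Sum>a\<in>coords D. val (cot_pull D (jac b a)) z * val (c.y a) z)"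
      by (simp add: T_simps distrib_left sum.distrib)
    also have "(\<Sum>a\<in>coords D. val (cot_pull D (jac b a)) z * val (c.y a) z) =
        (\<Sum>a\<in>coords D. val (cot_pull D (smul (jac b a) (c.dr a))) z)"
      unfolding cot_pull_def by (intro sum.cong refl C.proj.spull_hom(2) [symmetric] assms(4) superfun_jac c.dr b)
    also have "\<dots> = val (cot_pull D (ssum (\<lambda>a. smul (jac b a) (c.dr a)) (coords D))) z"
      unfolding cot_pull_def
      by (intro C.proj.spull_hom(4) [symmetric] assms(4) superfun_smul superfun_jac c.dr b C.Uopen)
    also have "\<dots> = val (cot_pull D (spull D (d.dr b) t)) z"
      by (rule C.cot_pull_cong [OF assms(4)]) (simp add: differential_transform [OF c.r rd b])
    also have "\<dots> = val (spull DT (d.y b) T) z"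
      by (rule T_cot_pull [OF d.dr [OF b] assms(4), symmetric])
    also have "val (T (Mom b)) z + \<dots> = val (spull DT (d.\<sigma> u) T) z"
      unfolding Mom using b assms(4)
      by (simp add: T.spull_hom(1,5) C'.superfun_mom d.y)
    finally show ?thesis .
  qed
  have "val (shift_momenta M H r c) z = val (spull DT (H c) c.\<sigma>) z"
    by (simp add: shift_momenta_\<sigma> [where r = r and c = c, OF c.cot_shift_axioms])
  also have "\<dots> = val (spull DT (spull DT (H d) T) c.\<sigma>) z"
    by (rule c.shift.val_spull_cong [OF assms(4) Hc])
  also have "\<dots> = val (spull DT (H d) (\<lambda>u. spull DT (T u) c.\<sigma>)) z"
    by (rule spull_spull [OF c.shift.superdomain_morphism_axioms T.superdomain_morphism_axioms H assms(4)])
  also have "\<dots> = val (spull DT (H d) (\<lambda>u. spull DT (d.\<sigma> u) T)) z"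
    by (rule spull_point_cong) (rule key)
  also have "\<dots> = val (spull DT (spull DT (H d) d.\<sigma>) T) z"
    by (rule spull_spull [OF T.superdomain_morphism_axioms d.shift.superdomain_morphism_axioms H assms(4), symmetric])
  finally show ?thesis by (simp add: shift_momenta_\<sigma> [where r = r and c = d, OF d.cot_shift_axioms])
qed

end

text \<open>The equations are checked chart by chart; overlaps enter only in showing that the
  shifted Hamiltonian is a function on the cotangent bundle.\<close>

theorem theorem4:
  fixes M :: "('m, 'a::{finite,linorder}, 'c) smfd"
    and H :: "'c \<Rightarrow> 'a cot sfun"
    and r :: "'c \<Rightarrow> 'a sfun"
  assumes "supermanifold M"
    and "H \<in> cot_functions M" and "cot_odd M H"
    and "cot_eq M (poisson_bracket M H H) (\<lambda>c. szero)"
    and "r \<in> smooth_functions M" and "fun_even M r"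
  shows "(shift_momenta M H r \<in> cot_functions M \<and> cot_odd M (shift_momenta M H r)) \<and>
    cot_eq M (poisson_bracket M (shift_momenta M H r) (shift_momenta M H r)) (\<lambda>c. szero) \<and>
    (fun_eq M (at_differential M H r) (\<lambda>c. szero) \<longrightarrow>
       fun_eq M (zero_section_restrict M (shift_momenta M H r)) (\<lambda>c. szero)) \<and>
    (fiberwise_quadratic M H \<longrightarrow>
       (fun_eq M (at_differential M H r) (\<lambda>c. szero) \<longleftrightarrow>
          cot_eq M (schouten_bracket M H r r) (\<lambda>c. szero)) \<and>
       (cot_eq M (schouten_bracket M H r r) (\<lambda>c. szero) \<longrightarrow>
          cot_eq M (shift_momenta M H r)
            (\<lambda>c. sadd (H c) (poisson_bracket M H (lift M r) c))))"
proof -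
  interpret super_mfd M by unfold_locales (rule assms(1))
  have shift: "cot_shift D (img M c) (r c)" if "c \<in> charts M" for c
    by (rule chart_cot_shift [OF assms(5,6) that])
  have H: "superfun_on DT (cot_dom D (img M c)) (H c)" if "c \<in> charts M" for c
    using assms(2) that by (simp add: cot_functions_def)
  have H': "shift_momenta M H r c = spull DT (H c) (cot_shift.\<sigma> D (r c))" if "c \<in> charts M" for c
    by (rule shift_momenta_\<sigma> [where r = r and c = c, OF shift [OF that]])
  have at_diff: "at_differential M H r c = spull DT (H c) (case_cot (scoord D) (\<lambda>a. sderiv D a (r c)))" for c
    by (simp add: at_differential_def)

  have global: "shift_momenta M H r \<in> cot_functions M"
    unfolding cot_functions_def
  proof (intro CollectI conjI ballI)
    fix c assume c: "c \<in> charts M"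
    interpret cot_shift D "img M c" "r c" by (rule shift [OF c])
    show "superfun_on DT (cot_dom D (img M c)) (shift_momenta M H r c)"
      unfolding H' [OF c] by (rule shift.superfun_spull [OF H [OF c]])
    fix d assume d: "d \<in> charts M"
    interpret transition M c d by unfold_locales (use c d in auto)
    show "sfun_eq_on (cot_dom D (overlap M c d)) (shift_momenta M H r c) (spull DT (shift_momenta M H r d) T)"
      unfolding sfun_eq_on_val using shift_transition [OF assms(2,5,6)] by blast
  qed

  have odd: "cot_odd M (shift_momenta M H r)"
    unfolding cot_odd_def odd_on_val has_parity_simps(1) [symmetric]
  proof (intro ballI)
    fix c z assume c: "c \<in> charts M" and z: "z \<in> cot_dom D (img M c)"
    interpret cot_shift D "img M c" "r c" by (rule shift [OF c])
    have "has_parity True (val (H c) z)" if "z \<in> cot_dom D (img M c)" for z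
      using assms(3) c that by (simp add: cot_odd_def odd_on_val has_parity_simps)
    then show "has_parity True (val (shift_momenta M H r c) z)"
      unfolding H' [OF c] by (rule shift.spull_hom(8) [OF z H [OF c]])
  qed

  have bracket: "cot_eq M (poisson_bracket M (shift_momenta M H r) (shift_momenta M H r)) (\<lambda>c. szero)"
    unfolding cot_eq_def sfun_eq_on_val poisson_bracket_def
  proof (intro ballI)
    fix c z assume c: "c \<in> charts M" and z: "z \<in> cot_dom D (img M c)"
    interpret cot_shift D "img M c" "r c" by (rule shift [OF c])
    have "val (poisson D (H c) (H c)) z = val szero z" if "z \<in> cot_dom D (img M c)" for z
      using assms(4) c that by (simp add: cot_eq_def sfun_eq_on_val poisson_bracket_def)
    then have "val (spull DT (poisson D (H c) (H c)) \<sigma>) z = val (spull DT szero \<sigma>) z"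
      by (rule shift.val_spull_cong [OF z])
    then show "val (poisson D (shift_momenta M H r c) (shift_momenta M H r c)) z = val szero z"
      unfolding H' [OF c] using poisson_shift [OF H [OF c] H [OF c] z] by (simp add: shift.spull_hom(7) [OF z])
  qed

  \<comment> \<open>The zero section followed by the translation is the graph of the differential,
    so restricting the shifted function amounts to evaluating \<open>H\<close> on that
    graph.\<close>
  have zero_section: "val (zero_section_restrict M (shift_momenta M H r) c) x = val (at_differential M H r c) x"
    if c: "c \<in> charts M" and x: "x \<in> img M c" for c x
  proof -
    interpret cot_shift D "img M c" "r c" by (rule shift [OF c])
    let ?\<zeta> = "case_cot (scoord D) (\<lambda>a. szero)"
    interpret \<zeta>: superdomain_morphism D "img M c" DT W ?\<zeta>
      by (rule morphism_section) (use Uopen in \<open>auto simp: superfun_szero\<close>)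
    have "val (zero_section_restrict M (shift_momenta M H r) c) x = val (spull DT (spull DT (H c) \<sigma>) ?\<zeta>) x"
      by (simp add: zero_section_restrict_def H' [OF c])
    also have "\<dots> = val (spull DT (H c) (\<lambda>u. spull DT (\<sigma> u) ?\<zeta>)) x"
      by (rule spull_spull [OF \<zeta>.superdomain_morphism_axioms shift.superdomain_morphism_axioms H [OF c] x])
    also have "\<dots> = val (spull DT (H c) (case_cot (scoord D) dr)) x"
    proof (rule spull_point_cong)
      fix u assume "u \<in> coords DT"
      then show "val (spull DT (\<sigma> u) ?\<zeta>) x = val (case_cot (scoord D) dr u) x"
        by (cases u) (auto simp: \<zeta>.spull_hom(1,5) [OF x] superfun_mom y
            section_cot_pull [OF \<zeta>.superdomain_morphism_axioms dr x])
    qed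
    finally show ?thesis by (simp add: at_diff)
  qed

  have quad: "quadratic D (img M c) (r c) h (H c)"
    if "c \<in> charts M"
      and "\<forall>a\<in>coords D. \<forall>b\<in>coords D. superfun_on D (img M c) (h a b)"
      and "sfun_eq_on (cot_dom D (img M c)) (H c) (sscale (1 / 2) (ssum (\<lambda>(a, b).
          smul (cot_pull D (h a b)) (smul (scoord DT (Mom b)) (scoord DT (Mom a))))
          (coords D \<times> coords D)))" for c h
    by (rule quadratic.intro [OF shift [OF that(1)]], unfold_locales)
      (use that H in \<open>auto simp: sfun_eq_on_val\<close>)

  have quadratic: "(fun_eq M (at_differential M H r) (\<lambda>c. szero) \<longleftrightarrow>
        cot_eq M (schouten_bracket M H r r) (\<lambda>c. szero)) \<and>
      (cot_eq M (schouten_bracket M H r r) (\<lambda>c. szero) \<longrightarrow>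
        cot_eq M (shift_momenta M H r) (\<lambda>c. sadd (H c) (poisson_bracket M H (lift M r) c)))"
    if q: "fiberwise_quadratic M H"
  proof (intro conjI impI)
    have "(\<forall>x\<in>img M c. val (at_differential M H r c) x = 0) \<longleftrightarrow>
        (\<forall>z\<in>cot_dom D (img M c). val (schouten_bracket M H r r c) z = 0)" if c: "c \<in> charts M" for c
    proof -
      obtain h where "quadratic D (img M c) (r c) h (H c)"
        using q c quad [OF c] unfolding fiberwise_quadratic_def by blast
      then interpret quadratic D "img M c" "r c" h "H c" .
      show ?thesis
        unfolding at_diff schouten_bracket_def poisson_bracket_def lift_def by (rule vanishing_iff)
    qed
    then show "fun_eq M (at_differential M H r) (\<lambda>c. szero) \<longleftrightarrow> cot_eq M (schouten_bracket M H r r) (\<lambda>c. szero)"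
      by (simp add: fun_eq_def cot_eq_def sfun_eq_on_val)
    assume S: "cot_eq M (schouten_bracket M H r r) (\<lambda>c. szero)"
    show "cot_eq M (shift_momenta M H r) (\<lambda>c. sadd (H c) (poisson_bracket M H (lift M r) c))"
      unfolding cot_eq_def sfun_eq_on_val
    proof (intro ballI)
      fix c z assume c: "c \<in> charts M" and z: "z \<in> cot_dom D (img M c)"
      obtain h where "quadratic D (img M c) (r c) h (H c)"
        using q c quad [OF c] unfolding fiberwise_quadratic_def by blast
      then interpret quadratic D "img M c" "r c" h "H c" .
      \<comment> \<open>\<open>X\<close> is the value of the Hamiltonian on the differential of
        \<open>r\<close>, pulled back to the cotangent bundle. The Schouten bracket is twice
        \<open>X\<close> and vanishes, which leaves the first two terms of
        \<open>shift_H\<close>.\<close>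
      define X where "X = val (form (\<lambda>a b. smul (y b) (y a))) z"
      have "val (schouten_bracket M H r r c) z = 2 *\<^sub>R X"
        unfolding schouten_bracket_def poisson_bracket_def lift_def X_def by (rule poisson_H_r_r [OF z])
      moreover have "val (schouten_bracket M H r r c) z = 0"
        using S c z by (simp add: cot_eq_def sfun_eq_on_val)
      ultimately have "X = 0" by simp
      then show "val (shift_momenta M H r c) z = val (sadd (H c) (poisson_bracket M H (lift M r) c)) z"
        unfolding H' [OF c] poisson_bracket_def lift_def val_simps(1) shift_H [OF z] X_def [symmetric] by simp
    qed
  qed

  have zero: "fun_eq M (at_differential M H r) (\<lambda>c. szero) \<longrightarrow>
      fun_eq M (zero_section_restrict M (shift_momenta M H r)) (\<lambda>c. szero)"
    unfolding fun_eq_def sfun_eq_on_val using zero_section by simp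
  show ?thesis
    by (intro conjI global odd bracket zero impI [OF quadratic])
qed

end
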